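(* Let $N\in\mathbb{N}$. The space $\mathbb{D}(\mathbb{R}^N)$ is a Hilbert space and the embedding $\mathbb{D}(\mathbb{R}^N)\hookrightarrow L^2(\mathbb{R}^N)$ is compact. The maps $\iota:L^2_g(\mathbb{S}^N)\to L^2(\mathbb{R}^N)$ and $\iota:\mathbb{H}(\mathbb{S}^N)\to\mathbb{D}(\mathbb{R}^N)$ are isometric isomorphisms. Moreover, $$\|v\|_{\mathbb{D}(\mathbb{R}^N)}=\left(\mathcal{E}_L(v,v)+\int_{\mathbb{R}^N}v^2\ln\phi^{-2}\,dx+(\kappa-A_N)\int_{\mathbb{R}^N}v^2\,dx\right)^{1/2}\qquad\text{for }v\in C_c^\infty(\mathbb{R}^N),$$ and $$\langle v_1,v_2\rangle_{\mathbb{D}(\mathbb{R}^N)}=\mathcal{E}_L(v_1,v_2)+\int_{\mathbb{R}^N}v_1v_2\,(\kappa-A_N+\ln\phi^{-2})\,dx\qquad\text{for }v_1,v_2\in C_c^\infty(\mathbb{R}^N).$$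
   Context: $\mathbb{S}^N\subset\mathbb{R}^{N+1}$ is the unit sphere with round metric $g$ and volume element $dV_g$, and $L^2_g(\mathbb{S}^N)$ is the corresponding $L^2$ space; $|z-\zeta|$ is the Euclidean distance in $\mathbb{R}^{N+1}$; $\psi=\Gamma'/\Gamma$, $c_N=\pi^{-N/2}\Gamma(\tfrac N2)$, $A_N=2\psi(\tfrac N2)$, $\rho_N=2\ln2+\psi(\tfrac N2)-\gamma$, $\gamma=-\Gamma'(1)$, and $\kappa>\max\{2(\psi(\tfrac N2)-\psi(\tfrac N4)),A_N,1\}$ is a fixed constant. $\mathbb{H}(\mathbb{S}^N)$ is the completion of $C^\infty(\mathbb{S}^N)$ with respect to the norm induced by $$\langle u_1,u_2\rangle_{\mathbb{H}(\mathbb{S}^N)}=\frac{c_N}{2}\int_{\mathbb{S}^N}\int_{\mathbb{S}^N}\frac{(u_1(z)-u_1(\zeta))(u_2(z)-u_2(\zeta))}{|z-\zeta|^N}\,dV_g(z)\,dV_g(\zeta)+\kappa\int_{\mathbb{S}^N}u_1u_2\,dV_g;$$ equivalently $\mathbb{H}(\mathbb{S}^N)=\{u\in L^2(\mathbb{S}^N):\|u\|_{\mathbb{H}(\mathbb{S}^N)}<\infty\}$. With $\sigma^{-1}(x)=\left(\frac{2x}{1+|x|^2},\frac{1-|x|^2}{1+|x|^2}\right)$ (inverse stereographic projection), $\phi(x)=\frac2{1+|x|^2}$, let $\iota(u)(x)=\phi(x)^{N/2}u(\sigma^{-1}(x))$. Then $\mathbb{D}(\mathbb{R}^N):=\iota(\mathbb{H}(\mathbb{S}^N))$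 with $\langle v_1,v_2\rangle_{\mathbb{D}(\mathbb{R}^N)}:=\langle u_1,u_2\rangle_{\mathbb{H}(\mathbb{S}^N)}$ and $\|v_1\|_{\mathbb{D}(\mathbb{R}^N)}:=\|u_1\|_{\mathbb{H}(\mathbb{S}^N)}$ for $v_i=\iota(u_i)$, $u_i\in\mathbb{H}(\mathbb{S}^N)$. Finally, $$\mathcal{E}_L(v_1,v_2)=\frac{c_N}{2}\int_{\mathbb{R}^N}\int_{B_1(x)}\frac{(v_1(x)-v_1(y))(v_2(x)-v_2(y))}{|x-y|^N}\,dy\,dx-c_N\iint_{|x-y|\ge1}\frac{v_1(x)v_2(y)}{|x-y|^N}\,dx\,dy+\rho_N\int_{\mathbb{R}^N}v_1v_2\,dx.$$ *)

theory Defs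
  imports "HOL-Analysis.Analysis"
begin

section \<open>Constants\<close>

definition c_const :: "nat \<Rightarrow> real" where
  "c_const N = pi powr (- (real N / 2)) * Gamma (real N / 2)"

definition A_const :: "nat \<Rightarrow> real" where
  "A_const N = 2 * Digamma (real N / 2)"

definition rho_const :: "nat \<Rightarrow> real" where
  "rho_const N = 2 * ln 2 + Digamma (real N / 2) - euler_mascheroni"

section \<open>Smooth functions\<close>

text \<open>Differentiability classes on an open set, by iterated partial derivatives.\<close>

primrec Ck_on :: "nat \<Rightarrow> 'a::euclidean_space set \<Rightarrow> ('a \<Rightarrow> 'b::real_normed_vector) \<Rightarrow> bool" where
  "Ck_on 0 U f \<longleftrightarrow> continuous_on U f"
| "Ck_on (Suc k) U f \<longleftrightarrow> f differentiable_on U \<and>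
     (\<forall>b\<in>Basis. Ck_on k U (\<lambda>x. frechet_derivative f (at x) b))"

definition smooth_on_open :: "'a::euclidean_space set \<Rightarrow> ('a \<Rightarrow> 'b::real_normed_vector) \<Rightarrow> bool" where
  "smooth_on_open U f \<longleftrightarrow> open U \<and> (\<forall>k. Ck_on k U f)"

definition Cc_smooth :: "('a::euclidean_space \<Rightarrow> real) set" where
  "Cc_smooth = {v. smooth_on_open UNIV v \<and> compact (closure {x. v x \<noteq> 0})}"

section \<open>The sphere and its Riemannian volume\<close>

text \<open>
  Points of the Euclidean space of dimension N + 1 are pairs in \<open>(real ^ 'n) \<times> real\<close>, where
  N is \<open>CARD('n)\<close>; the product norm is the Euclidean one.
\<close>

definition unit_sphere :: "((real ^ 'n) \<times> real) set" where
  "unit_sphere = sphere 0 1"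

text \<open>The coefficients of the metric induced by the Euclidean inner product, in the local
  coordinates given by a parametrization \<open>F\<close>.\<close>

definition metric_coeffs ::
    "((real ^ 'n) \<Rightarrow> ((real ^ 'n) \<times> real)) \<Rightarrow> (real ^ 'n) \<Rightarrow> real ^ 'n ^ 'n" where
  "metric_coeffs F x =
     (\<chi> i j. frechet_derivative F (at x) (axis i 1) \<bullet> frechet_derivative F (at x) (axis j 1))"

definition local_param ::
    "(real ^ 'n) set \<Rightarrow> ((real ^ 'n) \<Rightarrow> ((real ^ 'n) \<times> real)) \<Rightarrow> bool" where
  "local_param U F \<longleftrightarrow> smooth_on_open U F \<and> inj_on F U \<and> F ` U \<subseteq> unit_sphere \<and>
     (\<forall>x\<in>U. inj (frechet_derivative F (at x)))"

definition is_riemannian_volume :: "((real ^ 'n) \<times> real) measure \<Rightarrow> bool" where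
  "is_riemannian_volume M \<longleftrightarrow>
     sets M = sets (restrict_space borel unit_sphere) \<and>
     (\<forall>U F. local_param U F \<longrightarrow>
       (\<forall>A\<in>sets borel. A \<subseteq> F ` U \<longrightarrow>
         emeasure M A =
           (\<integral>\<^sup>+x\<in>U \<inter> F -` A. ennreal (sqrt (det (metric_coeffs F x))) \<partial>lborel)))"

text \<open>The volume element of the round metric as a Borel measure on the sphere: the unique measure
  given in every local parametrization by the density \<open>sqrt (det g)\<close>.\<close>

definition sphere_vol :: "((real ^ 'n) \<times> real) measure" where
  "sphere_vol = (THE M. is_riemannian_volume M)"

section \<open>Function spaces modulo almost everywhere equality\<close>

text \<open>
  Elements of the spaces below are represented by Borel functions. Every notion is relative to
  equality almost everywhere, so that it is a statement on the spaces of equivalence classes.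
\<close>

definition L2_space :: "'a measure \<Rightarrow> ('a \<Rightarrow> real) set" where
  "L2_space M = {u \<in> borel_measurable M. integrable M (\<lambda>x. (u x)\<^sup>2)}"

definition L2_inner :: "'a measure \<Rightarrow> ('a \<Rightarrow> real) \<Rightarrow> ('a \<Rightarrow> real) \<Rightarrow> real" where
  "L2_inner M u w = (LINT x|M. u x * w x)"

definition norm_of :: "('v \<Rightarrow> 'v \<Rightarrow> real) \<Rightarrow> 'v \<Rightarrow> real" where
  "norm_of ip u = sqrt (ip u u)"

definition ae_linear_space :: "'a measure \<Rightarrow> ('a \<Rightarrow> real) set \<Rightarrow> bool" where
  "ae_linear_space M V \<longleftrightarrow>
     V \<subseteq> borel_measurable M \<and> (\<lambda>x. 0) \<in> V \<and>
     (\<forall>u\<in>V. \<forall>w\<in>V. (\<lambda>x. u x + w x) \<in> V) \<and>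
     (\<forall>a. \<forall>u\<in>V. (\<lambda>x. a * u x) \<in> V) \<and>
     (\<forall>u\<in>V. \<forall>w\<in>borel_measurable M. (AE x in M. w x = u x) \<longrightarrow> w \<in> V)"

definition ae_inner_product ::
    "'a measure \<Rightarrow> ('a \<Rightarrow> real) set \<Rightarrow> (('a \<Rightarrow> real) \<Rightarrow> ('a \<Rightarrow> real) \<Rightarrow> real) \<Rightarrow> bool" where
  "ae_inner_product M V ip \<longleftrightarrow>
     (\<forall>u\<in>V. \<forall>w\<in>V. \<forall>h\<in>V. (AE x in M. u x = w x) \<longrightarrow> ip u h = ip w h) \<and>
     (\<forall>u\<in>V. \<forall>w\<in>V. ip u w = ip w u) \<and>
     (\<forall>u\<in>V. \<forall>w\<in>V. \<forall>h\<in>V. ip (\<lambda>x. u x + w x) h = ip u h + ip w h) \<and>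
     (\<forall>a. \<forall>u\<in>V. \<forall>h\<in>V. ip (\<lambda>x. a * u x) h = a * ip u h) \<and>
     (\<forall>u\<in>V. 0 \<le> ip u u) \<and>
     (\<forall>u\<in>V. ip u u = 0 \<longleftrightarrow> (AE x in M. u x = 0))"

definition ae_complete ::
    "('a \<Rightarrow> real) set \<Rightarrow> (('a \<Rightarrow> real) \<Rightarrow> real) \<Rightarrow> bool" where
  "ae_complete V nm \<longleftrightarrow>
     (\<forall>f. (\<forall>n. f n \<in> V) \<and>
          (\<forall>e>0. \<exists>n0. \<forall>m\<ge>n0. \<forall>n\<ge>n0. nm (\<lambda>x. f m x - f n x) < e) \<longrightarrow>
        (\<exists>u\<in>V. (\<lambda>n. nm (\<lambda>x. f n x - u x)) \<longlonglongrightarrow> 0))"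

definition hilbert_space_ae ::
    "'a measure \<Rightarrow> ('a \<Rightarrow> real) set \<Rightarrow> (('a \<Rightarrow> real) \<Rightarrow> ('a \<Rightarrow> real) \<Rightarrow> real) \<Rightarrow> bool" where
  "hilbert_space_ae M V ip \<longleftrightarrow>
     ae_linear_space M V \<and> ae_inner_product M V ip \<and> ae_complete V (norm_of ip)"

text \<open>The inclusion is continuous and maps bounded sequences to sequences having a convergent
  subsequence.\<close>

definition compactly_embedded ::
    "('a \<Rightarrow> real) set \<Rightarrow> (('a \<Rightarrow> real) \<Rightarrow> real) \<Rightarrow>
     ('a \<Rightarrow> real) set \<Rightarrow> (('a \<Rightarrow> real) \<Rightarrow> real) \<Rightarrow> bool" where
  "compactly_embedded V nV W nW \<longleftrightarrow>
     V \<subseteq> W \<and> (\<exists>C. \<forall>u\<in>V. nW u \<le> C * nV u) \<and>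
     (\<forall>f. (\<forall>n. f n \<in> V) \<and> bounded (range (\<lambda>n. nV (f n))) \<longrightarrow>
        (\<exists>r :: nat \<Rightarrow> nat. strict_mono r \<and>
          (\<exists>w\<in>W. (\<lambda>n. nW (\<lambda>x. f (r n) x - w x)) \<longlonglongrightarrow> 0)))"

definition isometric_iso_ae ::
    "'a measure \<Rightarrow> ('a \<Rightarrow> real) set \<Rightarrow> (('a \<Rightarrow> real) \<Rightarrow> real) \<Rightarrow>
     'b measure \<Rightarrow> ('b \<Rightarrow> real) set \<Rightarrow> (('b \<Rightarrow> real) \<Rightarrow> real) \<Rightarrow>
     (('a \<Rightarrow> real) \<Rightarrow> ('b \<Rightarrow> real)) \<Rightarrow> bool" where
  "isometric_iso_ae M V nV M' W nW T \<longleftrightarrow>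
     T ` V \<subseteq> W \<and>
     (\<forall>u\<in>V. \<forall>w\<in>V. AE y in M'. T (\<lambda>x. u x + w x) y = T u y + T w y) \<and>
     (\<forall>a. \<forall>u\<in>V. AE y in M'. T (\<lambda>x. a * u x) y = a * T u y) \<and>
     (\<forall>u\<in>V. \<forall>w\<in>V. (AE y in M'. T u y = T w y) \<longleftrightarrow> (AE x in M. u x = w x)) \<and>
     (\<forall>v\<in>W. \<exists>u\<in>V. AE y in M'. T u y = v y) \<and>
     (\<forall>u\<in>V. nW (T u) = nV u)"

section \<open>The spaces on the sphere and on the Euclidean space\<close>

definition H_inner ::
    "real \<Rightarrow> (((real ^ 'n) \<times> real) \<Rightarrow> real) \<Rightarrow> (((real ^ 'n) \<times> real) \<Rightarrow> real) \<Rightarrow> real" where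
  "H_inner \<kappa> u1 u2 =
     c_const CARD('n) / 2 *
       (LINT z|sphere_vol. LINT \<zeta>|sphere_vol.
          (u1 z - u1 \<zeta>) * (u2 z - u2 \<zeta>) / norm (z - \<zeta>) ^ CARD('n)) +
     \<kappa> * (LINT z|sphere_vol. u1 z * u2 z)"

text \<open>Since the integrals in \<open>H_inner\<close> are real-valued, finiteness of the norm is expressed with
  nonnegative extended integrals.\<close>

definition H_sqnorm_ext :: "real \<Rightarrow> (((real ^ 'n) \<times> real) \<Rightarrow> real) \<Rightarrow> ennreal" where
  "H_sqnorm_ext \<kappa> u =
     ennreal (c_const CARD('n) / 2) *
       (\<integral>\<^sup>+z. (\<integral>\<^sup>+\<zeta>. ennreal ((u z - u \<zeta>)\<^sup>2 / norm (z - \<zeta>) ^ CARD('n)) \<partial>sphere_vol) \<partial>sphere_vol) +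
     ennreal \<kappa> * (\<integral>\<^sup>+z. ennreal ((u z)\<^sup>2) \<partial>sphere_vol)"

definition H_space :: "real \<Rightarrow> (((real ^ 'n) \<times> real) \<Rightarrow> real) set" where
  "H_space \<kappa> = {u \<in> L2_space sphere_vol. H_sqnorm_ext \<kappa> u < \<infinity>}"

definition inv_stereo :: "(real ^ 'n) \<Rightarrow> ((real ^ 'n) \<times> real)" where
  "inv_stereo x =
     ((2 / (1 + (norm x)\<^sup>2)) *\<^sub>R x, (1 - (norm x)\<^sup>2) / (1 + (norm x)\<^sup>2))"

definition conf_factor :: "(real ^ 'n) \<Rightarrow> real" where
  "conf_factor x = 2 / (1 + (norm x)\<^sup>2)"

definition iota :: "(((real ^ 'n) \<times> real) \<Rightarrow> real) \<Rightarrow> (real ^ 'n) \<Rightarrow> real" where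
  "iota u x = conf_factor x powr (real CARD('n) / 2) * u (inv_stereo x)"

definition D_space :: "real \<Rightarrow> ((real ^ 'n) \<Rightarrow> real) set" where
  "D_space \<kappa> = iota ` H_space \<kappa>"

text \<open>The value does not depend on the preimages: two preimages of the same function agree on the
  sphere except possibly at the point omitted by the stereographic projection.\<close>

definition D_inner :: "real \<Rightarrow> ((real ^ 'n) \<Rightarrow> real) \<Rightarrow> ((real ^ 'n) \<Rightarrow> real) \<Rightarrow> real" where
  "D_inner \<kappa> v1 v2 =
     (THE r. \<exists>u1\<in>H_space \<kappa>. \<exists>u2\<in>H_space \<kappa>. v1 = iota u1 \<and> v2 = iota u2 \<and> r = H_inner \<kappa> u1 u2)"

definition E_L :: "((real ^ 'n) \<Rightarrow> real) \<Rightarrow> ((real ^ 'n) \<Rightarrow> real) \<Rightarrow> real" where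
  "E_L v1 v2 =
     c_const CARD('n) / 2 *
       (LINT x|lborel. (LINT y:ball x 1|lborel.
          (v1 x - v1 y) * (v2 x - v2 y) / norm (x - y) ^ CARD('n))) -
     c_const CARD('n) *
       (LINT p:{p. norm (fst p - snd p) \<ge> 1}|lborel \<Otimes>\<^sub>M lborel.
          v1 (fst p) * v2 (snd p) / norm (fst p - snd p) ^ CARD('n)) +
     rho_const CARD('n) * (LINT x|lborel. v1 x * v2 x)"

end

theory Submission
  imports Defs "HOL-Complex_Analysis.Great_Picard" "HOL-Library.Diagonal_Subsequence"
begin

text \<open>
  In stereographic coordinates the chordal distance is \<open>d(x, y) = (\<phi>(x) \<phi>(y))\<^sup>1\<^sup>/\<^sup>2 |x - y|\<close>, so the round
  volume has density \<open>\<phi>\<^sup>N\<close> and \<open>\<iota>\<close> transports everything from the sphere. The Hilbert space property is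
  Fatou's lemma. Compactness: averaging against the truncated kernel \<open>max(|z - \<zeta>|, \<delta>)\<^sup>-\<^sup>N\<close>, whose mass \<open>k\<close> does
  not depend on \<open>z\<close> by rotation invariance, moves \<open>u\<close> by at most \<open>O(k\<^sup>-\<^sup>1\<^sup>/\<^sup>2)\<close> in \<open>L\<^sup>2\<close> on bounded sets; the
  averages are equicontinuous, and \<open>k\<close> tends to infinity as \<open>\<delta>\<close> tends to zero.

  For the formula, all integrands are multiplied by \<open>d\<^sup>s\<close> with \<open>s > 0\<close>, which makes every term integrable. The
  cross terms \<open>v\<^sub>1(x) v\<^sub>2(y)\<close> of the two forms then cancel, and what remains is
  \<open>\<integral> v\<^sub>1 v\<^sub>2 (k\<^sub>s - q\<^sub>s)\<close>, where \<open>k\<^sub>s\<close> is the mass of \<open>|z - \<zeta>|\<^sup>s\<^sup>-\<^sup>N\<close> on the sphere, a Beta function, and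
  \<open>q\<^sub>s(x)\<close> is the mass of \<open>d\<^sup>s |x - y|\<^sup>-\<^sup>N\<close> on the unit ball around \<open>x\<close>. Both are \<open>|S\<^sup>N\<^sup>-\<^sup>1| / s\<close> to leading
  order; the constant terms of their expansions give the digamma values and \<open>ln \<phi>\<close>.
\<close>

text \<open>The weight answers a genuine obstacle: expanding the product of differences isolates
  \<open>v\<^sub>1(x) v\<^sub>2(x)\<close> with the integral of a non-integrable kernel as its
  coefficient, so without a weight the two forms can only be compared as differences of infinities.
  A power of the chordal distance is chosen over one of \<open>|x - y|\<close> because the mass on
  the sphere is then constant by rotation invariance; the dependence on \<open>x\<close> is confined
  to the local mass \<open>q\<^sub>s(x)\<close>, where \<phi> can be frozen at \<open>x\<close>. The
  weight is symmetric, at most 2 for \<open>s \<le> 1\<close>, and tends to 1 off the diagonal, so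
  dominated convergence removes it in the end. The logarithm appears with coefficient -2 because
  \<open>c\<^sub>N |S\<^sup>N\<^sup>-\<^sup>1| = 2\<close>.

  A second obstacle is that \<open>sphere_vol\<close> is given by a description quantified over all
  charts. Existence and uniqueness of such a measure come before any integral over the sphere can be
  evaluated, and the same uniqueness later yields the invariance under reflections.\<close>

section \<open>Square integrable functions, and completeness of spaces defined by a form\<close>

lemma L2_space_iff:
  "u \<in> L2_space M \<longleftrightarrow> u \<in> borel_measurable M \<and> (\<integral>\<^sup>+x. ennreal ((u x)\<^sup>2) \<partial>M) < \<infinity>"
  unfolding L2_space_def by (auto simp: integrable_iff_bounded)

lemma L2_space_measurable [measurable_dest]: "u \<in> L2_space M \<Longrightarrow> u \<in> borel_measurable M"
  by (simp add: L2_space_def)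

lemma L2_mult_integrable:
  assumes "u \<in> L2_space M" "w \<in> L2_space M"
  shows "integrable M (\<lambda>x. u x * w x)"
proof (rule Bochner_Integration.integrable_bound)
  show "integrable M (\<lambda>x. (u x)\<^sup>2 + (w x)\<^sup>2)"
    using assms by (auto simp: L2_space_def)
  show "(\<lambda>x. u x * w x) \<in> borel_measurable M"
    using assms by (auto simp: L2_space_def)
  have "\<bar>a * b\<bar> \<le> a\<^sup>2 + b\<^sup>2" for a b :: real
    using sum_squares_bound[of "\<bar>a\<bar>" "\<bar>b\<bar>"] abs_ge_zero[of "a * b"]
    unfolding abs_mult power2_abs by linarith
  then show "AE x in M. norm (u x * w x) \<le> norm ((u x)\<^sup>2 + (w x)\<^sup>2)"
    by auto
qed

lemma L2_space_add:
  assumes "u \<in> L2_space M" "w \<in> L2_space M"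
  shows "(\<lambda>x. u x + w x) \<in> L2_space M"
proof -
  have "integrable M (\<lambda>x. (u x)\<^sup>2 + 2 * (u x * w x) + (w x)\<^sup>2)"
    using assms L2_mult_integrable[OF assms] by (auto simp: L2_space_def)
  moreover have "(\<lambda>x. (u x)\<^sup>2 + 2 * (u x * w x) + (w x)\<^sup>2) = (\<lambda>x. (u x + w x)\<^sup>2)"
    by (auto simp: power2_sum algebra_simps)
  ultimately show ?thesis
    using assms by (auto simp: L2_space_def)
qed

lemma L2_space_scale: "u \<in> L2_space M \<Longrightarrow> (\<lambda>x. a * u x) \<in> L2_space M"
  by (auto simp: L2_space_def power_mult_distrib)

lemma L2_space_diff:
  assumes "u \<in> L2_space M" "w \<in> L2_space M"
  shows "(\<lambda>x. u x - w x) \<in> L2_space M"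
  using L2_space_add[OF assms(1) L2_space_scale[OF assms(2), of "-1"]] by simp

lemma L2_space_AE_cong:
  assumes "u \<in> L2_space M" "w \<in> borel_measurable M" "AE x in M. w x = u x"
  shows "w \<in> L2_space M"
proof -
  have "(\<integral>\<^sup>+x. ennreal ((w x)\<^sup>2) \<partial>M) = (\<integral>\<^sup>+x. ennreal ((u x)\<^sup>2) \<partial>M)"
    using assms(3) by (intro nn_integral_cong_AE) auto
  then show ?thesis using assms(1,2) by (auto simp: L2_space_iff)
qed

lemma L2_inner_add:
  assumes "u \<in> L2_space M" "w \<in> L2_space M" "h \<in> L2_space M"
  shows "L2_inner M (\<lambda>x. u x + w x) h = L2_inner M u h + L2_inner M w h"
  using assms by (simp add: L2_inner_def distrib_right L2_mult_integrable)

lemma L2_inner_scale: "L2_inner M (\<lambda>x. a * u x) h = a * L2_inner M u h"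
  by (simp add: L2_inner_def mult.assoc)

lemma L2_inner_AE_cong:
  assumes "u \<in> borel_measurable M" "w \<in> borel_measurable M" "h \<in> borel_measurable M" "AE x in M. u x = w x"
  shows "L2_inner M u h = L2_inner M w h"
  unfolding L2_inner_def using assms by (intro integral_cong_AE) auto

lemma L2_inner_self_nonneg: "0 \<le> L2_inner M u u"
  by (simp add: L2_inner_def)

lemma nn_integral_sq_eq_L2_inner:
  "u \<in> L2_space M \<Longrightarrow> (\<integral>\<^sup>+x. ennreal ((u x)\<^sup>2) \<partial>M) = ennreal (L2_inner M u u)"
  unfolding L2_inner_def L2_space_def power2_eq_square by (subst nn_integral_eq_integral) auto

lemma L2_inner_self_eq_0_iff:
  assumes "u \<in> L2_space M"
  shows "L2_inner M u u = 0 \<longleftrightarrow> (AE x in M. u x = 0)"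
  using assms integral_nonneg_eq_0_iff_AE[of M "\<lambda>x. (u x)\<^sup>2"]
  by (simp add: L2_inner_def L2_space_def power2_eq_square)

text \<open>Supplies the indices of a rapidly Cauchy subsequence. The partial sums dominate
  \<open>N k\<close>, and the added \<open>k\<close> makes them strictly increasing.\<close>

lemma strict_mono_above:
  fixes N :: "nat \<Rightarrow> nat"
  obtains r :: "nat \<Rightarrow> nat" where "strict_mono r" "\<And>k. N k \<le> r k"
proof
  show "strict_mono (\<lambda>k. k + (\<Sum>i\<le>k. N i))"
    by (auto simp: strict_mono_Suc_iff)
  show "N k \<le> k + (\<Sum>i\<le>k. N i)" for k
    using member_le_sum[of k "{..k}" N] by auto
qed

text \<open>The measure may be infinite, so the increments are not compared in the norm of L^1.
  Instead their squares are weighted by \<open>2^k\<close>: a finite weighted sum at a point forces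
  geometric decay of the increments there.\<close>

lemma L2_Cauchy_AE_subseq:
  assumes f: "\<And>n. f n \<in> L2_space M"
    and Cau: "\<And>e. e > 0 \<Longrightarrow> \<exists>n0. \<forall>m\<ge>n0. \<forall>n\<ge>n0. L2_inner M (\<lambda>x. f m x - f n x) (\<lambda>x. f m x - f n x) < e"
  obtains r :: "nat \<Rightarrow> nat" and w where "strict_mono r" "w \<in> borel_measurable M"
    "AE x in M. (\<lambda>k. f (r k) x) \<longlonglongrightarrow> w x"
proof -
  let ?d = "\<lambda>m n. L2_inner M (\<lambda>x. f m x - f n x) (\<lambda>x. f m x - f n x)"
  \<comment> \<open>The rate \<open>(1/8)^k\<close> leaves the summable \<open>(1/4)^k\<close> after
    the squares are multiplied by \<open>2^k\<close>.\<close>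
  have "\<forall>k. \<exists>n0. \<forall>m\<ge>n0. \<forall>n\<ge>n0. ?d m n < (1/8)^k"
    using Cau by simp
  then obtain N where N: "\<And>k m n. m \<ge> N k \<Longrightarrow> n \<ge> N k \<Longrightarrow> ?d m n < (1/8)^k"
    by metis
  obtain r where r: "strict_mono r" "\<And>k. N k \<le> r k"
    using strict_mono_above[of N] by metis
  have [measurable]: "\<And>n. f n \<in> borel_measurable M"
    using f by (auto simp: L2_space_def)
  define g where "g k x = f (r (Suc k)) x - f (r k) x" for k x
  have g_meas [measurable]: "\<And>k. g k \<in> borel_measurable M"
    unfolding g_def by measurable
  have g_le: "(\<integral>\<^sup>+x. ennreal (2^k * (g k x)\<^sup>2) \<partial>M) \<le> ennreal ((1/4)^k)" for k
  proof -
    have "r k \<le> r (Suc k)"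
      using r(1) by (simp add: strict_mono_less_eq)
    then have "?d (r (Suc k)) (r k) < (1/8)^k"
      using r(2)[of k] by (intro N) auto
    then have "2^k * ?d (r (Suc k)) (r k) \<le> 2^k * (1/8)^k"
      by simp
    also have "\<dots> = (1/4)^k"
      by (simp add: power_mult_distrib[symmetric])
    finally have *: "2^k * ?d (r (Suc k)) (r k) \<le> (1/4)^k" .
    have "(\<integral>\<^sup>+x. ennreal (2^k * (g k x)\<^sup>2) \<partial>M) = ennreal (2^k) * (\<integral>\<^sup>+x. ennreal ((g k x)\<^sup>2) \<partial>M)"
      by (simp add: ennreal_mult nn_integral_cmult)
    also have "(\<integral>\<^sup>+x. ennreal ((g k x)\<^sup>2) \<partial>M) = ennreal (?d (r (Suc k)) (r k))"
      unfolding g_def by (intro nn_integral_sq_eq_L2_inner L2_space_diff f)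
    finally show ?thesis
      using * by (simp add: ennreal_mult'[symmetric] L2_inner_self_nonneg)
  qed
  have "(\<integral>\<^sup>+x. (\<Sum>k. ennreal (2^k * (g k x)\<^sup>2)) \<partial>M) = (\<Sum>k. \<integral>\<^sup>+x. ennreal (2^k * (g k x)\<^sup>2) \<partial>M)"
    by (intro nn_integral_suminf) measurable
  also have "\<dots> \<le> (\<Sum>k. ennreal ((1/4)^k))"
    by (intro suminf_le g_le) auto
  also have "\<dots> = ennreal (\<Sum>k. (1/4)^k)"
    by (intro suminf_ennreal2) (auto intro!: summable_geometric)
  also have "\<dots> < \<infinity>" by simp
  finally have "(\<integral>\<^sup>+x. (\<Sum>k. ennreal (2^k * (g k x)\<^sup>2)) \<partial>M) \<noteq> \<infinity>" by simp
  then have AE1: "AE x in M. (\<Sum>k. ennreal (2^k * (g k x)\<^sup>2)) \<noteq> \<infinity>"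
    by (intro nn_integral_PInf_AE) auto
  \<comment> \<open>A bound \<open>B\<close> for the terms \<open>2^k * (g k x)\<^sup>2\<close>
    gives increments of size at most \<open>sqrt B * (1 / sqrt 2)^k\<close>, a convergent geometric
    series.\<close>
  have conv: "convergent (\<lambda>k. f (r k) x)" if x: "(\<Sum>k. ennreal (2^k * (g k x)\<^sup>2)) \<noteq> \<infinity>" for x
  proof -
    have sm: "summable (\<lambda>k. 2^k * (g k x)\<^sup>2)"
      using x by (intro summable_suminf_not_top) auto
    then obtain B where B: "\<And>k. 2^k * (g k x)\<^sup>2 \<le> B"
      using sums_le summable_LIMSEQ_zero[OF sm] convergent_imp_Bseq[OF convergentI[OF summable_LIMSEQ_zero[OF sm]]]
      unfolding Bseq_def by (metis abs_le_D1 real_norm_def)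
    have "B \<ge> 0" using B[of 0] by (metis le_cases mult_eq_0_iff order.trans power_0 mult_1 zero_le_power2)
    have gb: "norm (g k x) \<le> sqrt B * (1 / sqrt 2)^k" for k
    proof -
      have "(g k x)\<^sup>2 \<le> B * (1/2)^k"
        using B[of k] by (simp add: field_simps power_divide)
      then have "\<bar>g k x\<bar> \<le> sqrt (B * (1/2)^k)"
        using real_le_rsqrt by fastforce
      also have "\<dots> = sqrt B * (1 / sqrt 2)^k"
        by (simp add: real_sqrt_mult real_sqrt_power real_sqrt_divide)
      finally show ?thesis by simp
    qed
    have "summable (\<lambda>k. sqrt B * (1 / sqrt 2)^k)"
      by (intro summable_mult summable_geometric) auto
    then have "summable (\<lambda>k. g k x)"
      using gb by (rule summable_comparison_test')
    then have "convergent (\<lambda>n. \<Sum>k<n. g k x)"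
      by (simp add: summable_iff_convergent)
    moreover have "(\<Sum>k<n. g k x) = f (r n) x - f (r 0) x" for n
      unfolding g_def by (rule sum_lessThan_telescope)
    ultimately have "convergent (\<lambda>n. f (r n) x - f (r 0) x)" by simp
    then have "convergent (\<lambda>n. (f (r n) x - f (r 0) x) + f (r 0) x)"
      by (intro convergent_add convergent_const)
    then show ?thesis by simp
  qed
  show ?thesis
  proof (rule that[OF r(1)])
    show "(\<lambda>x. lim (\<lambda>k. f (r k) x)) \<in> borel_measurable M"
      by measurable
    show "AE x in M. (\<lambda>k. f (r k) x) \<longlonglongrightarrow> lim (\<lambda>k. f (r k) x)"
      using AE1 by eventually_elim (use conv in \<open>auto simp: convergent_LIMSEQ_iff\<close>)
  qed
qed

lemma nn_integral_sq_Fatou: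
  assumes [measurable]: "\<And>k. g k \<in> borel_measurable M"
    and "AE x in M. (\<lambda>k. g k x) \<longlonglongrightarrow> w x"
    and "\<And>k. k \<ge> k0 \<Longrightarrow> (\<integral>\<^sup>+x. ennreal ((g k x)\<^sup>2) \<partial>M) \<le> e"
  shows "(\<integral>\<^sup>+x. ennreal ((w x :: real)\<^sup>2) \<partial>M) \<le> e"
proof -
  have "(\<integral>\<^sup>+x. ennreal ((w x)\<^sup>2) \<partial>M) = (\<integral>\<^sup>+x. liminf (\<lambda>k. ennreal ((g k x)\<^sup>2)) \<partial>M)"
  proof (rule nn_integral_cong_AE)
    show "AE x in M. ennreal ((w x)\<^sup>2) = liminf (\<lambda>k. ennreal ((g k x)\<^sup>2))"
      using assms(2)
    proof eventually_elim
      case (elim x)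
      have "(\<lambda>k. ennreal ((g k x)\<^sup>2)) \<longlonglongrightarrow> ennreal ((w x)\<^sup>2)"
        by (intro tendsto_ennrealI tendsto_power elim)
      then show ?case by (intro lim_imp_Liminf[symmetric]) auto
    qed
  qed
  also have "\<dots> \<le> liminf (\<lambda>k. \<integral>\<^sup>+x. ennreal ((g k x)\<^sup>2) \<partial>M)"
    by (intro nn_integral_liminf) measurable
  also have "\<dots> \<le> e"
    using assms(3) by (intro Liminf_le) (auto simp: eventually_sequentially)
  finally show ?thesis .
qed

text \<open>\<open>grad u\<close> is the weighted difference quotient of \<open>u\<close>, so that the form is a sum of two
  squared norms, in the spaces over \<open>M \<Otimes>\<^sub>M M\<close> and over \<open>M\<close>.\<close>

locale jump_form = sigma_finite_measure M for M :: "'a measure" +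
  fixes K :: "'a \<Rightarrow> 'a \<Rightarrow> real" and c \<kappa> :: real
  assumes K_meas [measurable]: "(\<lambda>p. K (fst p) (snd p)) \<in> borel_measurable (M \<Otimes>\<^sub>M M)"
    and K_nonneg: "\<And>x y. 0 \<le> K x y"
    and c_pos: "0 < c" and kappa_pos: "0 < \<kappa>"
begin

sublocale P: pair_sigma_finite M M ..

definition grad :: "('a \<Rightarrow> real) \<Rightarrow> 'a \<times> 'a \<Rightarrow> real" where
  "grad u p = (u (fst p) - u (snd p)) * sqrt (K (fst p) (snd p))"

definition sqn :: "('a \<Rightarrow> real) \<Rightarrow> ennreal" where
  "sqn u = ennreal c * (\<integral>\<^sup>+x. (\<integral>\<^sup>+y. ennreal ((u x - u y)\<^sup>2 * K x y) \<partial>M) \<partial>M) +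
     ennreal \<kappa> * (\<integral>\<^sup>+x. ennreal ((u x)\<^sup>2) \<partial>M)"

definition form_space :: "('a \<Rightarrow> real) set" where
  "form_space = {u \<in> L2_space M. sqn u < \<infinity>}"

definition ip :: "('a \<Rightarrow> real) \<Rightarrow> ('a \<Rightarrow> real) \<Rightarrow> real" where
  "ip u w = c * (LINT x|M. LINT y|M. (u x - u y) * (w x - w y) * K x y) + \<kappa> * (LINT x|M. u x * w x)"

lemma grad_measurable [measurable (raw)]:
  assumes [measurable]: "u \<in> borel_measurable M"
  shows "grad u \<in> borel_measurable (M \<Otimes>\<^sub>M M)"
  unfolding grad_def by measurable

lemma grad_sq: "(grad u p)\<^sup>2 = (u (fst p) - u (snd p))\<^sup>2 * K (fst p) (snd p)"
  by (simp add: grad_def power_mult_distrib K_nonneg)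

lemma grad_mult: "grad u p * grad w p = (u (fst p) - u (snd p)) * (w (fst p) - w (snd p)) * K (fst p) (snd p)"
  using K_nonneg[of "fst p" "snd p"] by (simp add: grad_def algebra_simps flip: real_sqrt_mult)

lemma nn_integral_grad_sq:
  assumes [measurable]: "u \<in> borel_measurable M"
  shows "(\<integral>\<^sup>+p. ennreal ((grad u p)\<^sup>2) \<partial>(M \<Otimes>\<^sub>M M)) = (\<integral>\<^sup>+x. (\<integral>\<^sup>+y. ennreal ((u x - u y)\<^sup>2 * K x y) \<partial>M) \<partial>M)"
  by (subst nn_integral_fst[symmetric]) (simp_all add: grad_sq)

text \<open>Positivity of \<open>c\<close> matters here: in \<open>ennreal\<close> zero times
  infinity is zero, so a vanishing coefficient would hide an infinite energy.\<close>

lemma form_space_iff: "u \<in> form_space \<longleftrightarrow> u \<in> L2_space M \<and> grad u \<in> L2_space (M \<Otimes>\<^sub>M M)"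
proof (cases "u \<in> L2_space M")
  case True
  then have m [measurable]: "u \<in> borel_measurable M" and fin: "(\<integral>\<^sup>+x. ennreal ((u x)\<^sup>2) \<partial>M) < \<infinity>"
    by (auto simp: L2_space_iff)
  have "sqn u < \<infinity> \<longleftrightarrow> (\<integral>\<^sup>+p. ennreal ((grad u p)\<^sup>2) \<partial>(M \<Otimes>\<^sub>M M)) < \<infinity>"
    using c_pos kappa_pos fin
    by (auto simp: sqn_def nn_integral_grad_sq ennreal_mult_less_top)
  then show ?thesis using True by (auto simp: form_space_def L2_space_iff)
qed (auto simp: form_space_def)

text \<open>Finite energy of both arguments makes the product of gradients integrable on the product
  space, and Fubini's theorem then identifies the iterated integral in \<open>ip\<close>.\<close>

lemma ip_eq:
  assumes "u \<in> form_space" "w \<in> form_space"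
  shows "ip u w = c * L2_inner (M \<Otimes>\<^sub>M M) (grad u) (grad w) + \<kappa> * L2_inner M u w"
proof -
  have "integrable (M \<Otimes>\<^sub>M M) (\<lambda>p. grad u p * grad w p)"
    using assms by (intro L2_mult_integrable) (auto simp: form_space_iff)
  from P.integral_fst'[OF this] show ?thesis
    by (simp add: ip_def L2_inner_def grad_mult)
qed

lemma grad_add: "grad (\<lambda>x. u x + w x) = (\<lambda>p. grad u p + grad w p)"
  by (auto simp: grad_def algebra_simps)

lemma grad_diff: "grad (\<lambda>x. u x - w x) = (\<lambda>p. grad u p - grad w p)"
  by (auto simp: grad_def algebra_simps)

lemma grad_scale: "grad (\<lambda>x. a * u x) = (\<lambda>p. a * grad u p)"
  by (auto simp: grad_def algebra_simps)

lemma AE_pair: 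
  assumes "AE x in M. Q x"
  shows "AE p in M \<Otimes>\<^sub>M M. Q (fst p) \<and> Q (snd p)"
proof -
  obtain N where N: "N \<in> null_sets M" "{x \<in> space M. \<not> Q x} \<subseteq> N"
    using assms by (auto elim!: AE_E)
  show ?thesis
  proof (rule AE_I')
    show "N \<times> space M \<union> space M \<times> N \<in> null_sets (M \<Otimes>\<^sub>M M)"
      using N(1) by (intro null_sets.Un times_in_null_sets1 times_in_null_sets2) auto
    show "{p \<in> space (M \<Otimes>\<^sub>M M). \<not> (Q (fst p) \<and> Q (snd p))} \<subseteq> N \<times> space M \<union> space M \<times> N"
      using N(2) by (auto simp: space_pair_measure)
  qed
qed

lemma grad_AE_cong:
  assumes "AE x in M. u x = w x"
  shows "AE p in M \<Otimes>\<^sub>M M. grad u p = grad w p"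
  using AE_pair[OF assms] by eventually_elim (auto simp: grad_def)

lemma grad_tendsto:
  assumes "AE x in M. (\<lambda>k. g k x) \<longlonglongrightarrow> w x"
  shows "AE p in M \<Otimes>\<^sub>M M. (\<lambda>k. grad (g k) p) \<longlonglongrightarrow> grad w p"
  using AE_pair[OF assms] by eventually_elim (auto simp: grad_def intro!: tendsto_intros)

lemma form_space_add: "u \<in> form_space \<Longrightarrow> w \<in> form_space \<Longrightarrow> (\<lambda>x. u x + w x) \<in> form_space"
  by (auto simp: form_space_iff grad_add intro!: L2_space_add)

lemma form_space_scale: "u \<in> form_space \<Longrightarrow> (\<lambda>x. a * u x) \<in> form_space"
  by (auto simp: form_space_iff grad_scale intro!: L2_space_scale)

lemma form_space_diff: "u \<in> form_space \<Longrightarrow> w \<in> form_space \<Longrightarrow> (\<lambda>x. u x - w x) \<in> form_space"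
  by (auto simp: form_space_iff grad_diff intro!: L2_space_diff)

lemma form_space_AE_cong:
  assumes "u \<in> form_space" "w \<in> borel_measurable M" "AE x in M. w x = u x"
  shows "w \<in> form_space"
  unfolding form_space_iff
proof
  show "w \<in> L2_space M"
    using L2_space_AE_cong assms form_space_iff by blast
  show "grad w \<in> L2_space (M \<Otimes>\<^sub>M M)"
    using L2_space_AE_cong[OF _ grad_measurable[OF assms(2)] grad_AE_cong[OF assms(3)]] assms(1) form_space_iff
    by blast
qed

lemma ae_linear_space_form_space: "ae_linear_space M form_space"
  unfolding ae_linear_space_def
proof (intro conjI ballI allI impI)
  show "(\<lambda>x. 0) \<in> form_space"
    by (auto simp: form_space_iff grad_def[abs_def] L2_space_def)
qed (auto simp: form_space_add form_space_scale intro: form_space_AE_cong, auto simp: form_space_iff L2_space_def)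

lemma ip_AE_cong:
  assumes "u \<in> form_space" "w \<in> form_space" "h \<in> form_space" "AE x in M. u x = w x"
  shows "ip u h = ip w h"
proof -
  have "L2_inner M u h = L2_inner M w h"
    using assms by (intro L2_inner_AE_cong) (auto simp: form_space_iff L2_space_def)
  moreover have "L2_inner (M \<Otimes>\<^sub>M M) (grad u) (grad h) = L2_inner (M \<Otimes>\<^sub>M M) (grad w) (grad h)"
    using assms grad_AE_cong[OF assms(4)]
    by (intro L2_inner_AE_cong) (auto simp: form_space_iff L2_space_def)
  ultimately show ?thesis using assms by (simp add: ip_eq)
qed

lemma ip_commute: "ip u w = ip w u"
  by (simp add: ip_def mult.commute mult.left_commute)

lemma ip_self:
  assumes "u \<in> form_space"
  shows "ip u u \<ge> 0" "\<kappa> * L2_inner M u u \<le> ip u u" "sqn u = ennreal (ip u u)"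
proof -
  have m: "u \<in> L2_space M" "grad u \<in> L2_space (M \<Otimes>\<^sub>M M)" "u \<in> borel_measurable M"
    using assms by (auto simp: form_space_iff L2_space_def)
  show 1: "ip u u \<ge> 0" "\<kappa> * L2_inner M u u \<le> ip u u"
    using assms c_pos kappa_pos by (auto simp: ip_eq L2_inner_self_nonneg)
  show "sqn u = ennreal (ip u u)"
    using assms c_pos kappa_pos m
    by (simp add: sqn_def ip_eq nn_integral_grad_sq[symmetric] nn_integral_sq_eq_L2_inner
        ennreal_mult'[symmetric] ennreal_plus[symmetric] L2_inner_self_nonneg del: ennreal_plus)
qed

lemma ae_inner_product_ip: "ae_inner_product M form_space ip"
  unfolding ae_inner_product_def
proof (intro conjI ballI allI impI)
  fix u w h assume "u \<in> form_space" "w \<in> form_space" "h \<in> form_space"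
  then show "ip (\<lambda>x. u x + w x) h = ip u h + ip w h"
    by (simp add: ip_eq form_space_add, simp add: form_space_iff grad_add L2_inner_add distrib_left)
next
  fix a u h assume "u \<in> form_space" "h \<in> form_space"
  then show "ip (\<lambda>x. a * u x) h = a * ip u h"
    by (simp add: ip_eq form_space_scale) (simp add: form_space_iff grad_scale L2_inner_scale distrib_left)
next
  fix u assume u: "u \<in> form_space"
  \<comment> \<open>Definiteness comes from the \<kappa> part alone; the converse direction also
    needs the gradient to vanish on almost all pairs.\<close>
  have "AE p in M \<Otimes>\<^sub>M M. grad u p = 0" if "AE x in M. u x = 0"
    using AE_pair[OF that] by eventually_elim (auto simp: grad_def)
  then show "ip u u = 0 \<longleftrightarrow> (AE x in M. u x = 0)"
    using u c_pos kappa_pos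
    by (auto simp: ip_eq add_nonneg_eq_0_iff L2_inner_self_nonneg)
      (auto simp: form_space_iff L2_inner_self_eq_0_iff)
qed (auto intro: ip_AE_cong ip_commute simp: ip_self)

text \<open>The gradients need no limit of their own: almost everywhere convergence over
  \<open>M\<close> passes to the difference quotients over \<open>M \<Otimes>\<^sub>M M\<close>, so
  one limit function serves both parts of the form.\<close>

lemma Cauchy_limit:
  assumes f: "\<And>n. f n \<in> form_space"
    and Cau: "\<And>e. e > 0 \<Longrightarrow> \<exists>n0. \<forall>m\<ge>n0. \<forall>n\<ge>n0. ip (\<lambda>x. f m x - f n x) (\<lambda>x. f m x - f n x) < e"
  shows "\<exists>u\<in>form_space. (\<lambda>n. ip (\<lambda>x. f n x - u x) (\<lambda>x. f n x - u x)) \<longlonglongrightarrow> 0"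
proof -
  have fm [measurable]: "\<And>n. f n \<in> borel_measurable M"
    using f by (auto simp: form_space_iff L2_space_def)
  have CauL: "\<exists>n0. \<forall>m\<ge>n0. \<forall>n\<ge>n0. L2_inner M (\<lambda>x. f m x - f n x) (\<lambda>x. f m x - f n x) < e" if e: "e > 0" for e
  proof -
    obtain n0 where n0: "\<And>m n. m \<ge> n0 \<Longrightarrow> n \<ge> n0 \<Longrightarrow> ip (\<lambda>x. f m x - f n x) (\<lambda>x. f m x - f n x) < \<kappa> * e"
      using Cau[OF mult_pos_pos[OF kappa_pos e]] by metis
    have "L2_inner M (\<lambda>x. f m x - f n x) (\<lambda>x. f m x - f n x) < e" if "m \<ge> n0" "n \<ge> n0" for m n
    proof -
      have "\<kappa> * L2_inner M (\<lambda>x. f m x - f n x) (\<lambda>x. f m x - f n x) < \<kappa> * e"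
        using n0[OF that] ip_self(2)[OF form_space_diff[OF f[of m] f[of n]]] by linarith
      then show ?thesis using kappa_pos by simp
    qed
    then show ?thesis by blast
  qed
  have fL: "\<And>n. f n \<in> L2_space M" using f by (auto simp: form_space_iff)
  obtain r w where r: "strict_mono r" and [measurable]: "w \<in> borel_measurable M"
    and lim: "AE x in M. (\<lambda>k. f (r k) x) \<longlonglongrightarrow> w x"
    using L2_Cauchy_AE_subseq[of f M, OF fL CauL] by metis
  have key: "\<exists>n0. \<forall>n\<ge>n0. (\<lambda>x. f n x - w x) \<in> form_space \<and> ip (\<lambda>x. f n x - w x) (\<lambda>x. f n x - w x) \<le> e" if "e > 0" for e
  proof -
    have "e/2 > 0" using that by simp
    then obtain n0 where n0: "\<And>m n. m \<ge> n0 \<Longrightarrow> n \<ge> n0 \<Longrightarrow> ip (\<lambda>x. f m x - f n x) (\<lambda>x. f m x - f n x) < e/2"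
      using Cau by metis
    have "(\<lambda>x. f n x - w x) \<in> form_space \<and> ip (\<lambda>x. f n x - w x) (\<lambda>x. f n x - w x) \<le> e" if n: "n \<ge> n0" for n
    proof -
      let ?g = "\<lambda>k x. f n x - f (r k) x"
      have gV: "?g k \<in> form_space" for k using f by (intro form_space_diff)
      then have gV': "?g k \<in> L2_space M" "grad (?g k) \<in> L2_space (M \<Otimes>\<^sub>M M)" for k by (auto simp: form_space_iff)
      have glim: "AE x in M. (\<lambda>k. ?g k x) \<longlonglongrightarrow> f n x - w x"
        using lim by eventually_elim (intro tendsto_intros)
      have ple: "c * L2_inner (M \<Otimes>\<^sub>M M) (grad (?g k)) (grad (?g k)) \<le> e/2 \<and> \<kappa> * L2_inner M (?g k) (?g k) \<le> e/2"
        if "k \<ge> n0" for k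
      proof -
        have "r k \<ge> n0" using that r by (meson order_trans strict_mono_imp_increasing)
        then have "ip (?g k) (?g k) < e/2" using n0[OF n] by blast
        then show ?thesis
          using ip_eq[OF gV[of k] gV[of k]] c_pos kappa_pos
            L2_inner_self_nonneg[of "M" "?g k"] L2_inner_self_nonneg[of "M \<Otimes>\<^sub>M M" "grad (?g k)"]
          by (smt (verit) mult_nonneg_nonneg)
      qed
      \<comment> \<open>Here \<open>n\<close> is fixed and only \<open>k\<close> runs. Fatou's lemma
        turns the bounds for \<open>f n - f (r k)\<close> into bounds for \<open>f n - w\<close>;
        they hold from \<open>n0\<close> on because \<open>r k \<ge> k\<close>.\<close>
      have 1: "(\<integral>\<^sup>+x. ennreal ((f n x - w x)\<^sup>2) \<partial>M) \<le> ennreal (e / (2 * \<kappa>))"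
      proof (rule nn_integral_sq_Fatou[OF _ glim])
        fix k assume "k \<ge> n0"
        from ple[OF this] show "(\<integral>\<^sup>+x. ennreal ((?g k x)\<^sup>2) \<partial>M) \<le> ennreal (e / (2 * \<kappa>))"
          using kappa_pos by (subst nn_integral_sq_eq_L2_inner[OF gV'(1)]) (auto intro!: ennreal_leI simp: field_simps)
      qed auto
      have 2: "(\<integral>\<^sup>+p. ennreal ((grad (\<lambda>x. f n x - w x) p)\<^sup>2) \<partial>(M \<Otimes>\<^sub>M M)) \<le> ennreal (e / (2 * c))"
      proof (rule nn_integral_sq_Fatou[OF _ grad_tendsto[OF glim]])
        fix k assume "k \<ge> n0"
        from ple[OF this] show "(\<integral>\<^sup>+p. ennreal ((grad (?g k) p)\<^sup>2) \<partial>(M \<Otimes>\<^sub>M M)) \<le> ennreal (e / (2 * c))"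
          using c_pos by (subst nn_integral_sq_eq_L2_inner[OF gV'(2)]) (auto intro!: ennreal_leI simp: field_simps)
      qed auto
      have V: "(\<lambda>x. f n x - w x) \<in> form_space"
        unfolding form_space_iff L2_space_iff
        using le_less_trans[OF 1] le_less_trans[OF 2] by auto
      have "L2_inner M (\<lambda>x. f n x - w x) (\<lambda>x. f n x - w x) \<le> e / (2*\<kappa>)"
        using 1 V that kappa_pos \<open>e > 0\<close> by (subst (asm) nn_integral_sq_eq_L2_inner) (auto simp: form_space_iff)
      moreover have "L2_inner (M \<Otimes>\<^sub>M M) (grad (\<lambda>x. f n x - w x)) (grad (\<lambda>x. f n x - w x)) \<le> e / (2*c)"
        using 2 V that c_pos \<open>e > 0\<close> by (subst (asm) nn_integral_sq_eq_L2_inner) (auto simp: form_space_iff)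
      ultimately have "ip (\<lambda>x. f n x - w x) (\<lambda>x. f n x - w x) \<le> c * (e / (2*c)) + \<kappa> * (e/(2*\<kappa>))"
        using V c_pos kappa_pos unfolding ip_eq[OF V V] by (intro add_mono mult_left_mono) auto
      also have "\<dots> = e" using c_pos kappa_pos by simp
      finally show ?thesis using V by simp
    qed
    then show ?thesis by blast
  qed
  \<comment> \<open>Membership of \<open>w\<close> itself is obtained only now, as the difference of
    \<open>f n1\<close> and \<open>f n1 - w\<close>.\<close>
  obtain n1 where "(\<lambda>x. f n1 x - w x) \<in> form_space"
    using key[of 1] by auto
  from form_space_diff[OF f[of n1] this] have w: "w \<in> form_space"
    by simp
  have "(\<lambda>n. ip (\<lambda>x. f n x - w x) (\<lambda>x. f n x - w x)) \<longlonglongrightarrow> 0"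
  proof (rule LIMSEQ_I)
    fix e :: real assume "e > 0"
    then obtain n0 where "\<forall>n\<ge>n0. ip (\<lambda>x. f n x - w x) (\<lambda>x. f n x - w x) \<le> e/2"
      using key[of "e/2"] by auto
    then show "\<exists>n0. \<forall>n\<ge>n0. norm (ip (\<lambda>x. f n x - w x) (\<lambda>x. f n x - w x) - 0) < e"
      using \<open>e > 0\<close> ip_self(1)[OF form_space_diff[OF f w]] by (intro exI[of _ n0]) fastforce
  qed
  then show ?thesis using w by blast
qed

lemma ae_complete_form_space: "ae_complete form_space (norm_of ip)"
  unfolding ae_complete_def
proof (intro allI impI, elim conjE)
  fix f :: "nat \<Rightarrow> 'a \<Rightarrow> real"
  assume f: "\<forall>n. f n \<in> form_space"
    and Cau: "\<forall>e>0. \<exists>n0. \<forall>m\<ge>n0. \<forall>n\<ge>n0. norm_of ip (\<lambda>x. f m x - f n x) < e"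
  have "\<exists>n0. \<forall>m\<ge>n0. \<forall>n\<ge>n0. ip (\<lambda>x. f m x - f n x) (\<lambda>x. f m x - f n x) < e" if "e > 0" for e
    using Cau[rule_format, of "sqrt e"] that by (auto simp: norm_of_def)
  then obtain u where "u \<in> form_space" "(\<lambda>n. ip (\<lambda>x. f n x - u x) (\<lambda>x. f n x - u x)) \<longlonglongrightarrow> 0"
    using Cauchy_limit[of f] f by auto
  then show "\<exists>u\<in>form_space. (\<lambda>n. norm_of ip (\<lambda>x. f n x - u x)) \<longlonglongrightarrow> 0"
    unfolding norm_of_def using tendsto_real_sqrt by fastforce
qed

lemma hilbert_space_form_space: "hilbert_space_ae M form_space ip"
  unfolding hilbert_space_ae_def
  using ae_linear_space_form_space ae_inner_product_ip ae_complete_form_space by blast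

end

text \<open>With the zero kernel the form reduces to the inner product of L^2, so completeness of
  the form space applies.\<close>

lemma (in sigma_finite_measure) L2_complete:
  assumes f: "\<And>n. f n \<in> L2_space M"
    and Cau: "\<And>e. e > 0 \<Longrightarrow> \<exists>n0. \<forall>m\<ge>n0. \<forall>n\<ge>n0. L2_inner M (\<lambda>x. f m x - f n x) (\<lambda>x. f m x - f n x) < e"
  shows "\<exists>u\<in>L2_space M. (\<lambda>n. L2_inner M (\<lambda>x. f n x - u x) (\<lambda>x. f n x - u x)) \<longlonglongrightarrow> 0"
proof -
  interpret J: jump_form M "\<lambda>_ _. 0" 1 1
    by unfold_locales auto
  have "J.form_space = L2_space M"
    by (auto simp: J.form_space_def J.sqn_def L2_space_iff)
  moreover have "J.ip u w = L2_inner M u w" for u w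
    by (simp add: J.ip_def L2_inner_def)
  ultimately show ?thesis using J.Cauchy_limit[of f] assms by simp
qed

section \<open>Calculus of the differentiability classes\<close>

text \<open>Both sides are choices from the same set of derivatives, hence equal even at points
  where neither function is differentiable.\<close>

lemma frechet_derivative_transform_open:
  assumes "open U" "x \<in> U" "\<And>y. y \<in> U \<Longrightarrow> f y = g y"
  shows "frechet_derivative f (at x) = frechet_derivative g (at x)"
proof -
  have "(f has_derivative D) (at x) \<longleftrightarrow> (g has_derivative D) (at x)" for D
    using has_derivative_transform_within_open[of f D x UNIV U g]
      has_derivative_transform_within_open[of g D x UNIV U f] assms by auto
  then show ?thesis by (simp add: frechet_derivative_def)
qed

lemma differentiable_on_cong_set:
  assumes "\<And>x. x \<in> U \<Longrightarrow> f x = g x" "f differentiable_on U"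
  shows "g differentiable_on U"
  unfolding differentiable_on_def differentiable_def
proof
  fix x assume x: "x \<in> U"
  then obtain D where "(f has_derivative D) (at x within U)"
    using assms(2) by (auto simp: differentiable_on_def differentiable_def)
  then have "(g has_derivative D) (at x within U)"
    by (rule has_derivative_transform[OF x assms(1)[symmetric], rotated]) auto
  then show "\<exists>D. (g has_derivative D) (at x within U)" by blast
qed

lemma Ck_on_cong:
  assumes "open U" "\<And>x. x \<in> U \<Longrightarrow> f x = g x" "Ck_on k U f"
  shows "Ck_on k U g"
  using assms(2,3)
proof (induction k arbitrary: f g)
  case 0
  then show ?case by (auto cong: continuous_on_cong)
next
  case (Suc k)
  have "Ck_on k U (\<lambda>x. frechet_derivative g (at x) b)" if "b \<in> Basis" for b
  proof (rule Suc.IH)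
    show "Ck_on k U (\<lambda>x. frechet_derivative f (at x) b)"
      using Suc.prems that by auto
    show "frechet_derivative f (at x) b = frechet_derivative g (at x) b" if "x \<in> U" for x
      using frechet_derivative_transform_open[OF assms(1) that Suc.prems(1)] by auto
  qed
  moreover have "g differentiable_on U"
    using Suc.prems by (auto intro: differentiable_on_cong_set[of U f])
  ultimately show ?case by simp
qed

text \<open>Lets an explicit derivative \<open>D\<close> stand in for the choice operator
  \<open>frechet_derivative\<close>, which cannot be computed with directly.\<close>

lemma Ck_on_SucI:
  assumes "open U" "\<And>x. x \<in> U \<Longrightarrow> (f has_derivative D x) (at x)"
    and "\<And>b. b \<in> Basis \<Longrightarrow> Ck_on k U (\<lambda>x. D x b)"
  shows "Ck_on (Suc k) U f"
proof -
  have "f differentiable_on U"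
    using assms(2) by (auto simp: differentiable_on_def differentiable_def intro: has_derivative_at_withinI)
  moreover have "Ck_on k U (\<lambda>x. frechet_derivative f (at x) b)" if "b \<in> Basis" for b
    by (rule Ck_on_cong[OF assms(1) _ assms(3)[OF that]])
      (metis assms(2) frechet_derivative_at)
  ultimately show ?thesis by simp
qed

lemma Ck_on_Suc_has_derivative:
  assumes "open U" "Ck_on (Suc k) U f" "x \<in> U"
  shows "(f has_derivative frechet_derivative f (at x)) (at x)"
  using assms by (auto simp: differentiable_on_eq_differentiable_at frechet_derivative_works)

lemma Ck_on_SucD: "open U \<Longrightarrow> Ck_on (Suc k) U f \<Longrightarrow> Ck_on k U f"
proof (induction k arbitrary: f)
  case 0
  then show ?case by (auto intro: differentiable_imp_continuous_on)
next
  case (Suc k)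
  then show ?case by auto
qed

lemma Ck_on_const: "open U \<Longrightarrow> Ck_on k U (\<lambda>_. c)"
proof (induction k arbitrary: c)
  case (Suc k)
  then show ?case by (intro Ck_on_SucI[where D = "\<lambda>_ _. 0"]) auto
qed auto

lemma Ck_on_bounded_linear:
  assumes "open U" "bounded_linear L"
  shows "Ck_on k U L"
proof (cases k)
  case 0
  then show ?thesis using assms by (simp add: linear_continuous_on)
next
  case (Suc m)
  show ?thesis unfolding Suc
    by (rule Ck_on_SucI[where D = "\<lambda>_. L"])
      (use assms in \<open>auto intro: bounded_linear_imp_has_derivative Ck_on_const\<close>)
qed

lemma Ck_on_compose_bounded_linear:
  assumes "open U" "bounded_linear L" "Ck_on k U f"
  shows "Ck_on k U (\<lambda>x. L (f x))"
  using assms(3)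
proof (induction k arbitrary: f)
  case 0
  then show ?case using assms(2) by (simp add: bounded_linear.continuous_on)
next
  case (Suc k)
  show ?case
  proof (rule Ck_on_SucI[OF assms(1), where D = "\<lambda>x b. L (frechet_derivative f (at x) b)"])
    show "((\<lambda>x. L (f x)) has_derivative (\<lambda>b. L (frechet_derivative f (at x) b))) (at x)" if "x \<in> U" for x
      using bounded_linear.has_derivative[OF assms(2) Ck_on_Suc_has_derivative[OF assms(1) Suc.prems that]] .
    show "Ck_on k U (\<lambda>x. L (frechet_derivative f (at x) b))" if "b \<in> Basis" for b
      using Suc that by auto
  qed
qed

lemma Ck_on_add:
  assumes "open U" "Ck_on k U f" "Ck_on k U g"
  shows "Ck_on k U (\<lambda>x. f x + g x)"
  using assms(2,3)
proof (induction k arbitrary: f g)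
  case 0
  then show ?case by (auto intro: continuous_intros)
next
  case (Suc k)
  show ?case
  proof (rule Ck_on_SucI[OF assms(1), where D = "\<lambda>x b. frechet_derivative f (at x) b + frechet_derivative g (at x) b"])
    show "((\<lambda>x. f x + g x) has_derivative (\<lambda>b. frechet_derivative f (at x) b + frechet_derivative g (at x) b)) (at x)"
      if "x \<in> U" for x
      by (intro has_derivative_add Ck_on_Suc_has_derivative[OF assms(1) Suc.prems(1) that]
          Ck_on_Suc_has_derivative[OF assms(1) Suc.prems(2) that])
  qed (use Suc in auto)
qed

lemma Ck_on_scaleR:
  assumes "open U" "Ck_on k U f" "Ck_on k U g"
  shows "Ck_on k U (\<lambda>x. f x *\<^sub>R g x)"
  using assms(2,3)
proof (induction k arbitrary: f g)
  case 0
  then show ?case by (auto intro: continuous_intros)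
next
  case (Suc k)
  let ?D = "\<lambda>x b. f x *\<^sub>R frechet_derivative g (at x) b + frechet_derivative f (at x) b *\<^sub>R g x"
  show ?case
  proof (rule Ck_on_SucI[OF assms(1), where D = ?D])
    show "((\<lambda>x. f x *\<^sub>R g x) has_derivative ?D x) (at x)" if "x \<in> U" for x
      by (intro has_derivative_scaleR Ck_on_Suc_has_derivative[OF assms(1) Suc.prems(1) that]
          Ck_on_Suc_has_derivative[OF assms(1) Suc.prems(2) that])
    \<comment> \<open>The product rule contains the undifferentiated factors, so both hypotheses are
      also used one order lower.\<close>
    show "Ck_on k U (\<lambda>x. ?D x b)" if "b \<in> Basis" for b
      using Suc.prems that Ck_on_SucD[OF assms(1) Suc.prems(1)] Ck_on_SucD[OF assms(1) Suc.prems(2)]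
      by (intro Ck_on_add Suc.IH assms(1)) auto
  qed
qed

lemma smooth_compose_bounded_linear:
  "smooth_on_open U f \<Longrightarrow> bounded_linear L \<Longrightarrow> smooth_on_open U (\<lambda>x. L (f x))"
  by (auto simp: smooth_on_open_def intro: Ck_on_compose_bounded_linear)

section \<open>Change of variables for an arbitrary finite index type\<close>

text \<open>The library states the change of variables formula for well-ordered index types only. The
  type \<open>'a wo\<close> is a copy of a finite type with an arbitrary well-order.\<close>

typedef (overloaded) 'a wo = "UNIV :: 'a set" by simp

lemma bij_Rep_wo: "bij Rep_wo"
  by (metis (no_types, lifting) Abs_wo_inverse Rep_wo_inverse UNIV_I bijI')

instance wo :: (finite) finite
proof
  show "finite (UNIV :: 'a wo set)"
    using bij_Rep_wo by (metis bij_betw_finite finite)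
qed

definition wo_code :: "'a::finite wo \<Rightarrow> nat" where
  "wo_code = (SOME f. inj f)"

lemma inj_wo_code: "inj (wo_code :: 'a::finite wo \<Rightarrow> nat)"
proof -
  have "\<exists>f :: 'a wo \<Rightarrow> nat. inj f"
    using finite_imp_inj_to_nat_seg[of "UNIV :: 'a wo set"] by auto
  then show ?thesis unfolding wo_code_def by (rule someI_ex)
qed

instantiation wo :: (finite) wellorder
begin

definition less_eq_wo :: "'a wo \<Rightarrow> 'a wo \<Rightarrow> bool" where
  "less_eq_wo a b \<longleftrightarrow> wo_code a \<le> wo_code b"

definition less_wo :: "'a wo \<Rightarrow> 'a wo \<Rightarrow> bool" where
  "less_wo a b \<longleftrightarrow> wo_code a < wo_code b"

instance
proof
  fix x y z :: "'a wo"
  show "x < y \<longleftrightarrow> x \<le> y \<and> \<not> y \<le> x"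
    unfolding less_wo_def less_eq_wo_def by linarith
  show "x \<le> x"
    by (simp add: less_eq_wo_def)
  show "x \<le> z" if "x \<le> y" "y \<le> z"
    using that unfolding less_eq_wo_def by (rule order_trans)
  show "x = y" if "x \<le> y" "y \<le> x"
    using that unfolding less_eq_wo_def by (intro injD[OF inj_wo_code] order_antisym)
  show "x \<le> y \<or> y \<le> x"
    unfolding less_eq_wo_def by (rule linear)
next
  fix P :: "'a wo \<Rightarrow> bool" and a :: "'a wo"
  assume H: "\<And>x. (\<And>y. y < x \<Longrightarrow> P y) \<Longrightarrow> P x"
  show "P a"
  proof (induction a rule: measure_induct_rule[of wo_code])
    case (less x)
    show ?case by (rule H, rule less) (simp add: less_wo_def)
  qed
qed

end

definition to_wo :: "real ^ 'n \<Rightarrow> real ^ ('n::finite wo)" where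
  "to_wo x = (\<chi> i. x $ Rep_wo i)"

definition of_wo :: "real ^ ('n::finite wo) \<Rightarrow> real ^ 'n" where
  "of_wo y = (\<chi> i. y $ Abs_wo i)"

lemma of_to_wo [simp]: "of_wo (to_wo x) = x"
  by (simp add: to_wo_def of_wo_def vec_eq_iff Abs_wo_inverse)

lemma to_of_wo [simp]: "to_wo (of_wo x) = x"
  by (simp add: to_wo_def of_wo_def vec_eq_iff Rep_wo_inverse)

lemma bounded_linear_to_wo: "bounded_linear to_wo"
  by (intro linear_conv_bounded_linear[THEN iffD1] linearI) (auto simp: to_wo_def vec_eq_iff)

lemma bounded_linear_of_wo: "bounded_linear of_wo"
  by (intro linear_conv_bounded_linear[THEN iffD1] linearI) (auto simp: of_wo_def vec_eq_iff)

lemma measurable_to_wo [measurable]: "to_wo \<in> borel_measurable borel"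
  by (intro borel_measurable_continuous_onI linear_continuous_on bounded_linear_to_wo)

lemma measurable_of_wo [measurable]: "of_wo \<in> borel_measurable borel"
  by (intro borel_measurable_continuous_onI linear_continuous_on bounded_linear_of_wo)

lemma prod_Basis_vec:
  fixes x :: "real ^ 'n"
  shows "(\<Prod>b\<in>Basis. x \<bullet> b) = (\<Prod>i\<in>UNIV. x $ i)"
proof -
  have B: "(Basis :: (real^'n) set) = range (\<lambda>i. axis i 1)"
    by (auto simp: Basis_vec_def)
  have inj: "inj (\<lambda>i::'n. axis i (1::real))"
    by (auto simp: inj_def axis_eq_axis)
  show ?thesis
    unfolding B by (subst prod.reindex[OF inj]) (simp add: inner_axis)
qed

text \<open>Relabelling coordinates maps boxes to boxes with the same side lengths, and boxes
  determine Lebesgue measure.\<close>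

lemma distr_to_wo: "distr lborel borel to_wo = (lborel :: (real ^ ('n::finite wo)) measure)"
proof (rule lborel_eqI[symmetric])
  fix l u :: "real ^ ('n wo)"
  assume lu: "\<And>b. b \<in> Basis \<Longrightarrow> l \<bullet> b \<le> u \<bullet> b"
  have le: "l $ i \<le> u $ i" for i
    using lu[of "axis i 1"] by (simp add: inner_axis axis_in_Basis_iff)
  have "to_wo -` box l u = box (of_wo l) (of_wo u)"
  proof (rule set_eqI)
    fix x :: "real ^ 'n"
    have "(\<forall>i. l $ i < x $ Rep_wo i \<and> x $ Rep_wo i < u $ i) \<longleftrightarrow>
      (\<forall>j. l $ Abs_wo j < x $ j \<and> x $ j < u $ Abs_wo j)"
      by (metis Abs_wo_inverse Rep_wo_inverse UNIV_I)
    then show "x \<in> to_wo -` box l u \<longleftrightarrow> x \<in> box (of_wo l) (of_wo u)"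
      by (simp add: mem_box_cart to_wo_def of_wo_def)
  qed
  then have "emeasure (distr lborel borel to_wo) (box l u) = emeasure lborel (box (of_wo l) (of_wo u))"
    by (simp add: emeasure_distr)
  also have "\<dots> = (\<Prod>b\<in>Basis. (of_wo u - of_wo l) \<bullet> b)"
    using le by (subst emeasure_lborel_box_eq) (auto simp: of_wo_def Basis_vec_def inner_axis)
  also have "\<dots> = (\<Prod>i\<in>UNIV. (u - l) $ Abs_wo i)"
    by (simp only: prod_Basis_vec) (simp add: of_wo_def)
  also have "(\<Prod>i\<in>UNIV. (u - l) $ Abs_wo i) = (\<Prod>i\<in>UNIV. (u - l) $ i)"
    by (rule prod.reindex_bij_witness[of _ Rep_wo Abs_wo]) (auto simp: Rep_wo_inverse Abs_wo_inverse)
  finally show "emeasure (distr lborel borel to_wo) (box l u) = (\<Prod>b\<in>Basis. (u - l) \<bullet> b)"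
    by (simp only: prod_Basis_vec)
qed simp

lemma nn_integral_to_wo:
  assumes "f \<in> borel_measurable borel"
  shows "(\<integral>\<^sup>+y. f y \<partial>lborel) = (\<integral>\<^sup>+x. f (to_wo x) \<partial>lborel)"
  by (subst distr_to_wo[symmetric]) (use assms in \<open>simp add: nn_integral_distr\<close>)

text \<open>Conjugation by \<open>h\<close> carries the transposition of \<open>a\<close> and
  \<open>b\<close> to that of \<open>h a\<close> and \<open>h b\<close>, so the sign is preserved
  along a decomposition into transpositions. The two permutations live on different types.\<close>

lemma sign_conj:
  fixes h :: "'a::finite \<Rightarrow> 'b::finite"
  assumes "bij h" "p permutes UNIV"
  shows "sign (h \<circ> p \<circ> inv h) = sign p \<and> (h \<circ> p \<circ> inv h) permutes UNIV"
  using assms(2) finite[of "UNIV :: 'a set"]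
proof (induction rule: permutes_induct)
  case id
  then show ?case using assms(1) by (simp add: bij_is_surj surj_iff[THEN iffD1] permutes_id[unfolded id_def])
next
  case (swap a b p)
  have eq: "h \<circ> (Transposition.transpose a b \<circ> p) \<circ> inv h = Transposition.transpose (h a) (h b) \<circ> (h \<circ> p \<circ> inv h)"
    using assms(1) by (auto simp: fun_eq_iff Transposition.transpose_def bij_is_inj inj_eq)
  have ne: "h a \<noteq> h b"
    using swap assms(1) by (simp add: bij_is_inj inj_eq)
  have perm: "permutation p" "permutation (h \<circ> p \<circ> inv h)"
    using swap permutation_permutes finite by blast+
  have "sign (Transposition.transpose (h a) (h b) \<circ> (h \<circ> p \<circ> inv h)) = sign (Transposition.transpose a b \<circ> p)"
    using swap ne by (simp only: sign_compose[OF permutation_swap_id perm(1)] sign_compose[OF permutation_swap_id perm(2)] sign_swap_id if_False)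
  then show ?case
    unfolding eq using swap by (blast intro: permutes_compose permutes_swap_id)
qed

text \<open>Relabelling rows and columns simultaneously conjugates the permutations in the Leibniz
  formula, which leaves their signs alone.\<close>

lemma det_reindex:
  fixes A :: "real ^ 'a ^ 'a" and h :: "'b::finite \<Rightarrow> 'a::finite"
  assumes h: "bij h"
  shows "det (\<chi> i j. A $ h i $ h j) = det A"
proof -
  have hi [simp]: "inv h (h x) = x" "h (inv h y) = y" for x y
    using h by (auto simp: bij_is_inj bij_is_surj surj_f_inv_f)
  have bi: "bij (inv h)" using h by (rule bij_imp_bij_inv)
  have inv_inv: "inv (inv h) = h" using h by (simp add: inv_inv_eq)
  have "(\<Sum>p\<in>{p. p permutes UNIV}. of_int (sign p) * (\<Prod>i\<in>UNIV. A $ h i $ h (p i))) =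
     (\<Sum>p\<in>{p. p permutes UNIV}. of_int (sign p) * (\<Prod>i\<in>UNIV. A $ i $ p i))"
  proof (rule sum.reindex_bij_witness[of _ "\<lambda>q. inv h \<circ> q \<circ> h" "\<lambda>p. h \<circ> p \<circ> inv h"])
    fix p :: "'b \<Rightarrow> 'b" assume p: "p \<in> {p. p permutes UNIV}"
    show "inv h \<circ> (h \<circ> p \<circ> inv h) \<circ> h = p" by (auto simp: fun_eq_iff)
    show "h \<circ> p \<circ> inv h \<in> {p. p permutes UNIV}" using sign_conj[OF h] p by auto
    have "(\<Prod>i\<in>UNIV. A $ i $ (h \<circ> p \<circ> inv h) i) = (\<Prod>i\<in>UNIV. A $ h i $ h (p i))"
      by (rule prod.reindex_bij_witness[of _ h "inv h"]) auto
    then show "of_int (sign (h \<circ> p \<circ> inv h)) * (\<Prod>i\<in>UNIV. A $ i $ (h \<circ> p \<circ> inv h) i) =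
       of_int (sign p) * (\<Prod>i\<in>UNIV. A $ h i $ h (p i))"
      using sign_conj[OF h] p by auto
  next
    fix q :: "'a \<Rightarrow> 'a" assume q: "q \<in> {p. p permutes UNIV}"
    show "h \<circ> (inv h \<circ> q \<circ> h) \<circ> inv h = q" by (auto simp: fun_eq_iff)
    show "inv h \<circ> q \<circ> h \<in> {p. p permutes UNIV}" using sign_conj[OF bi, of q] q by (auto simp: inv_inv)
  qed
  then show ?thesis by (simp add: det_def)
qed

text \<open>Links the integral on subsets used by the change of variables theorems with the
  nonnegative integral. The latter takes the same value for \<open>lborel\<close> and its
  completion, whether or not the integrand is Borel.\<close>

lemma absolutely_integrable_nn_integral:
  fixes h :: "'a::euclidean_space \<Rightarrow> real"
  assumes "h absolutely_integrable_on S" "\<And>x. x \<in> S \<Longrightarrow> 0 \<le> h x"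
  shows "(\<integral>\<^sup>+x\<in>S. ennreal (h x) \<partial>lborel) = ennreal (integral S h)"
proof -
  have i: "integrable lebesgue (\<lambda>x. indicator S x *\<^sub>R h x)"
    using assms(1) by (simp add: set_integrable_def)
  have "(\<integral>\<^sup>+x\<in>S. ennreal (h x) \<partial>lborel) = (\<integral>\<^sup>+x. ennreal (indicator S x *\<^sub>R h x) \<partial>lebesgue)"
    unfolding nn_integral_completion by (intro nn_integral_cong) (auto simp: indicator_def)
  also have "\<dots> = ennreal (LINT x|lebesgue. indicator S x *\<^sub>R h x)"
    using i assms(2) by (intro nn_integral_eq_integral) (auto simp: indicator_def)
  finally show ?thesis
    using set_lebesgue_integral_eq_integral(2)[OF assms(1)] by (simp add: set_lebesgue_integral_def)
qed

lemma nn_change_of_variables_wo: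
  fixes g :: "real ^ 'm::{finite,wellorder} \<Rightarrow> real ^ 'm::_"
  assumes S: "S \<in> sets lebesgue"
    and der: "\<And>x. x \<in> S \<Longrightarrow> (g has_derivative g' x) (at x within S)"
    and inj: "inj_on g S"
    and f: "f absolutely_integrable_on (g ` S)" "\<And>y. (0::real) \<le> f y"
  shows "(\<integral>\<^sup>+x\<in>S. ennreal (\<bar>det (matrix (g' x))\<bar> * f (g x)) \<partial>lborel) = (\<integral>\<^sup>+y\<in>g ` S. ennreal (f y) \<partial>lborel)"
proof -
  \<comment> \<open>The formula applied below is for vector-valued integrands; a real one enters as
    a vector of dimension 1.\<close>
  have "(\<lambda>x. vec (f x) :: real^1) absolutely_integrable_on (g ` S) \<and>
      integral (g ` S) (\<lambda>x. vec (f x) :: real^1) = vec (integral (g ` S) f)"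
    using f(1) by (simp add: absolutely_integrable_on_1_iff integral_on_1_eq)
  from has_absolute_integral_change_of_variables[OF S der inj, of "\<lambda>x. vec (f x) :: real^1", THEN iffD2, OF _ this]
  have "(\<lambda>x. \<bar>det (matrix (g' x))\<bar> * f (g x)) absolutely_integrable_on S"
    "integral S (\<lambda>x. \<bar>det (matrix (g' x))\<bar> * f (g x)) = integral (g ` S) f"
    by (auto simp: absolutely_integrable_on_1_iff integral_on_1_eq vec_eq_iff)
  then show ?thesis
    using f by (subst (1 2) absolutely_integrable_nn_integral) auto
qed

text \<open>Everything is conjugated by \<open>to_wo\<close>, which preserves Lebesgue measure and
  relabels the Jacobian matrix. The derivatives \<open>g'\<close> are prescribed on \<open>S\<close>
  only, so measurability of the transformed integrand is required through an indicator.\<close>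

lemma nn_change_of_variables:
  fixes g :: "real ^ 'n::finite \<Rightarrow> real ^ 'n"
  assumes S: "S \<in> sets borel"
    and der: "\<And>x. x \<in> S \<Longrightarrow> (g has_derivative g' x) (at x)"
    and inj: "inj_on g S"
    and gS: "g ` S \<in> sets borel"
    and g': "(\<lambda>x. indicator S x * ennreal (\<bar>det (matrix (g' x))\<bar> * f (g x))) \<in> borel_measurable borel"
    and f: "f \<in> borel_measurable borel" "integrable lborel f" "\<And>y. (0::real) \<le> f y"
  shows "(\<integral>\<^sup>+x\<in>S. ennreal (\<bar>det (matrix (g' x))\<bar> * f (g x)) \<partial>lborel) = (\<integral>\<^sup>+y\<in>g ` S. ennreal (f y) \<partial>lborel)"
proof -
  note [measurable] = S gS f(1)
  define S1 where "S1 = of_wo -` S"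
  define g1 where "g1 y = to_wo (g (of_wo y))" for y
  define g1' where "g1' y = (\<lambda>h. to_wo (g' (of_wo y) (of_wo h)))" for y
  define f1 where "f1 y = f (of_wo y)" for y
  have S1 [measurable]: "S1 \<in> sets borel"
    unfolding S1_def by (rule measurable_sets_borel[OF measurable_of_wo S])
  have gS1: "g1 ` S1 = of_wo -` (g ` S)"
  proof (intro set_eqI iffI)
    fix y assume "y \<in> of_wo -` (g ` S)"
    then obtain x where x: "x \<in> S" "of_wo y = g x" by auto
    then have "y = g1 (to_wo x)" by (simp add: g1_def flip: x(2))
    then show "y \<in> g1 ` S1" using x(1) by (auto simp: S1_def)
  qed (auto simp: S1_def g1_def)
  have gS1m [measurable]: "g1 ` S1 \<in> sets borel"
    unfolding gS1 by (rule measurable_sets_borel[OF measurable_of_wo gS])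
  have f1m [measurable]: "f1 \<in> borel_measurable borel"
    unfolding f1_def using f(1) by measurable
  have der1: "(g1 has_derivative g1' y) (at y within S1)" if "y \<in> S1" for y
  proof -
    have "(g has_derivative g' (of_wo y)) (at (of_wo y))" using der that by (auto simp: S1_def)
    then have "((\<lambda>y. g (of_wo y)) has_derivative (\<lambda>h. g' (of_wo y) (of_wo h))) (at y)"
      using has_derivative_compose[OF bounded_linear_imp_has_derivative[OF bounded_linear_of_wo]] by blast
    then have "(g1 has_derivative g1' y) (at y)"
      unfolding g1_def g1'_def by (rule bounded_linear.has_derivative[OF bounded_linear_to_wo])
    then show ?thesis by (rule has_derivative_at_withinI)
  qed
  have inj1: "inj_on g1 S1"
    using inj unfolding inj_on_def g1_def S1_def by (metis of_to_wo to_of_wo vimage_eq)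
  have nf: "(\<integral>\<^sup>+y. ennreal (f1 y) \<partial>lborel) < \<infinity>"
    using f(2,3) by (subst nn_integral_to_wo) (auto simp: f1_def integrable_iff_bounded)
  then have "integrable lborel f1"
    using f(3) by (auto simp: integrable_iff_bounded f1_def[symmetric]) (simp add: f1_def)
  then have "set_integrable lborel (g1 ` S1) f1"
    using integrable_mult_indicator[OF _ \<open>integrable lborel f1\<close>, of "g1 ` S1"] gS1m by (simp add: set_integrable_def)
  then have f1i: "f1 absolutely_integrable_on (g1 ` S1)"
    unfolding set_integrable_def by (subst integrable_completion) auto
  have det1: "det (matrix (g1' y)) = det (matrix (g' (of_wo y)))" for y
  proof -
    have ax: "of_wo (axis j 1) = axis (Rep_wo j) (1::real)" for j
      by (auto simp: of_wo_def axis_def vec_eq_iff Rep_wo_inverse Abs_wo_inverse)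
    have "matrix (g1' y) = (\<chi> i j. matrix (g' (of_wo y)) $ Rep_wo i $ Rep_wo j)"
      unfolding matrix_def g1'_def ax by (simp add: vec_eq_iff to_wo_def)
    then show ?thesis using det_reindex[OF bij_Rep_wo] by simp
  qed
  have m2: "(\<lambda>y. ennreal (\<bar>det (matrix (g1' y))\<bar> * f1 (g1 y)) * indicator S1 y) \<in> borel_measurable borel"
  proof -
    have "(\<lambda>y. ennreal (\<bar>det (matrix (g1' y))\<bar> * f1 (g1 y)) * indicator S1 y) =
       (\<lambda>x. indicator S x * ennreal (\<bar>det (matrix (g' x))\<bar> * f (g x))) \<circ> of_wo"
      by (auto simp: fun_eq_iff det1 f1_def g1_def S1_def indicator_def)
    then show ?thesis using measurable_comp[OF measurable_of_wo g'] by simp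
  qed
  have "(\<integral>\<^sup>+y\<in>S1. ennreal (\<bar>det (matrix (g1' y))\<bar> * f1 (g1 y)) \<partial>lborel) = (\<integral>\<^sup>+y\<in>g1 ` S1. ennreal (f1 y) \<partial>lborel)"
    using S1 f(3) by (intro nn_change_of_variables_wo der1 inj1 f1i) (auto simp: f1_def)
  also have "(\<integral>\<^sup>+y\<in>S1. ennreal (\<bar>det (matrix (g1' y))\<bar> * f1 (g1 y)) \<partial>lborel)
     = (\<integral>\<^sup>+x\<in>S. ennreal (\<bar>det (matrix (g' x))\<bar> * f (g x)) \<partial>lborel)"
    by (subst nn_integral_to_wo[OF m2]) (auto intro!: nn_integral_cong simp: det1 f1_def g1_def S1_def indicator_def)
  also have "(\<integral>\<^sup>+y\<in>g1 ` S1. ennreal (f1 y) \<partial>lborel) = (\<integral>\<^sup>+y\<in>g ` S. ennreal (f y) \<partial>lborel)"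
    by (subst nn_integral_to_wo) (auto intro!: nn_integral_cong simp: gS1 f1_def indicator_def)
  finally show ?thesis .
qed

section \<open>Radial integrals\<close>

text \<open>The sign makes the preimages of the half lines \<open>{a<..}\<close> open balls. These
  have finite measure, as the comparison of measures on such half lines requires; for the norm
  itself they would be complements of balls.\<close>

lemma distr_neg_norm:
  "distr lborel borel (\<lambda>x::'a::euclidean_space. - norm x) =
    density lborel (\<lambda>r. ennreal (indicator {..0} r * (DIM('a) * unit_ball_vol DIM('a) * (- r) ^ (DIM('a) - 1))))"
  (is "?L = density lborel ?f")
proof (rule measure_eqI_lessThan)
  let ?n = "DIM('a)"
  have L: "emeasure ?L {a<..} = ennreal (unit_ball_vol ?n * (max 0 (- a)) ^ ?n)" for a :: real
  proof -
    have "(\<lambda>x::'a. - norm x) -` {a<..} = ball 0 (- a)" by auto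
    moreover have "emeasure lborel (ball (0::'a) (- a)) = ennreal (unit_ball_vol ?n * (max 0 (- a)) ^ ?n)"
      by (cases "a < 0") (auto simp: emeasure_ball ball_empty)
    ultimately show ?thesis by (simp add: emeasure_distr)
  qed
  then show "emeasure ?L {a<..} < \<infinity>" for a :: real by simp
  fix a :: real
  have "emeasure (density lborel ?f) {a<..} = (\<integral>\<^sup>+r. ?f r * indicator {a<..} r \<partial>lborel)"
    by (subst emeasure_density) auto
  \<comment> \<open>Using \<open>min a 0\<close> covers nonnegative \<open>a\<close> too: the
    interval then shrinks to the point 0. The integrands differ at most at \<open>a\<close> and at
    0.\<close>
  also have "\<dots> = (\<integral>\<^sup>+r. ennreal (?n * unit_ball_vol ?n * (- r) ^ (?n - 1)) * indicator {min a 0..0} r \<partial>lborel)"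
  proof (rule nn_integral_cong_AE)
    have "AE r in lborel. r \<noteq> a" by (rule AE_lborel_singleton)
    moreover have "AE r in lborel. r \<noteq> (0::real)" by (rule AE_lborel_singleton)
    ultimately show "AE r in lborel. ?f r * indicator {a<..} r =
        ennreal (?n * unit_ball_vol ?n * (- r) ^ (?n - 1)) * indicator {min a 0..0} r"
      by eventually_elim (auto simp: indicator_def)
  qed
  also have "\<dots> = ennreal (- unit_ball_vol ?n * (- 0) ^ ?n - (- unit_ball_vol ?n * (- min a 0) ^ ?n))"
  proof (rule nn_integral_FTC_Icc)
    fix r assume "r \<in> {min a 0..0}"
    show "((\<lambda>r. - unit_ball_vol ?n * (- r) ^ ?n) has_real_derivative ?n * unit_ball_vol ?n * (- r) ^ (?n - 1)) (at r)"
      by (auto intro!: derivative_eq_intros)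
  qed auto
  also have "\<dots> = emeasure ?L {a<..}"
    unfolding L by (auto simp: power_0_left min_def max_def)
  finally show "emeasure ?L {a<..} = emeasure (density lborel ?f) {a<..}" ..
qed auto

lemma nn_integral_radial:
  fixes f :: "real \<Rightarrow> ennreal"
  assumes [measurable]: "f \<in> borel_measurable borel"
  shows "(\<integral>\<^sup>+x. f (norm (x::'a::euclidean_space)) \<partial>lborel) =
    ennreal (DIM('a) * unit_ball_vol DIM('a)) * (\<integral>\<^sup>+r\<in>{0<..}. ennreal (r ^ (DIM('a) - 1)) * f r \<partial>lborel)"
proof -
  let ?n = "DIM('a)" let ?V = "unit_ball_vol DIM('a)"
  have "(\<integral>\<^sup>+x. f (norm (x::'a)) \<partial>lborel) = (\<integral>\<^sup>+r. f (- r) \<partial>distr lborel borel (\<lambda>x::'a. - norm x))"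
    by (subst nn_integral_distr) auto
  also have "\<dots> = (\<integral>\<^sup>+r. ennreal (indicator {..0} r * (?n * ?V * (- r) ^ (?n - 1))) * f (- r) \<partial>lborel)"
    unfolding distr_neg_norm by (subst nn_integral_density) auto
  also have "\<dots> = (\<integral>\<^sup>+r. ennreal (indicator {..0} (- r) * (?n * ?V * r ^ (?n - 1))) * f r \<partial>lborel)"
    by (subst lborel_distr_uminus[symmetric], subst nn_integral_distr) auto
  also have "\<dots> = (\<integral>\<^sup>+r. ennreal (?n * ?V) * (ennreal (r ^ (?n - 1)) * f r * indicator {0<..} r) \<partial>lborel)"
  proof (rule nn_integral_cong_AE)
    have "AE r in lborel. r \<noteq> (0::real)" by (rule AE_lborel_singleton)
    then show "AE r in lborel. ennreal (indicator {..0} (- r) * (?n * ?V * r ^ (?n - 1))) * f r =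
       ennreal (?n * ?V) * (ennreal (r ^ (?n - 1)) * f r * indicator {0<..} r)"
      by eventually_elim (auto simp: indicator_def ennreal_mult' mult_ac)
  qed
  finally show ?thesis by (simp add: nn_integral_cmult)
qed

text \<open>Substitute \<open>t = r\<^sup>2 / (1 + r\<^sup>2)\<close> in the Beta integral, so that
  \<open>1 - t = 1 / (1 + r\<^sup>2)\<close>.\<close>

lemma nn_integral_Beta_substitution:
  assumes a: "a > 0" and b: "b > (0::real)"
  shows "(\<integral>\<^sup>+r\<in>{0<..}. ennreal (2 * r powr (2 * a - 1) * (1 + r\<^sup>2) powr (- a - b)) \<partial>lborel) = ennreal (Beta a b)"
proof -
  let ?f = "\<lambda>t::real. t powr (a - 1) * (1 - t) powr (b - 1)"
  let ?g = "\<lambda>r::real. r\<^sup>2 / (1 + r\<^sup>2)"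
  let ?g' = "\<lambda>r::real. 2 * r / (1 + r\<^sup>2)\<^sup>2"
  have hi: "(?f has_integral Beta a b) {0<..<1}"
    using has_integral_Beta_real[OF a b] by (simp add: has_integral_Icc_iff_Ioo)
  have ai: "?f absolutely_integrable_on {0<..<1}"
    using hi by (subst absolutely_integrable_on_iff_nonneg) auto
  have pos: "1 + r\<^sup>2 > 0" for r :: real by (smt (verit) zero_le_power2)
  have img: "?g ` {0<..} = {0<..<1}"
  proof (intro set_eqI iffI)
    fix t :: real assume "t \<in> {0<..<1}"
    then have t: "0 < t" "t < 1" by auto
    then have "t = ?g (sqrt (t / (1 - t)))" by (simp add: field_simps)
    then show "t \<in> ?g ` {0<..}" using t by (intro image_eqI[where x = "sqrt (t / (1 - t))"]) auto
  qed (use pos in \<open>auto simp: field_simps\<close>)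
  have inj: "inj_on ?g {0<..}"
  proof (rule inj_onI)
    fix r s :: real assume "r \<in> {0<..}" "s \<in> {0<..}" "?g r = ?g s"
    then have "r\<^sup>2 = s\<^sup>2" using pos[of r] pos[of s] by (simp add: divide_simps algebra_simps split: if_splits)
    then show "r = s" using \<open>r \<in> _\<close> \<open>s \<in> _\<close> by (simp add: power2_eq_iff_nonneg)
  qed
  have der: "(?g has_real_derivative ?g' r) (at r within {0<..})" for r
    using pos[of r] by (auto intro!: derivative_eq_intros simp: power2_eq_square field_simps)
  have "(\<lambda>r. \<bar>?g' r\<bar> * ?f (?g r)) absolutely_integrable_on {0<..} \<and>
     integral {0<..} (\<lambda>r. \<bar>?g' r\<bar> * ?f (?g r)) = Beta a b"
    using has_absolute_integral_change_of_variables_1'[OF _ der inj, of ?f "Beta a b"] ai hi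
    by (auto simp: img integral_unique)
  then have "(\<integral>\<^sup>+r\<in>{0<..}. ennreal (\<bar>?g' r\<bar> * ?f (?g r)) \<partial>lborel) = ennreal (Beta a b)"
    by (subst absolutely_integrable_nn_integral) auto
  moreover have "\<bar>?g' r\<bar> * ?f (?g r) = 2 * r powr (2 * a - 1) * (1 + r\<^sup>2) powr (- a - b)" if r: "r > 0" for r
  proof -
    have q: "1 + r\<^sup>2 > 0" by (rule pos)
    have e: "1 - ?g r = 1 / (1 + r\<^sup>2)" using q by (simp add: field_simps)
    \<comment> \<open>Both sides are positive, so comparing logarithms reduces the identity between
      powers to a linear one.\<close>
    have "ln (\<bar>?g' r\<bar> * ?f (?g r)) = ln (2 * r powr (2 * a - 1) * (1 + r\<^sup>2) powr (- a - b))"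
      unfolding e using r q
      by (simp add: ln_mult ln_div ln_powr ln_realpow, simp add: algebra_simps)
    moreover have "\<bar>?g' r\<bar> * ?f (?g r) > 0" unfolding e using r q by (intro mult_pos_pos) auto
    moreover have "2 * r powr (2 * a - 1) * (1 + r\<^sup>2) powr (- a - b) > 0" using r q by simp
    ultimately show ?thesis by (simp only: ln_inj_iff)
  qed
  ultimately show ?thesis
    by (auto simp: indicator_def intro!: nn_integral_cong elim!: trans[rotated])
qed

section \<open>The stereographic projection\<close>

lemma one_plus_norm_sq_pos: "0 < 1 + (norm (x :: 'a::real_normed_vector))\<^sup>2"
  by (smt (verit) zero_le_power2)

lemma conf_factor_pos [simp]: "0 < conf_factor x"
  using one_plus_norm_sq_pos[of x] by (simp add: conf_factor_def)

lemma conf_factor_le_2: "conf_factor x \<le> 2"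
  using one_plus_norm_sq_pos[of x] by (simp add: conf_factor_def field_simps)

lemma conf_factor_neq [simp]: "conf_factor x \<noteq> 0"
  using conf_factor_pos[of x] by linarith

lemma conf_factor_norm_sq: "conf_factor x * (norm x)\<^sup>2 = 2 - conf_factor x"
proof -
  have "1 + (norm x)\<^sup>2 \<noteq> 0" using one_plus_norm_sq_pos[of x] by linarith
  then show ?thesis by (simp add: conf_factor_def field_simps)
qed

lemma conf_factor_inner_self: "conf_factor x * (x \<bullet> x) = 2 - conf_factor x"
  using conf_factor_norm_sq[of x] by (simp add: power2_norm_eq_inner)

text \<open>The value \<open>s = N\<close> gives the total volume of the sphere, and general
  \<open>s\<close> the masses of the zonal kernels. Polar coordinates lead to the Beta integral with
  parameters \<open>N/2\<close> and \<open>s/2\<close>.\<close>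

lemma nn_integral_conf_factor_powr:
  assumes "s > 0"
  shows "(\<integral>\<^sup>+x. ennreal (conf_factor (x :: real ^ 'n) powr ((real CARD('n) + s) / 2)) \<partial>lborel) =
    ennreal (CARD('n) * unit_ball_vol CARD('n) * 2 powr ((real CARD('n) + s) / 2) / 2 * Beta (real CARD('n) / 2) (s / 2))"
proof -
  let ?N = "real CARD('n)"
  let ?q = "(?N + s) / 2"
  have N: "?N \<ge> 1" "DIM(real^'n) = CARD('n)" by (auto simp: Suc_le_eq)
  have "(\<integral>\<^sup>+x. ennreal (conf_factor (x :: real ^ 'n) powr ?q) \<partial>lborel) =
     ennreal (?N * unit_ball_vol ?N) * (\<integral>\<^sup>+r\<in>{0<..}. ennreal (r ^ (CARD('n) - 1)) * ennreal ((2 / (1 + r\<^sup>2)) powr ?q) \<partial>lborel)"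
    unfolding conf_factor_def by (subst nn_integral_radial[where f = "\<lambda>r. ennreal ((2 / (1 + r\<^sup>2)) powr ?q)"]) (simp_all add: N)
  also have "(\<integral>\<^sup>+r\<in>{0<..}. ennreal (r ^ (CARD('n) - 1)) * ennreal ((2 / (1 + r\<^sup>2)) powr ?q) \<partial>lborel) =
    (\<integral>\<^sup>+r. ennreal (2 powr ?q / 2) * (ennreal (2 * r powr (2 * (?N/2) - 1) * (1 + r\<^sup>2) powr (- (?N/2) - s/2)) * indicator {0<..} r) \<partial>lborel)"
  proof (intro nn_integral_cong)
    fix r :: real
    have q: "1 + r\<^sup>2 > 0" by (smt (verit) zero_le_power2)
    have "r ^ (CARD('n) - 1) * (2 / (1 + r\<^sup>2)) powr ?q =
       2 powr ?q / 2 * (2 * r powr (2 * (?N/2) - 1) * (1 + r\<^sup>2) powr (- (?N/2) - s/2))" if "r > 0"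
    proof -
      have "r ^ (CARD('n) - 1) = r powr (?N - 1)"
        using that by (subst powr_realpow[symmetric]) (auto simp: of_nat_diff Suc_le_eq)
      moreover have "(2 / (1 + r\<^sup>2)) powr ?q = 2 powr ?q * (1 + r\<^sup>2) powr (- (?N/2) - s/2)"
      proof -
        have "- (?N/2) - s/2 = - ?q" by (simp add: add_divide_distrib)
        then show ?thesis using q by (simp only: powr_minus_divide powr_divide) simp
      qed
      ultimately show ?thesis by simp
    qed
    then show "ennreal (r ^ (CARD('n) - 1)) * ennreal ((2 / (1 + r\<^sup>2)) powr ?q) * indicator {0<..} r =
      ennreal (2 powr ?q / 2) * (ennreal (2 * r powr (2 * (?N/2) - 1) * (1 + r\<^sup>2) powr (- (?N/2) - s/2)) * indicator {0<..} r)"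
      by (auto simp: indicator_def ennreal_mult'[symmetric])
  qed
  also have "\<dots> = ennreal (2 powr ?q / 2) * ennreal (Beta (?N/2) (s/2))"
    using assms N by (subst nn_integral_cmult, simp, subst nn_integral_Beta_substitution) auto
  also have "\<dots> = ennreal (2 powr ?q / 2 * Beta (?N/2) (s/2))"
    by (rule ennreal_mult'[symmetric]) simp
  also have "ennreal (?N * unit_ball_vol ?N) * \<dots> = ennreal (?N * unit_ball_vol ?N * (2 powr ?q / 2 * Beta (?N/2) (s/2)))"
    by (rule ennreal_mult'[symmetric]) simp
  finally show ?thesis by (simp only: mult.assoc times_divide_eq_left times_divide_eq_right)
qed

definition stereo :: "(real ^ 'n) \<times> real \<Rightarrow> real ^ 'n" where
  "stereo w = (1 / (1 + snd w)) *\<^sub>R fst w"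

text \<open>With all nonlinearity in one scalar factor, the identities below reduce to
  \<open>conf_factor_inner_self\<close>, and derivatives to the product rule.\<close>

lemma inv_stereo_alt: "inv_stereo x = conf_factor x *\<^sub>R (x, 1) + (0, - 1)"
  using one_plus_norm_sq_pos[of x] by (simp add: inv_stereo_def conf_factor_def field_simps)

lemma snd_inv_stereo: "snd (inv_stereo x) = conf_factor x - 1"
  by (simp add: inv_stereo_alt)

lemma chordal_distance_sq:
  "(norm (inv_stereo x - inv_stereo y))\<^sup>2 = conf_factor x * conf_factor y * (norm (x - y))\<^sup>2"
proof -
  let ?a = "conf_factor x" and ?b = "conf_factor y"
  have a: "?a * (x \<bullet> x) = 2 - ?a" "?b * (y \<bullet> y) = 2 - ?b"
    by (rule conf_factor_inner_self)+
  have "(norm (inv_stereo x - inv_stereo y))\<^sup>2 =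
     ?a * (?a * (x \<bullet> x)) - 2 * ?a * ?b * (x \<bullet> y) + ?b * (?b * (y \<bullet> y)) + (?a - ?b)\<^sup>2"
    unfolding power2_norm_eq_inner inv_stereo_alt
    by (simp add: inner_diff_left inner_diff_right inner_commute) (simp add: power2_eq_square algebra_simps)
  also have "\<dots> = ?b * (?a * (x \<bullet> x)) - 2 * ?a * ?b * (x \<bullet> y) + ?a * (?b * (y \<bullet> y))"
    unfolding a by (simp add: algebra_simps power2_eq_square)
  also have "\<dots> = ?a * ?b * (norm (x - y))\<^sup>2"
    by (simp add: power2_norm_eq_inner inner_diff_left inner_diff_right inner_commute algebra_simps)
  finally show ?thesis .
qed

text \<open>The omitted pole is the reference point for zonal integrals, since the distance to it is
  a function of \<open>conf_factor\<close> alone.\<close>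

lemma pole_distance_sq: "(norm ((0, - 1) - inv_stereo x))\<^sup>2 = 2 * conf_factor x"
proof -
  have "(norm ((0, - 1) - inv_stereo x))\<^sup>2 = conf_factor x * (conf_factor x * (x \<bullet> x)) + (conf_factor x)\<^sup>2"
    unfolding power2_norm_eq_inner inv_stereo_alt by (simp add: power2_eq_square)
  then show ?thesis
    unfolding conf_factor_inner_self by (simp add: algebra_simps power2_eq_square)
qed

lemma unit_sphere_iff: "w \<in> unit_sphere \<longleftrightarrow> fst w \<bullet> fst w + (snd w)\<^sup>2 = 1"
  by (simp add: unit_sphere_def norm_eq_1 inner_prod_def power2_eq_square)

lemma inv_stereo_in_sphere [simp]: "inv_stereo x \<in> unit_sphere"
proof -
  have "fst (inv_stereo x) \<bullet> fst (inv_stereo x) = conf_factor x * (conf_factor x * (x \<bullet> x))"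
    by (simp add: inv_stereo_alt)
  then show ?thesis
    unfolding unit_sphere_iff snd_inv_stereo conf_factor_inner_self
    by (simp add: algebra_simps power2_eq_square)
qed

lemma inv_stereo_neq_pole [simp]: "inv_stereo x \<noteq> (0, - 1)"
proof
  assume "inv_stereo x = (0, - 1)"
  then show False using snd_inv_stereo[of x] by simp
qed

lemma stereo_inv_stereo [simp]: "stereo (inv_stereo x) = x"
  using conf_factor_pos[of x] by (simp add: stereo_def inv_stereo_alt)

lemma sphere_snd_neq: "w \<in> unit_sphere \<Longrightarrow> w \<noteq> (0, - 1) \<Longrightarrow> 1 + snd w \<noteq> 0"
proof
  assume w: "w \<in> unit_sphere" "w \<noteq> (0, - 1)" "1 + snd w = 0"
  then have s: "snd w = - 1" by simp
  then have "fst w = 0" using w(1) by (simp add: unit_sphere_iff)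
  then show False using s w(2) by (metis prod.collapse)
qed

lemma inv_stereo_stereo:
  assumes "w \<in> unit_sphere" "w \<noteq> (0, - 1)"
  shows "inv_stereo (stereo w) = w"
proof -
  have ne: "1 + snd w \<noteq> 0" using assms by (rule sphere_snd_neq)
  have ff: "fst w \<bullet> fst w = (1 - snd w) * (1 + snd w)"
    using assms(1) by (simp add: unit_sphere_iff algebra_simps power2_eq_square)
  have n: "1 + (norm (stereo w))\<^sup>2 = 2 / (1 + snd w)"
    using ne unfolding stereo_def power2_norm_eq_inner by (simp add: ff) (simp add: field_simps)
  have "conf_factor (stereo w) = 1 + snd w"
    unfolding conf_factor_def n using ne by simp
  then show ?thesis
    using ne by (simp add: inv_stereo_alt stereo_def prod_eq_iff)
qed

lemma range_inv_stereo: "range inv_stereo = unit_sphere - {(0, - 1)}"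
proof (intro set_eqI iffI)
  fix w :: "(real ^ 'n) \<times> real"
  assume "w \<in> unit_sphere - {(0, - 1)}"
  then show "w \<in> range inv_stereo" using inv_stereo_stereo[of w] by (metis DiffE insertI1 rangeI)
qed (auto simp: inv_stereo_neq_pole[symmetric] simp del: inv_stereo_neq_pole)

lemma inj_inv_stereo: "inj inv_stereo"
  by (metis injI stereo_inv_stereo)

text \<open>Expressing the derivative through \<open>conf_factor\<close> itself and a linear
  function lets the induction for smoothness close by the product rule.\<close>

lemma conf_factor_has_derivative:
  "(conf_factor has_derivative (\<lambda>b. - (conf_factor x * (conf_factor x * (x \<bullet> b))))) (at x)"
proof -
  have "((\<lambda>x. 2 / (1 + x \<bullet> x)) has_derivative (\<lambda>b. - (2 * (2 * (x \<bullet> b)) / (1 + x \<bullet> x)\<^sup>2))) (at x)"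
  proof -
    have "1 + x \<bullet> x \<noteq> 0" by (smt (verit) inner_ge_zero)
    then show ?thesis
      by (auto intro!: derivative_eq_intros simp: inner_commute power2_eq_square field_simps)
  qed
  moreover have eq: "(\<lambda>x. 2 / (1 + x \<bullet> x)) = conf_factor"
    by (auto simp: conf_factor_def power2_norm_eq_inner)
  moreover have "- (2 * (2 * (x \<bullet> b)) / (1 + x \<bullet> x)\<^sup>2) = - (conf_factor x * (conf_factor x * (x \<bullet> b)))" for b
    unfolding conf_factor_def power2_norm_eq_inner by (simp add: power2_eq_square)
  ultimately have "((\<lambda>x. 2 / (1 + x \<bullet> x)) has_derivative (\<lambda>b. - (conf_factor x * (conf_factor x * (x \<bullet> b))))) (at x)"
    by (simp only:)
  then show ?thesis unfolding eq .
qed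

lemma Ck_on_conf_factor: "Ck_on k UNIV conf_factor"
proof (induction k)
  case 0
  show ?case by (simp add: continuous_on_eq_continuous_at)
     (metis conf_factor_has_derivative has_derivative_continuous)
next
  case (Suc k)
  show ?case
  proof (rule Ck_on_SucI[OF _ conf_factor_has_derivative])
    fix b :: "real ^ 'a"
    have "Ck_on k UNIV (\<lambda>x. conf_factor x *\<^sub>R (conf_factor x *\<^sub>R (x \<bullet> (- b))))"
      by (intro Ck_on_scaleR Suc Ck_on_bounded_linear bounded_linear_inner_left) auto
    then show "Ck_on k UNIV (\<lambda>x. - (conf_factor x * (conf_factor x * (x \<bullet> b))))" by simp
  qed auto
qed

lemma continuous_conf_factor: "continuous_on S conf_factor"
  using Ck_on_conf_factor[of 0] continuous_on_subset by force

lemma borel_conf_factor [measurable]: "conf_factor \<in> borel_measurable borel"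
  by (intro borel_measurable_continuous_onI continuous_conf_factor)

lemma smooth_inv_stereo: "smooth_on_open UNIV inv_stereo"
  unfolding smooth_on_open_def
proof (intro conjI allI)
  fix k
  have "Ck_on k UNIV (\<lambda>x :: real ^ 'a. conf_factor x *\<^sub>R ((x, 0) + (0, 1 :: real)) + (0, - 1 :: real))"
    by (intro Ck_on_add Ck_on_scaleR Ck_on_conf_factor Ck_on_const Ck_on_bounded_linear)
      (auto intro: bounded_linear_Pair bounded_linear_ident bounded_linear_zero)
  then show "Ck_on k UNIV (inv_stereo :: real ^ 'a \<Rightarrow> _)"
    by (simp add: inv_stereo_alt[abs_def])
qed auto

lemma continuous_inv_stereo: "continuous_on S inv_stereo"
  using smooth_inv_stereo[unfolded smooth_on_open_def, THEN conjunct2, rule_format, of 0] continuous_on_subset by force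

lemma borel_inv_stereo [measurable]: "inv_stereo \<in> borel_measurable borel"
  by (intro borel_measurable_continuous_onI continuous_inv_stereo)

lemma borel_stereo [measurable]: "stereo \<in> borel_measurable borel"
proof -
  have "stereo \<in> borel_measurable (borel \<Otimes>\<^sub>M borel)"
    unfolding stereo_def[abs_def] by measurable
  then show ?thesis by (simp add: borel_prod)
qed

definition inv_stereo_deriv :: "real ^ 'n \<Rightarrow> real ^ 'n \<Rightarrow> (real ^ 'n) \<times> real" where
  "inv_stereo_deriv x b = (- (conf_factor x * (conf_factor x * (x \<bullet> b)))) *\<^sub>R (x, 1) + conf_factor x *\<^sub>R (b, 0)"

lemma inv_stereo_has_derivative: "(inv_stereo has_derivative inv_stereo_deriv x) (at x)"
proof -
  have "((\<lambda>x. conf_factor x *\<^sub>R (x, 1::real) + (0, - 1)) has_derivative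
      (\<lambda>b. conf_factor x *\<^sub>R (b, 0) + (- (conf_factor x * (conf_factor x * (x \<bullet> b)))) *\<^sub>R (x, 1) + 0)) (at x)"
    by (intro has_derivative_add has_derivative_scaleR conf_factor_has_derivative has_derivative_Pair
        has_derivative_ident has_derivative_const)
  then show ?thesis
    by (simp add: inv_stereo_alt[abs_def] inv_stereo_deriv_def[abs_def] add.commute)
qed

text \<open>Conformality of the chart: the terms containing \<open>x \<bullet> a\<close> and
  \<open>x \<bullet> b\<close> cancel once \<open>conf_factor x * (x \<bullet> x)\<close> is
  replaced by \<open>2 - conf_factor x\<close>.\<close>

lemma inv_stereo_deriv_inner: "inv_stereo_deriv x a \<bullet> inv_stereo_deriv x b = (conf_factor x)\<^sup>2 * (a \<bullet> b)"
proof -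
  let ?c = "conf_factor x"
  have "inv_stereo_deriv x a \<bullet> inv_stereo_deriv x b =
     ?c * ?c * (?c * (?c * (x \<bullet> x))) * (x \<bullet> a) * (x \<bullet> b) - 2 * (?c * ?c * ?c) * (x \<bullet> a) * (x \<bullet> b)
       + ?c * ?c * ?c * ?c * (x \<bullet> a) * (x \<bullet> b) + ?c\<^sup>2 * (a \<bullet> b)"
    by (simp add: inv_stereo_deriv_def inner_diff_left inner_diff_right inner_commute)
      (simp add: algebra_simps power2_eq_square)
  then show ?thesis
    unfolding conf_factor_inner_self by (simp add: algebra_simps)
qed

text \<open>Conformality reduces the Gram determinant of any parametrization to the Jacobian of its
  expression in stereographic coordinates.\<close>

lemma metric_coeffs_stereo:
  fixes F :: "real ^ 'n \<Rightarrow> (real ^ 'n) \<times> real"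
  assumes T: "(T has_derivative T') (at x)"
    and F: "open S" "x \<in> S" "\<And>y. y \<in> S \<Longrightarrow> F y = inv_stereo (T y)"
  shows "sqrt (det (metric_coeffs F x)) = \<bar>det (matrix T')\<bar> * conf_factor (T x) ^ CARD('n)"
    and "inj T' \<Longrightarrow> inj (frechet_derivative F (at x))"
proof -
  have "((\<lambda>y. inv_stereo (T y)) has_derivative (\<lambda>b. inv_stereo_deriv (T x) (T' b))) (at x)"
    using has_derivative_compose[OF T inv_stereo_has_derivative] .
  then have "(F has_derivative (\<lambda>b. inv_stereo_deriv (T x) (T' b))) (at x)"
    by (rule has_derivative_transform_within_open[OF _ F(1,2)]) (simp add: F(3))
  then have fd: "frechet_derivative F (at x) = (\<lambda>b. inv_stereo_deriv (T x) (T' b))"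
    by (metis frechet_derivative_at)
  have lin: "linear T'" using T by (rule has_derivative_linear)
  have "metric_coeffs F x = (\<chi> i. (conf_factor (T x))\<^sup>2 *s ((transpose (matrix T') ** matrix T') $ i))"
    by (simp add: vec_eq_iff metric_coeffs_def fd inv_stereo_deriv_inner matrix_matrix_mult_def transpose_def
        matrix_def inner_vec_def)
  then have "det (metric_coeffs F x) = ((conf_factor (T x))\<^sup>2) ^ CARD('n) * (det (matrix T') * det (matrix T'))"
    by (simp add: det_rows_mul det_mul det_transpose)
  also have "\<dots> = (\<bar>det (matrix T')\<bar> * conf_factor (T x) ^ CARD('n))\<^sup>2"
    by (simp add: power_mult_distrib power2_eq_square)
  finally show "sqrt (det (metric_coeffs F x)) = \<bar>det (matrix T')\<bar> * conf_factor (T x) ^ CARD('n)"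
    using conf_factor_pos[of "T x"] by (simp del: conf_factor_pos)
  show "inj (frechet_derivative F (at x))" if "inj T'"
  proof (rule injI)
    fix a b assume "frechet_derivative F (at x) a = frechet_derivative F (at x) b"
    then have eq: "inv_stereo_deriv (T x) (T' a) = inv_stereo_deriv (T x) (T' b)" by (simp add: fd)
    have "inv_stereo_deriv y (u - w) = inv_stereo_deriv y u - inv_stereo_deriv y w" for y u w :: "real ^ 'n"
      by (simp add: inv_stereo_deriv_def inner_diff_right algebra_simps)
    then have "inv_stereo_deriv (T x) (T' a - T' b) \<bullet> inv_stereo_deriv (T x) (T' a - T' b) = 0"
      using eq by simp
    then have "T' a - T' b = 0"
      using conf_factor_pos[of "T x"] by (simp add: inv_stereo_deriv_inner del: conf_factor_pos)
    then show "a = b" using \<open>inj T'\<close> by (simp add: inj_eq)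
  qed
qed

section \<open>The Riemannian volume of the sphere\<close>

lemma local_paramD:
  assumes "local_param U F"
  shows "open U" "Ck_on k U F" "inj_on F U" "F ` U \<subseteq> unit_sphere" "x \<in> U \<Longrightarrow> inj (frechet_derivative F (at x))"
  using assms by (auto simp: local_param_def smooth_on_open_def)

text \<open>Serves twice: with \<open>flip\<close> it provides a chart around the omitted pole, with
  reflections it gives the invariance of the volume.\<close>

lemma local_param_compose_isometry:
  fixes R :: "(real ^ 'n) \<times> real \<Rightarrow> (real ^ 'n) \<times> real"
  assumes F: "local_param U F" and R: "linear R" "\<And>w. norm (R w) = norm w"
  shows "local_param U (\<lambda>x. R (F x))"
    and "x \<in> U \<Longrightarrow> metric_coeffs (\<lambda>x. R (F x)) x = metric_coeffs F x"
proof -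
  note FD = local_paramD[OF F]
  have bl: "bounded_linear R" using R(1) by (simp add: linear_conv_bounded_linear)
  have ot: "orthogonal_transformation R" using R by (simp add: orthogonal_transformation)
  have injR: "inj R" using ot by (rule orthogonal_transformation_inj)
  have fd: "frechet_derivative (\<lambda>x. R (F x)) (at x) = (\<lambda>b. R (frechet_derivative F (at x) b))" if "x \<in> U" for x
    using bounded_linear.has_derivative[OF bl Ck_on_Suc_has_derivative[OF FD(1) FD(2)[of "Suc 0"] that]]
    by (metis frechet_derivative_at)
  show "metric_coeffs (\<lambda>x. R (F x)) x = metric_coeffs F x" if "x \<in> U"
    unfolding metric_coeffs_def fd[OF that] using ot by (simp only: orthogonal_transformation_def)
  have "inj_on (\<lambda>x. R (F x)) U"
    using FD(3) injR unfolding inj_on_def by blast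
  moreover have "(\<lambda>x. R (F x)) ` U \<subseteq> unit_sphere"
  proof
    fix w assume "w \<in> (\<lambda>x. R (F x)) ` U"
    then obtain x where "x \<in> U" "w = R (F x)" by blast
    moreover from this have "norm (F x) = 1" using FD(4) by (auto simp: unit_sphere_def)
    ultimately show "w \<in> unit_sphere" by (simp add: R(2) unit_sphere_def)
  qed
  moreover have "inj (frechet_derivative (\<lambda>x. R (F x)) (at x))" if "x \<in> U" for x
    using inj_compose[OF injR FD(5)[OF that]] unfolding fd[OF that] by (simp add: o_def)
  moreover have "smooth_on_open U (\<lambda>x. R (F x))"
    using F bl by (auto simp: local_param_def intro: smooth_compose_bounded_linear)
  ultimately show "local_param U (\<lambda>x. R (F x))"
    by (auto simp: local_param_def)
qed

lemma local_param_inv_stereo: "local_param UNIV inv_stereo"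
  unfolding local_param_def
  using smooth_inv_stereo inj_inv_stereo metric_coeffs_stereo(2)[of "\<lambda>x. x" "\<lambda>x. x" _ UNIV inv_stereo]
  by (auto intro: has_derivative_ident)

text \<open>The candidate for the measure that \<open>sphere_vol\<close> describes: the density is
  the volume factor of the chart \<open>inv_stereo\<close>, and the omitted pole has measure
  zero.\<close>

definition stereo_vol :: "((real ^ 'n) \<times> real) measure" where
  "stereo_vol = distr (density lborel (\<lambda>x. ennreal (conf_factor x ^ CARD('n))))
     (restrict_space borel unit_sphere) inv_stereo"

lemma closed_unit_sphere: "closed unit_sphere"
  by (simp add: unit_sphere_def)

lemma measurable_inv_stereo [measurable]: "inv_stereo \<in> borel \<rightarrow>\<^sub>M restrict_space borel unit_sphere"
  by (intro measurable_restrict_space2) auto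

lemma sets_sphere_iff:
  "A \<in> sets (restrict_space borel unit_sphere) \<longleftrightarrow> A \<in> sets borel \<and> A \<subseteq> unit_sphere"
  using closed_unit_sphere by (subst sets_restrict_space_iff) (auto intro: borel_closed)

lemma emeasure_stereo_vol:
  assumes "A \<in> sets (restrict_space borel unit_sphere)"
  shows "emeasure (stereo_vol :: ((real ^ 'n) \<times> real) measure) A =
    (\<integral>\<^sup>+x\<in>inv_stereo -` A. ennreal (conf_factor x ^ CARD('n)) \<partial>lborel)"
proof -
  have "inv_stereo -` A \<in> sets (borel :: (real ^ 'n) measure)"
    using assms by (intro measurable_sets_borel[OF borel_inv_stereo]) (auto simp: sets_sphere_iff)
  then show ?thesis
    unfolding stereo_vol_def using assms
    by (subst emeasure_distr) (auto simp: emeasure_density)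
qed

lemma nn_integral_conf_factor_power_finite:
  "(\<integral>\<^sup>+x. ennreal (conf_factor (x :: real ^ 'n) ^ CARD('n)) \<partial>lborel) < \<infinity>"
proof -
  have "conf_factor x ^ CARD('n) = conf_factor x powr ((real CARD('n) + real CARD('n)) / 2)" for x :: "real ^ 'n"
    by (simp add: powr_realpow)
  then show ?thesis
    using nn_integral_conf_factor_powr[of "real CARD('n)", where ?'n = 'n] by simp
qed

lemma integrable_conf_factor_power: "integrable lborel (\<lambda>x :: real ^ 'n. conf_factor x ^ CARD('n))"
proof -
  have "\<bar>conf_factor x ^ CARD('n)\<bar> = conf_factor x ^ CARD('n)" for x :: "real ^ 'n"
    by (simp add: less_imp_le)
  then show ?thesis
    using nn_integral_conf_factor_power_finite[where 'n = 'n] by (simp add: integrable_iff_bounded)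
qed

lemma continuous_on_det_metric:
  assumes "local_param U F"
  shows "continuous_on U (\<lambda>x. sqrt (det (metric_coeffs F x)))"
proof -
  have "continuous_on U (\<lambda>x. frechet_derivative F (at x) (axis i 1))" for i
    using local_paramD(2)[OF assms, of "Suc 0"] by (simp add: axis_in_Basis_iff)
  then show ?thesis
    unfolding det_def metric_coeffs_def by (auto intro!: continuous_intros)
qed

lemma stereo_has_derivative:
  assumes "1 + snd w \<noteq> 0"
  shows "\<exists>D. (stereo has_derivative D) (at w)"
  unfolding stereo_def[abs_def] using assms
  by (intro exI) (rule derivative_eq_intros refl | simp)+

text \<open>For an arbitrary chart \<open>F\<close> the map \<open>T = stereo \<circ> F\<close> is a
  change of coordinates, and \<open>metric_coeffs_stereo\<close> turns the Gram density into its
  Jacobian times the density of \<open>stereo_vol\<close>. Points sent to the pole are removed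
  first.\<close>

lemma is_riemannian_volume_stereo_vol: "is_riemannian_volume (stereo_vol :: ((real ^ 'n) \<times> real) measure)"
  unfolding is_riemannian_volume_def
proof (intro conjI allI impI ballI)
  show "sets (stereo_vol :: ((real ^ 'n) \<times> real) measure) = sets (restrict_space borel unit_sphere)"
    by (simp add: stereo_vol_def)
  fix U and F :: "real ^ 'n \<Rightarrow> (real ^ 'n) \<times> real" and A
  assume F: "local_param U F" and A [measurable]: "A \<in> sets borel" and AF: "A \<subseteq> F ` U"
  note FD = local_paramD[OF F]
  let ?p = "(0, - 1) :: (real ^ 'n) \<times> real"
  let ?m = "\<lambda>x. sqrt (det (metric_coeffs F x))"
  have U [measurable]: "U \<in> sets borel" using FD(1) by auto
  have contF: "continuous_on U F" using FD(2)[of 0] by simp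
  have pre: "U \<inter> F -` B \<in> sets borel" if "B \<in> sets borel" for B
  proof -
    have "F -` B \<inter> space (restrict_space borel U) \<in> sets (restrict_space borel U)"
      using measurable_sets[OF borel_measurable_continuous_on_restrict[OF contF] that] .
    then show ?thesis
      using U by (auto simp: sets_restrict_space_iff space_restrict_space Int_commute)
  qed
  define S where "S = U \<inter> F -` (A - {?p})"
  define T where "T x = stereo (F x)" for x
  have S [measurable]: "S \<in> sets borel" unfolding S_def by (rule pre) auto
  have U1: "open (U \<inter> F -` (- {?p}))"
    using contF FD(1) by (intro continuous_open_preimage) auto
  have FT: "F y = inv_stereo (T y)" if "y \<in> U \<inter> F -` (- {?p})" for y
    using that FD(4) unfolding T_def by (intro inv_stereo_stereo[symmetric]) auto
  have SU: "S \<subseteq> U \<inter> F -` (- {?p})" by (auto simp: S_def)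
  define T' where "T' x = frechet_derivative T (at x)" for x
  have T': "(T has_derivative T' x) (at x)" if "x \<in> S" for x
  proof -
    have "1 + snd (F x) \<noteq> 0" using that FD(4) by (intro sphere_snd_neq) (auto simp: S_def)
    then obtain D where "(stereo has_derivative D) (at (F x))" using stereo_has_derivative by blast
    moreover have "(F has_derivative frechet_derivative F (at x)) (at x)"
      using that by (intro Ck_on_Suc_has_derivative[OF FD(1,2)]) (auto simp: S_def)
    ultimately have "(T has_derivative (\<lambda>b. D (frechet_derivative F (at x) b))) (at x)"
      unfolding T_def by (rule has_derivative_compose[rotated])
    then show ?thesis unfolding T'_def by (metis frechet_derivative_at)
  qed
  have met: "?m x = \<bar>det (matrix (T' x))\<bar> * conf_factor (T x) ^ CARD('n)" if "x \<in> S" for x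
    by (rule metric_coeffs_stereo(1)[OF T'[OF that] U1 _ FT]) (use that SU in auto)
  have TS: "T ` S = inv_stereo -` A"
  proof (intro set_eqI iffI)
    fix y assume "y \<in> inv_stereo -` A"
    then obtain x where x: "x \<in> U" "F x = inv_stereo y" using AF by fastforce
    then have "x \<in> S" "T x = y"
      using \<open>y \<in> inv_stereo -` A\<close> by (auto simp: S_def T_def)
    then show "y \<in> T ` S" by blast
  next
    fix y assume "y \<in> T ` S"
    then show "y \<in> inv_stereo -` A" using FT SU by (auto simp: S_def)
  qed
  have injT: "inj_on T S"
  proof (rule inj_onI)
    fix x y assume "x \<in> S" "y \<in> S" "T x = T y"
    then have "F x = F y" using FT[OF subsetD[OF SU]] by simp
    then show "x = y" using FD(3) \<open>x \<in> S\<close> \<open>y \<in> S\<close> by (auto simp: S_def inj_on_def)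
  qed
  \<comment> \<open>The derivative of \<open>T\<close> is controlled on \<open>S\<close> only. Its
    Jacobian inherits measurability from the Gram determinant, which is continuous on
    \<open>U\<close> and agrees with the transformed density on \<open>S\<close>.\<close>
  have mm: "(\<lambda>x. indicator U x *\<^sub>R ?m x) \<in> borel_measurable borel"
    by (intro borel_measurable_continuous_on_indicator U continuous_on_det_metric F)
  have "(\<lambda>x. indicator S x * ennreal (indicator U x *\<^sub>R ?m x)) \<in> borel_measurable borel"
    using mm by measurable
  moreover have "(\<lambda>x. indicator S x * ennreal (indicator U x *\<^sub>R ?m x)) =
     (\<lambda>x. indicator S x * ennreal (\<bar>det (matrix (T' x))\<bar> * conf_factor (T x) ^ CARD('n)))"
    using met SU by (auto simp: fun_eq_iff indicator_def)
  ultimately have mT: "(\<lambda>x. indicator S x * ennreal (\<bar>det (matrix (T' x))\<bar> * conf_factor (T x) ^ CARD('n))) \<in> borel_measurable borel"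
    by simp
  have Asp: "A \<in> sets (restrict_space borel unit_sphere)"
    using AF FD(4) by (auto simp: sets_sphere_iff)
  have TSb: "T ` S \<in> sets borel"
    unfolding TS by (rule measurable_sets_borel[OF borel_inv_stereo A])
  have "emeasure stereo_vol A = (\<integral>\<^sup>+y\<in>T ` S. ennreal (conf_factor y ^ CARD('n)) \<partial>lborel)"
    unfolding TS by (rule emeasure_stereo_vol[OF Asp])
  also have "\<dots> = (\<integral>\<^sup>+x\<in>S. ennreal (\<bar>det (matrix (T' x))\<bar> * conf_factor (T x) ^ CARD('n)) \<partial>lborel)"
    by (rule nn_change_of_variables[symmetric, OF S T' injT TSb mT])
      (auto intro!: integrable_conf_factor_power simp: less_imp_le)
  also have "\<dots> = (\<integral>\<^sup>+x\<in>U \<inter> F -` A. ennreal (?m x) \<partial>lborel)"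
  proof (rule nn_integral_cong_AE)
    \<comment> \<open>By injectivity at most one parameter is sent to the pole, so returning from
      \<open>S\<close> to the full preimage of \<open>A\<close> changes the integral by
      nothing.\<close>
    have "\<exists>a. U \<inter> F -` {?p} \<subseteq> {a}"
    proof (cases "U \<inter> F -` {?p} = {}")
      case False
      then obtain a where a: "a \<in> U" "F a = ?p" by auto
      have "b = a" if "b \<in> U \<inter> F -` {?p}" for b
        by (rule inj_onD[OF FD(3)]) (use that a in auto)
      then show ?thesis by blast
    qed simp
    then obtain a where a: "U \<inter> F -` {?p} \<subseteq> {a}" ..
    have "AE x in lborel. x \<noteq> a" by (rule AE_lborel_singleton)
    then show "AE x in lborel. ennreal (\<bar>det (matrix (T' x))\<bar> * conf_factor (T x) ^ CARD('n)) * indicator S x =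
      ennreal (?m x) * indicator (U \<inter> F -` A) x"
    proof eventually_elim
      case (elim x)
      then have "x \<in> S \<longleftrightarrow> x \<in> U \<inter> F -` A" using a by (auto simp: S_def)
      then show ?case
        using met[of x] by (cases "x \<in> S") (simp_all only: indicator_simps mult_zero_right not_True_eq_False not_False_eq_True)
    qed
  qed
  finally show "emeasure stereo_vol A = (\<integral>\<^sup>+x\<in>U \<inter> F -` A. ennreal (?m x) \<partial>lborel)" .
qed

definition flip :: "(real ^ 'n) \<times> real \<Rightarrow> (real ^ 'n) \<times> real" where
  "flip w = (fst w, - snd w)"

lemma flip_isometry: "linear flip" "norm (flip w) = norm w"
  by (auto intro!: linearI simp: flip_def prod_eq_iff norm_prod_def)

text \<open>Two charts cover the sphere: \<open>inv_stereo\<close> omits only the pole, and its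
  mirror image contains it. Each set is cut at the pole and the two pieces are measured in different
  charts.\<close>

lemma is_riemannian_volume_unique:
  fixes M M' :: "((real ^ 'n) \<times> real) measure"
  assumes M: "is_riemannian_volume M" and M': "is_riemannian_volume M'"
  shows "M = M'"
proof (rule measure_eqI)
  show sets_eq: "sets M = sets M'"
    using assms by (simp add: is_riemannian_volume_def)
  let ?p = "(0, - 1) :: (real ^ 'n) \<times> real"
  have eq: "emeasure M A = emeasure M' A" if "local_param U F" "A \<in> sets borel" "A \<subseteq> F ` U" for U F A
    using M M' that by (auto simp: is_riemannian_volume_def)
  fix A assume A: "A \<in> sets M"
  then have A': "A \<in> sets borel" "A \<subseteq> unit_sphere"
    using M by (auto simp: is_riemannian_volume_def sets_sphere_iff)
  have "A - {?p} \<subseteq> range inv_stereo" using A' by (auto simp: range_inv_stereo)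
  then have 1: "emeasure M (A - {?p}) = emeasure M' (A - {?p})"
    using A' by (intro eq[OF local_param_inv_stereo]) auto
  \<comment> \<open>The origin corresponds to the opposite pole \<open>(0, 1)\<close>, which
    \<open>flip\<close> moves to \<open>?p\<close>.\<close>
  have "?p = flip (inv_stereo 0)" by (simp add: flip_def inv_stereo_def)
  then have "A \<inter> {?p} \<subseteq> range (\<lambda>x. flip (inv_stereo x))" by auto
  then have 2: "emeasure M (A \<inter> {?p}) = emeasure M' (A \<inter> {?p})"
    using A' by (intro eq[OF local_param_compose_isometry(1)[OF local_param_inv_stereo flip_isometry]]) auto
  have s: "A - {?p} \<in> sets M" "A \<inter> {?p} \<in> sets M"
    using A' M by (auto simp: is_riemannian_volume_def sets_sphere_iff)
  have "emeasure M A = emeasure M ((A - {?p}) \<union> (A \<inter> {?p}))" by (simp add: Un_Diff_Int)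
  also have "\<dots> = emeasure M (A - {?p}) + emeasure M (A \<inter> {?p})"
    using s by (intro plus_emeasure[symmetric]) auto
  also have "\<dots> = emeasure M' (A - {?p}) + emeasure M' (A \<inter> {?p})" by (simp add: 1 2)
  also have "\<dots> = emeasure M' ((A - {?p}) \<union> (A \<inter> {?p}))"
    using s by (intro plus_emeasure) (auto simp: sets_eq)
  also have "\<dots> = emeasure M' A" by (simp add: Un_Diff_Int)
  finally show "emeasure M A = emeasure M' A" .
qed

lemma sphere_vol_eq: "sphere_vol = stereo_vol"
  unfolding sphere_vol_def
  using is_riemannian_volume_stereo_vol is_riemannian_volume_unique by (intro the_equality) blast+

lemma sets_sphere_vol [measurable_cong]: "sets sphere_vol = sets (restrict_space borel unit_sphere)"
  by (simp add: sphere_vol_eq stereo_vol_def)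

lemma space_sphere_vol: "space sphere_vol = unit_sphere"
  using sets_eq_imp_space_eq[OF sets_sphere_vol] by (simp add: space_restrict_space)

lemma nn_integral_sphere_vol:
  assumes "f \<in> borel_measurable (sphere_vol :: ((real ^ 'n) \<times> real) measure)"
  shows "(\<integral>\<^sup>+z. f z \<partial>sphere_vol) = (\<integral>\<^sup>+x. ennreal (conf_factor x ^ CARD('n)) * f (inv_stereo (x :: real ^ 'n)) \<partial>lborel)"
proof -
  have f: "f \<in> borel_measurable (restrict_space borel unit_sphere)"
    using assms by (simp add: measurable_cong_sets[OF sets_sphere_vol refl])
  then have [measurable]: "(\<lambda>x. f (inv_stereo x)) \<in> borel_measurable borel"
    using measurable_comp[OF measurable_inv_stereo] by (simp add: o_def)
  show ?thesis
    unfolding sphere_vol_eq stereo_vol_def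
    using f by (subst nn_integral_distr) (auto simp: nn_integral_density)
qed

lemma finite_measure_sphere_vol: "finite_measure (sphere_vol :: ((real ^ 'n) \<times> real) measure)"
proof
  have "emeasure sphere_vol (space (sphere_vol :: ((real ^ 'n) \<times> real) measure)) = (\<integral>\<^sup>+z. 1 \<partial>(sphere_vol :: ((real ^ 'n) \<times> real) measure))"
    by simp
  also have "\<dots> = (\<integral>\<^sup>+x. ennreal (conf_factor (x :: real ^ 'n) ^ CARD('n)) \<partial>lborel)"
    by (subst nn_integral_sphere_vol) auto
  also have "\<dots> < \<infinity>" by (rule nn_integral_conf_factor_power_finite)
  finally show "emeasure sphere_vol (space (sphere_vol :: ((real ^ 'n) \<times> real) measure)) \<noteq> \<infinity>" by simp
qed

text \<open>The density is positive everywhere, so passing to it creates no new null sets.\<close>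

lemma AE_sphere_vol:
  assumes "{z \<in> unit_sphere. P z} \<in> sets borel"
  shows "(AE z in (sphere_vol :: ((real ^ 'n) \<times> real) measure). P z) \<longleftrightarrow> (AE x in lborel. P (inv_stereo (x :: real ^ 'n)))"
  unfolding sphere_vol_eq stereo_vol_def
  using assms by (subst AE_distr_iff)
    (auto simp: AE_density space_restrict_space sets_sphere_iff ennreal_eq_0_iff not_le)

text \<open>The image measure satisfies the same description, because \<open>F\<close> and
  \<open>R \<circ> F\<close> have equal metric coefficients; uniqueness concludes. Since
  \<open>R\<close> is an involution, the preimage of a set in the chart \<open>F\<close> lies in the
  chart \<open>R \<circ> F\<close>.\<close>

lemma distr_sphere_vol_isometry:
  fixes R :: "(real ^ 'n) \<times> real \<Rightarrow> (real ^ 'n) \<times> real"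
  assumes R: "linear R" "\<And>w. norm (R w) = norm w" "\<And>w. R (R w) = w"
  shows "R \<in> sphere_vol \<rightarrow>\<^sub>M sphere_vol" "distr sphere_vol sphere_vol R = sphere_vol"
proof -
  have bl: "bounded_linear R" using R(1) by (simp add: linear_conv_bounded_linear)
  have Rm: "R \<in> borel_measurable borel"
    by (intro borel_measurable_continuous_onI linear_continuous_on bl)
  show m [measurable]: "R \<in> sphere_vol \<rightarrow>\<^sub>M sphere_vol"
    unfolding measurable_cong_sets[OF sets_sphere_vol sets_sphere_vol]
    using Rm R(2) by (intro measurable_restrict_space2 measurable_restrict_space1) (auto simp: space_restrict_space unit_sphere_def)
  have "is_riemannian_volume (distr sphere_vol sphere_vol R)"
    unfolding is_riemannian_volume_def
  proof (intro conjI allI impI ballI)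
    show "sets (distr sphere_vol sphere_vol R) = sets (restrict_space borel unit_sphere)"
      by (simp add: sets_sphere_vol)
    fix U and F :: "real ^ 'n \<Rightarrow> (real ^ 'n) \<times> real" and A
    assume F: "local_param U F" and A: "A \<in> sets borel" "A \<subseteq> F ` U"
    have As: "A \<in> sets sphere_vol" using A local_paramD(4)[OF F] by (auto simp: sets_sphere_vol sets_sphere_iff)
    have RA: "R -` A \<inter> space sphere_vol = R -` A"
    proof -
      have "w \<in> unit_sphere" if "R w \<in> A" for w
        using that R(2)[of w] sets.sets_into_space[OF As] by (auto simp: space_sphere_vol unit_sphere_def)
      then show ?thesis by (auto simp: space_sphere_vol)
    qed
    have "emeasure (distr sphere_vol sphere_vol R) A = emeasure sphere_vol (R -` A)"
      using As by (simp add: emeasure_distr RA)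
    also have "\<dots> = (\<integral>\<^sup>+x\<in>U \<inter> (\<lambda>x. R (F x)) -` (R -` A). ennreal (sqrt (det (metric_coeffs (\<lambda>x. R (F x)) x))) \<partial>lborel)"
    proof -
      have "R -` A \<in> sets borel" using measurable_sets_borel[OF Rm A(1)] .
      moreover have "R -` A \<subseteq> (\<lambda>x. R (F x)) ` U"
      proof
        fix w assume "w \<in> R -` A"
        then obtain x where "x \<in> U" "R w = F x" using A(2) by auto
        then show "w \<in> (\<lambda>x. R (F x)) ` U" using R(3)[of w] by (intro image_eqI[of _ _ x]) auto
      qed
      ultimately show ?thesis
        using is_riemannian_volume_stereo_vol local_param_compose_isometry(1)[OF F R(1,2)]
        unfolding sphere_vol_eq is_riemannian_volume_def by blast
    qed
    also have "\<dots> = (\<integral>\<^sup>+x\<in>U \<inter> F -` A. ennreal (sqrt (det (metric_coeffs F x))) \<partial>lborel)"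
      by (intro nn_integral_cong) (auto simp: indicator_def R(3) local_param_compose_isometry(2)[OF F R(1,2)])
    finally show "emeasure (distr sphere_vol sphere_vol R) A = \<dots>" .
  qed
  then show "distr sphere_vol sphere_vol R = sphere_vol"
    using is_riemannian_volume_stereo_vol is_riemannian_volume_unique sphere_vol_eq by metis
qed

text \<open>Two points of the sphere are exchanged by the reflection in their bisecting hyperplane.\<close>

lemma exists_reflection:
  fixes z p :: "'a::euclidean_space"
  assumes "norm z = norm p"
  obtains R where "linear R" "\<And>w. norm (R w) = norm w" "\<And>w. R (R w) = w" "R z = p"
proof (cases "z = p")
  case True
  show ?thesis by (rule that[of "\<lambda>w. w"]) (auto simp: True linear_id[unfolded id_def])
next
  case False
  define d where "d = z - p"
  have d: "d \<bullet> d \<noteq> 0" using False by (simp add: d_def)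
  define R where "R w = w - (2 * (w \<bullet> d) / (d \<bullet> d)) *\<^sub>R d" for w
  have Rd: "R w \<bullet> d = - (w \<bullet> d)" for w
    using d by (simp add: R_def inner_diff_left)
  show ?thesis
  proof (rule that[of R])
    show "linear R"
      by (auto intro!: linearI simp: R_def inner_add_left algebra_simps add_divide_distrib)
    show "R (R w) = w" for w
      unfolding R_def[of "R w"] Rd by (simp add: R_def)
    have "R w \<bullet> R w = w \<bullet> w" for w
    proof -
      have "R w \<bullet> R w = R w \<bullet> w - (2 * (w \<bullet> d) / (d \<bullet> d)) * (R w \<bullet> d)"
        by (subst (2) R_def) (simp add: inner_diff_right)
      also have "\<dots> = w \<bullet> w"
        unfolding Rd by (simp add: R_def inner_diff_left inner_diff_right inner_commute)
      finally show ?thesis .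
    qed
    then show "norm (R w) = norm w" for w by (simp add: norm_eq_sqrt_inner)
    have "z \<bullet> z = p \<bullet> p" using assms by (simp add: norm_eq_sqrt_inner)
    then have "2 * (z \<bullet> d) = d \<bullet> d" by (simp add: d_def inner_diff_left inner_diff_right inner_commute)
    then show "R z = p" using d by (simp add: R_def) (simp add: d_def)
  qed
qed

text \<open>A reflection exchanging \<open>z\<close> and the pole moves the integral to the pole,
  where \<open>pole_distance_sq\<close> evaluates the distance. The right-hand side is therefore
  free of \<open>z\<close>.\<close>

lemma zonal_integral_const:
  fixes z :: "(real ^ 'n) \<times> real" and k :: "real \<Rightarrow> ennreal"
  assumes z: "z \<in> unit_sphere" and k [measurable]: "k \<in> borel_measurable borel"
  shows "(\<integral>\<^sup>+\<zeta>. k (norm (z - \<zeta>)) \<partial>sphere_vol) =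
    (\<integral>\<^sup>+x. ennreal (conf_factor x ^ CARD('n)) * k (sqrt (2 * conf_factor (x :: real ^ 'n))) \<partial>lborel)"
proof -
  let ?p = "(0, - 1) :: (real ^ 'n) \<times> real"
  have "norm z = norm ?p" using z by (simp add: unit_sphere_def)
  then obtain R where R: "linear R" "\<And>w. norm (R w) = norm w" "\<And>w. R (R w) = w" "R z = ?p"
    by (rule exists_reflection[of z ?p]) blast
  note Rm = distr_sphere_vol_isometry[OF R(1-3)]
  have m: "(\<lambda>\<zeta>. k (norm (?p - \<zeta>))) \<in> borel_measurable (sphere_vol :: ((real ^ 'n) \<times> real) measure)"
    unfolding measurable_cong_sets[OF sets_sphere_vol refl] by (intro measurable_restrict_space1) measurable
  have "(\<integral>\<^sup>+\<zeta>. k (norm (z - \<zeta>)) \<partial>sphere_vol) = (\<integral>\<^sup>+\<zeta>. k (norm (?p - R \<zeta>)) \<partial>sphere_vol)"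
  proof (intro nn_integral_cong)
    fix \<zeta>
    have "norm (?p - R \<zeta>) = norm (R (z - \<zeta>))" using R(1,4) by (simp add: linear_diff)
    then show "k (norm (z - \<zeta>)) = k (norm (?p - R \<zeta>))" by (simp add: R(2))
  qed
  also have "\<dots> = (\<integral>\<^sup>+\<zeta>. k (norm (?p - \<zeta>)) \<partial>distr sphere_vol sphere_vol R)"
    using m Rm(1) by (subst nn_integral_distr) auto
  also have "\<dots> = (\<integral>\<^sup>+\<zeta>. k (norm (?p - \<zeta>)) \<partial>sphere_vol)" by (simp add: Rm(2))
  also have "\<dots> = (\<integral>\<^sup>+x. ennreal (conf_factor x ^ CARD('n)) * k (norm (?p - inv_stereo (x :: real ^ 'n))) \<partial>lborel)"
    by (rule nn_integral_sphere_vol[OF m])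
  also have "(\<lambda>x :: real ^ 'n. norm (?p - inv_stereo x)) = (\<lambda>x. sqrt (2 * conf_factor x))"
    by (metis norm_ge_zero pole_distance_sq real_sqrt_unique)
  finally show ?thesis by (simp add: fun_eq_iff)
qed

section \<open>The form on the sphere and compactness\<close>

interpretation sphere: finite_measure sphere_vol
  by (rule finite_measure_sphere_vol)

lemma measurable_sphere_ident [measurable]: "(\<lambda>z. z) \<in> borel_measurable sphere_vol"
  unfolding measurable_cong_sets[OF sets_sphere_vol refl] by (rule measurable_restrict_space1) simp

lemma c_const_pos: "0 < n \<Longrightarrow> 0 < c_const n"
  by (simp add: c_const_def Gamma_real_pos)

lemma jump_form_sphere:
  assumes "\<kappa> > 0"
  shows "jump_form (sphere_vol :: ((real ^ 'n) \<times> real) measure)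
    (\<lambda>z \<zeta>. inverse (norm (z - \<zeta>) ^ CARD('n))) (c_const CARD('n) / 2) \<kappa>"
proof unfold_locales
  show "(\<lambda>p. inverse (norm (fst p - snd p) ^ CARD('n))) \<in>
     borel_measurable (sphere_vol \<Otimes>\<^sub>M (sphere_vol :: ((real ^ 'n) \<times> real) measure))"
    by measurable
qed (use assms c_const_pos[of "CARD('n)"] in auto)

lemma H_space_eq:
  assumes "\<kappa> > 0"
  shows "(H_space \<kappa> :: ((real ^ 'n) \<times> real \<Rightarrow> real) set) =
    jump_form.form_space sphere_vol (\<lambda>z \<zeta>. inverse (norm (z - \<zeta>) ^ CARD('n))) (c_const CARD('n) / 2) \<kappa>"
  unfolding H_space_def H_sqnorm_ext_def jump_form.form_space_def[OF jump_form_sphere[OF assms]]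
    jump_form.sqn_def[OF jump_form_sphere[OF assms]]
  unfolding divide_inverse ..

lemma H_inner_eq:
  assumes "\<kappa> > 0"
  shows "(H_inner \<kappa> :: ((real ^ 'n) \<times> real \<Rightarrow> real) \<Rightarrow> _) =
    jump_form.ip sphere_vol (\<lambda>z \<zeta>. inverse (norm (z - \<zeta>) ^ CARD('n))) (c_const CARD('n) / 2) \<kappa>"
  unfolding H_inner_def[abs_def] jump_form.ip_def[OF jump_form_sphere[OF assms], abs_def]
  unfolding divide_inverse ..

lemma hilbert_space_H:
  "\<kappa> > 0 \<Longrightarrow> hilbert_space_ae (sphere_vol :: ((real ^ 'n) \<times> real) measure) (H_space \<kappa>) (H_inner \<kappa>)"
  using jump_form.hilbert_space_form_space[OF jump_form_sphere] by (simp add: H_space_eq H_inner_eq)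

text \<open>The resulting L^1 bound drives the equicontinuity of the averages;
  \<open>\<bar>u\<bar> \<le> 1 + u\<^sup>2\<close> takes the place of the Cauchy-Schwarz
  inequality.\<close>

lemma (in finite_measure) L2_space_integrable:
  assumes "u \<in> L2_space M"
  shows "integrable M u" "(\<integral>x. \<bar>u x\<bar> \<partial>M) \<le> measure M (space M) + L2_inner M u u"
proof -
  have i: "integrable M (\<lambda>x. 1 + u x * u x)"
    using L2_mult_integrable[OF assms assms] by simp
  have le: "\<bar>u x\<bar> \<le> 1 + u x * u x" for x
  proof -
    have "0 \<le> (\<bar>u x\<bar> - 1/2)\<^sup>2" by simp
    then show ?thesis by (simp add: power2_diff) (simp add: power2_eq_square)
  qed
  show 1: "integrable M u"
    by (rule Bochner_Integration.integrable_bound[OF i]) (use assms le in \<open>auto simp: L2_space_def\<close>)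
  have "(\<integral>x. \<bar>u x\<bar> \<partial>M) \<le> (\<integral>x. 1 + u x * u x \<partial>M)"
    using 1 i le by (intro integral_mono) auto
  also have "\<dots> = measure M (space M) + L2_inner M u u"
    using L2_mult_integrable[OF assms assms] by (simp add: L2_inner_def)
  finally show "(\<integral>x. \<bar>u x\<bar> \<partial>M) \<le> measure M (space M) + L2_inner M u u" .
qed

lemma (in finite_measure) integrable_bounded_mult:
  fixes h g :: "'a \<Rightarrow> real"
  assumes "integrable M g" "h \<in> borel_measurable M" "\<And>x. \<bar>h x\<bar> \<le> C"
  shows "integrable M (\<lambda>x. h x * g x)"
proof (rule Bochner_Integration.integrable_bound[of M "\<lambda>x. C * g x"])
  have "0 \<le> C" using assms(3)[of undefined] by linarith
  then show "AE x in M. norm (h x * g x) \<le> norm (C * g x)"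
    using assms(3) by (auto simp: abs_mult intro!: mult_right_mono)
qed (use assms in auto)

text \<open>With \<open>m\<close> the weighted mean of \<open>u\<close>, the integral of
  \<open>(a - u)\<^sup>2 h\<close> equals \<open>k (a - m)\<^sup>2\<close> plus the weighted
  variance of \<open>u\<close>. The variance is nonnegative and is dropped.\<close>

lemma (in finite_measure) averaging_estimate:
  fixes h u :: "'a \<Rightarrow> real"
  assumes u: "u \<in> L2_space M" and h [measurable]: "h \<in> borel_measurable M"
    and hb: "\<And>x. 0 \<le> h x" "\<And>x. h x \<le> C"
    and k: "(\<integral>\<^sup>+x. ennreal (h x) \<partial>M) = ennreal k" "k > 0"
  shows "ennreal (k * (a - (\<integral>x. h x * u x \<partial>M) / k)\<^sup>2) \<le> (\<integral>\<^sup>+x. ennreal ((a - u x)\<^sup>2 * h x) \<partial>M)"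
proof -
  define m where "m = (\<integral>x. h x * u x \<partial>M) / k"
  have hb': "\<bar>h x\<bar> \<le> C" for x using hb by simp
  have [measurable]: "u \<in> borel_measurable M" using u by (simp add: L2_space_def)
  have ih: "integrable M h" using integrable_bounded_mult[OF _ h hb', of "\<lambda>_. 1"] by simp
  have ihu: "integrable M (\<lambda>x. h x * u x)" by (rule integrable_bounded_mult[OF L2_space_integrable(1)[OF u] h hb'])
  have ihuu: "integrable M (\<lambda>x. h x * (u x)\<^sup>2)"
    using u by (intro integrable_bounded_mult[OF _ h hb']) (auto simp: L2_space_def)
  have kk: "(\<integral>x. h x \<partial>M) = k"
    using k hb by (subst integral_eq_nn_integral) auto
  have km: "(\<integral>x. h x * u x \<partial>M) = k * m" using k(2) by (simp add: m_def)
  have ex: "(\<lambda>x. (b - u x)\<^sup>2 * h x) = (\<lambda>x. b\<^sup>2 * h x - 2 * b * (h x * u x) + h x * (u x)\<^sup>2)" for b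
    by (auto simp: fun_eq_iff power2_diff algebra_simps)
  have ib: "integrable M (\<lambda>x. (b - u x)\<^sup>2 * h x)" for b
    unfolding ex using ih ihu ihuu by auto
  have vb: "(\<integral>x. (b - u x)\<^sup>2 * h x \<partial>M) = b\<^sup>2 * k - 2 * b * (k * m) + (\<integral>x. h x * (u x)\<^sup>2 \<partial>M)" for b
    unfolding ex using ih ihu ihuu by (simp add: kk km)
  have "0 \<le> (\<integral>x. (m - u x)\<^sup>2 * h x \<partial>M)" using hb by simp
  then have "k * (a - m)\<^sup>2 \<le> (\<integral>x. (a - u x)\<^sup>2 * h x \<partial>M)"
    unfolding vb by (simp add: power2_eq_square algebra_simps)
  then have "ennreal (k * (a - m)\<^sup>2) \<le> ennreal (\<integral>x. (a - u x)\<^sup>2 * h x \<partial>M)" by (rule ennreal_leI)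
  also have "\<dots> = (\<integral>\<^sup>+x. ennreal ((a - u x)\<^sup>2 * h x) \<partial>M)"
    using hb by (intro nn_integral_eq_integral[symmetric] ib) auto
  finally show ?thesis unfolding m_def .
qed

section \<open>Truncated kernels and compactness\<close>

definition trunc_kernel :: "nat \<Rightarrow> real \<Rightarrow> real \<Rightarrow> real" where
  "trunc_kernel n d r = inverse (max r d ^ n)"

lemma borel_trunc_kernel [measurable]: "trunc_kernel n d \<in> borel_measurable borel"
  unfolding trunc_kernel_def[abs_def] by measurable

lemma trunc_kernel_bounds:
  assumes "d > 0"
  shows "0 \<le> trunc_kernel n d r" "trunc_kernel n d r \<le> inverse (d ^ n)"
    "r > 0 \<Longrightarrow> trunc_kernel n d r \<le> inverse (r ^ n)"
proof -
  have "d ^ n \<le> max r d ^ n" using assms by (intro power_mono) auto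
  then show "trunc_kernel n d r \<le> inverse (d ^ n)"
    unfolding trunc_kernel_def using assms by (intro le_imp_inverse_le) auto
  show "0 \<le> trunc_kernel n d r" using assms by (simp add: trunc_kernel_def)
  show "trunc_kernel n d r \<le> inverse (r ^ n)" if "r > 0"
    unfolding trunc_kernel_def using that by (intro le_imp_inverse_le power_mono) auto
qed

lemma continuous_trunc_kernel: "d > 0 \<Longrightarrow> continuous_on S (trunc_kernel n d)"
  unfolding trunc_kernel_def[abs_def] by (intro continuous_intros) (auto simp: max_def)

lemma powr_half_nat: "0 < (y::real) \<Longrightarrow> y powr (real n / 2) = sqrt y ^ n"
  using powr_half_sqrt_powr[of y "real n"] by (simp add: powr_realpow real_sqrt_power)

text \<open>At infinity the integrand behaves like \<open>|x|\<^sup>-\<^sup>N\<close>, so the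
  integral over a ball grows at least like the logarithm of the radius.\<close>

lemma nn_integral_conf_factor_lower_bound:
  assumes "R \<ge> 1"
  shows "(\<integral>\<^sup>+x\<in>{x. norm x \<le> R}. ennreal (conf_factor (x :: real ^ 'n) powr (real CARD('n) / 2)) \<partial>lborel) \<ge>
    ennreal (CARD('n) * unit_ball_vol CARD('n) * ln R)"
proof -
  let ?N = "CARD('n)"
  have N: "?N \<ge> 1" "DIM(real^'n) = CARD('n)" by (auto simp: Suc_le_eq)
  let ?f = "\<lambda>r. ennreal ((2 / (1 + r\<^sup>2)) powr (real ?N / 2)) * indicator {..R} r"
  have "(\<integral>\<^sup>+x\<in>{x. norm x \<le> R}. ennreal (conf_factor (x :: real ^ 'n) powr (real ?N / 2)) \<partial>lborel) =
     (\<integral>\<^sup>+x. ?f (norm (x :: real ^ 'n)) \<partial>lborel)"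
    by (auto simp: conf_factor_def indicator_def intro!: nn_integral_cong)
  also have "\<dots> = ennreal (?N * unit_ball_vol ?N) * (\<integral>\<^sup>+r\<in>{0<..}. ennreal (r ^ (?N - 1)) * ?f r \<partial>lborel)"
    by (subst nn_integral_radial) (auto simp: N)
  finally have eq: "(\<integral>\<^sup>+x\<in>{x. norm x \<le> R}. ennreal (conf_factor (x :: real ^ 'n) powr (real ?N / 2)) \<partial>lborel) =
    ennreal (?N * unit_ball_vol ?N) * (\<integral>\<^sup>+r\<in>{0<..}. ennreal (r ^ (?N - 1)) * ?f r \<partial>lborel)" .
  have "(\<integral>\<^sup>+r\<in>{0<..}. ennreal (r ^ (?N - 1)) * ?f r \<partial>lborel) \<ge> (\<integral>\<^sup>+r. ennreal (1 / r) * indicator {1..R} r \<partial>lborel)"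
  proof (rule nn_integral_mono)
    fix r :: real
    show "ennreal (1 / r) * indicator {1..R} r \<le> ennreal (r ^ (?N - 1)) * ?f r * indicator {0<..} r"
    proof (cases "r \<in> {1..R}")
      case True
      then have r: "1 \<le> r" "r \<le> R" by auto
      have "r ^ ?N = r * r ^ (?N - 1)"
        using power_Suc[of r "?N - 1"] by simp
      then have "1 / r = r ^ (?N - 1) * (1 / r ^ ?N)"
        using r by simp
      also have "1 / r ^ ?N = (1 / r\<^sup>2) powr (real ?N / 2)"
        using r by (subst powr_half_nat) (auto simp: real_sqrt_divide power_divide)
      also have "r ^ (?N - 1) * \<dots> \<le> r ^ (?N - 1) * (2 / (1 + r\<^sup>2)) powr (real ?N / 2)"
      proof -
        have "1 \<le> r\<^sup>2" using r by simp
        then have "1 / r\<^sup>2 \<le> 2 / (1 + r\<^sup>2)"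
          using frac_le[of 2 2 "1 + r\<^sup>2" "2 * r\<^sup>2"] one_plus_norm_sq_pos[of r] by simp
        then show ?thesis using r by (intro mult_left_mono powr_mono2) auto
      qed
      finally show ?thesis using r by (auto simp: ennreal_mult'[symmetric] intro!: ennreal_leI)
    qed simp
  qed
  also have "(\<integral>\<^sup>+r. ennreal (1 / r) * indicator {1..R} r \<partial>lborel) = ennreal (ln R - ln 1)"
    using assms by (intro nn_integral_FTC_Icc) (auto intro!: derivative_eq_intros)
  finally have "ennreal (?N * unit_ball_vol ?N) * ennreal (ln R) \<le>
     ennreal (?N * unit_ball_vol ?N) * (\<integral>\<^sup>+r\<in>{0<..}. ennreal (r ^ (?N - 1)) * ?f r \<partial>lborel)"
    by (intro mult_left_mono) auto
  then show ?thesis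
    unfolding eq by (subst ennreal_mult') auto
qed

text \<open>Seen from the pole, the singularity of the kernel lies at infinity in stereographic
  coordinates. A truncation at small distance leaves a large ball untouched, and the logarithmic
  growth on that ball exceeds any bound.\<close>

lemma trunc_kernel_mass_large:
  "\<exists>d>0. \<exists>k>M. \<forall>z\<in>unit_sphere.
     (\<integral>\<^sup>+\<zeta>. ennreal (trunc_kernel CARD('n) d (norm (z - \<zeta>))) \<partial>(sphere_vol :: ((real ^ 'n) \<times> real) measure)) = ennreal k"
proof -
  let ?N = "CARD('n)" let ?s = "real CARD('n) * unit_ball_vol CARD('n)"
  \<comment> \<open>Chosen so that the lower bound \<open>2 powr - (N/2) * ?s * ln R\<close> equals
    \<open>\<bar>M\<bar>\<close> plus a positive number.\<close>
  define R where "R = exp (\<bar>M\<bar> * 2 powr (real ?N / 2) / ?s + 1)"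
  have s: "?s > 0" by simp
  have R1: "R \<ge> 1" unfolding R_def using s by (simp del: unit_ball_vol_pos)
  \<comment> \<open>The distance from the pole to a point with coordinates of norm \<open>R\<close>:
    for \<open>norm x \<le> R\<close> the truncation has no effect.\<close>
  define d where "d = 2 / sqrt (1 + R\<^sup>2)"
  have d: "d > 0" unfolding d_def using one_plus_norm_sq_pos[of R] by simp
  let ?K = "\<integral>\<^sup>+x. ennreal (conf_factor x ^ ?N) * ennreal (trunc_kernel ?N d (sqrt (2 * conf_factor (x :: real ^ 'n)))) \<partial>lborel"
  have fin: "?K < \<infinity>"
  proof -
    have "?K \<le> (\<integral>\<^sup>+x. ennreal (conf_factor (x :: real ^ 'n) ^ ?N) * ennreal (inverse (d ^ ?N)) \<partial>lborel)"
      using trunc_kernel_bounds[OF d] by (intro nn_integral_mono mult_left_mono ennreal_leI) auto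
    also have "\<dots> < \<infinity>"
      using nn_integral_conf_factor_power_finite[where 'n = 'n] by (simp add: nn_integral_multc ennreal_mult_less_top)
    finally show ?thesis .
  qed
  have "(\<integral>\<^sup>+x. ennreal (2 powr - (real ?N / 2)) * (ennreal (conf_factor (x :: real ^ 'n) powr (real ?N / 2)) * indicator {x. norm x \<le> R} x) \<partial>lborel) \<le> ?K"
  proof (rule nn_integral_mono)
    fix x :: "real ^ 'n"
    show "ennreal (2 powr - (real ?N / 2)) * (ennreal (conf_factor x powr (real ?N / 2)) * indicator {x. norm x \<le> R} x) \<le>
      ennreal (conf_factor x ^ ?N) * ennreal (trunc_kernel ?N d (sqrt (2 * conf_factor x)))"
    proof (cases "norm x \<le> R")
      case True
      have "(norm x)\<^sup>2 \<le> R\<^sup>2" using True by (intro power_mono) auto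
      then have "4 / (1 + R\<^sup>2) \<le> 2 * conf_factor x"
        using one_plus_norm_sq_pos[of x] unfolding conf_factor_def by (simp add: frac_le)
      then have "d \<le> sqrt (2 * conf_factor x)"
        unfolding d_def using real_sqrt_le_mono[of "4 / (1 + R\<^sup>2)"] by (simp add: real_sqrt_divide)
      then have "trunc_kernel ?N d (sqrt (2 * conf_factor x)) = inverse ((2 * conf_factor x) powr (real ?N / 2))"
        by (simp add: trunc_kernel_def max_absorb1 powr_half_nat)
      moreover have "conf_factor x ^ ?N * inverse ((2 * conf_factor x) powr (real ?N / 2)) =
         2 powr - (real ?N / 2) * conf_factor x powr (real ?N / 2)"
      proof -
        have "conf_factor x ^ ?N = conf_factor x powr (real ?N / 2) * conf_factor x powr (real ?N / 2)"
          by (simp add: powr_add[symmetric] powr_realpow)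
        then show ?thesis by (simp add: powr_mult less_imp_le powr_minus field_simps)
      qed
      ultimately show ?thesis using True by (simp add: ennreal_mult'[symmetric] less_imp_le)
    qed simp
  qed
  then have "ennreal (2 powr - (real ?N / 2)) * ennreal (?s * ln R) \<le> ?K"
    using nn_integral_conf_factor_lower_bound[OF R1, where 'n = 'n]
    by (subst (asm) nn_integral_cmult) (auto intro: order_trans[OF mult_left_mono])
  then have "ennreal (2 powr - (real ?N / 2) * (?s * ln R)) \<le> ?K" by (simp add: ennreal_mult')
  moreover have "2 powr - (real ?N / 2) * (?s * ln R) > M"
  proof -
    have "a * (b * ln (exp (\<bar>M\<bar> * e / b + 1))) = \<bar>M\<bar> + a * b" if "b > 0" "a * e = 1" for a b e :: real
    proof -
      have "a * (b * ln (exp (\<bar>M\<bar> * e / b + 1))) = \<bar>M\<bar> * (a * e) + a * b"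
        using that(1) by (simp add: field_simps)
      then show ?thesis using that(2) by simp
    qed
    from this[OF s, of "2 powr - (real ?N / 2)" "2 powr (real ?N / 2)"]
    have "2 powr - (real ?N / 2) * (?s * ln R) = \<bar>M\<bar> + 2 powr - (real ?N / 2) * ?s"
      unfolding R_def by (simp add: powr_minus)
    moreover have "2 powr - (real ?N / 2) * ?s > 0" using s by simp
    ultimately show ?thesis by linarith
  qed
  moreover obtain k where k: "?K = ennreal k" "k \<ge> 0"
    using fin by (cases "?K" rule: ennreal_cases) auto
  ultimately have "k > M" by (simp only: ennreal_le_iff)
  have "(\<integral>\<^sup>+\<zeta>. ennreal (trunc_kernel ?N d (norm (z - \<zeta>))) \<partial>(sphere_vol :: ((real ^ 'n) \<times> real) measure)) = ennreal k"
    if "z \<in> unit_sphere" for z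
    unfolding k(1)[symmetric] by (rule zonal_integral_const[OF that]) simp
  then show ?thesis using d \<open>k > M\<close> by blast
qed

text \<open>A diagonal argument over the tolerances \<open>1 / Suc j\<close>. The premise speaks
  about every subsequence \<open>s\<close> because each extraction refines the previous one.\<close>

lemma Cauchy_subseq_of_totally_bounded:
  fixes D :: "nat \<Rightarrow> nat \<Rightarrow> real"
  assumes "\<And>e (s :: nat \<Rightarrow> nat). e > 0 \<Longrightarrow> strict_mono s \<Longrightarrow> \<exists>(r :: nat \<Rightarrow> nat) n0. strict_mono r \<and> (\<forall>m\<ge>n0. \<forall>n\<ge>n0. D (s (r m)) (s (r n)) < e)"
  shows "\<exists>r :: nat \<Rightarrow> nat. strict_mono r \<and> (\<forall>e>0. \<exists>n0. \<forall>m\<ge>n0. \<forall>n\<ge>n0. D (r m) (r n) < e)"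
proof -
  define P where "P j s \<longleftrightarrow> (\<exists>n0. \<forall>m\<ge>n0. \<forall>n\<ge>n0. D (s m) (s n) < 1 / real (Suc j))" for j and s :: "nat \<Rightarrow> nat"
  interpret subseqs P
  proof
    fix j and s :: "nat \<Rightarrow> nat" assume "strict_mono s"
    then obtain r :: "nat \<Rightarrow> nat" and n0 where r: "strict_mono r" "\<forall>m\<ge>n0. \<forall>n\<ge>n0. D (s (r m)) (s (r n)) < 1 / real (Suc j)"
      using assms[of "1 / real (Suc j)" s] by auto
    from r(2) have "P j (s \<circ> r)" unfolding P_def o_def by blast
    with r(1) show "\<exists>r'. strict_mono r' \<and> P j (s \<circ> r')" by blast
  qed
  \<comment> \<open>Only the tail of the diagonal sequence beyond index \<open>j\<close> is known to
    be a subsequence of the corresponding extraction, hence the shift by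
    \<open>Suc j\<close>.\<close>
  have "P j (diagseq \<circ> ((+) (Suc j)))" for j
  proof (rule diagseq_holds)
    fix r s :: "nat \<Rightarrow> nat" and j assume r: "strict_mono r" and "P j s"
    then obtain n0 where "\<And>m n. m \<ge> n0 \<Longrightarrow> n \<ge> n0 \<Longrightarrow> D (s m) (s n) < 1 / real (Suc j)" by (auto simp: P_def)
    moreover have "r m \<ge> m" for m using r by (rule strict_mono_imp_increasing)
    ultimately show "P j (s \<circ> r)" unfolding P_def o_def by (meson order_trans)
  qed
  have "\<exists>n0. \<forall>m\<ge>n0. \<forall>n\<ge>n0. D (diagseq m) (diagseq n) < e" if e: "e > 0" for e
  proof -
    obtain j where j: "1 / real (Suc j) < e" using nat_approx_posE[OF e] by (metis)
    obtain n0 where n0: "\<And>m n. m \<ge> n0 \<Longrightarrow> n \<ge> n0 \<Longrightarrow> D (diagseq (Suc j + m)) (diagseq (Suc j + n)) < 1 / real (Suc j)"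
      using \<open>P j (diagseq \<circ> ((+) (Suc j)))\<close> unfolding P_def o_def by auto
    have "D (diagseq m) (diagseq n) < e" if "m \<ge> Suc j + n0" "n \<ge> Suc j + n0" for m n
    proof -
      have "n0 \<le> m - Suc j" "n0 \<le> n - Suc j" using that by linarith+
      from n0[OF this] show ?thesis using that j by simp
    qed
    then show ?thesis by blast
  qed
  then show ?thesis using subseq_diagseq by blast
qed

text \<open>The average \<open>T f\<close> of \<open>f\<close> against a truncated kernel of mass \<open>k\<close> is within \<open>O(k\<^sup>-\<^sup>1\<^sup>/\<^sup>2)\<close> of \<open>f\<close> in
  \<open>L\<^sup>2\<close> on bounded sets of the form, and bounded sets have equicontinuous averages. Since the kernel is not
  integrable, \<open>k\<close> can be taken arbitrarily large.\<close>

lemma H_almost_Cauchy_subseq: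
  fixes f :: "nat \<Rightarrow> (real ^ 'n) \<times> real \<Rightarrow> real"
  assumes \<kappa>: "\<kappa> > 0" and f: "\<And>n. f n \<in> H_space \<kappa>" and B: "\<And>n. H_inner \<kappa> (f n) (f n) \<le> B" and e: "e > 0"
  shows "\<exists>(r :: nat \<Rightarrow> nat) n0. strict_mono r \<and> (\<forall>m\<ge>n0. \<forall>n\<ge>n0.
     L2_inner sphere_vol (\<lambda>x. f (r m) x - f (r n) x) (\<lambda>x. f (r m) x - f (r n) x) < e)"
proof -
  let ?N = "CARD('n)"
  let ?S = "sphere_vol :: ((real ^ 'n) \<times> real) measure"
  let ?vol = "measure ?S (space ?S)"
  define c where "c = c_const ?N / 2"
  have c: "c > 0" using c_const_pos[of ?N] by (simp add: c_def)
  interpret J: jump_form ?S "\<lambda>z \<zeta>. inverse (norm (z - \<zeta>) ^ ?N)" c \<kappa>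
    unfolding c_def by (rule jump_form_sphere[OF \<kappa>])
  have fJ: "f n \<in> J.form_space" and BJ: "J.ip (f n) (f n) \<le> B" for n
    using f[of n] B[of n] H_space_eq[OF \<kappa>, where 'n = 'n] H_inner_eq[OF \<kappa>, where 'n = 'n]
    by (simp_all add: c_def)
  have fL: "f n \<in> L2_space ?S" for n using fJ by (simp add: J.form_space_iff)
  have fm [measurable]: "f n \<in> borel_measurable ?S" for n using fL[of n] by (simp add: L2_space_def)
  have B0: "B \<ge> 0" using J.ip_self(1)[OF fJ[of 0]] BJ[of 0] by linarith
  have energy: "(\<integral>\<^sup>+z. (\<integral>\<^sup>+\<zeta>. ennreal ((f n z - f n \<zeta>)\<^sup>2 * inverse (norm (z - \<zeta>) ^ ?N)) \<partial>?S) \<partial>?S) \<le> ennreal (B / c)" for n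
  proof -
    have g: "J.grad (f n) \<in> L2_space (?S \<Otimes>\<^sub>M ?S)" using fJ[of n] by (simp add: J.form_space_iff)
    have "c * L2_inner (?S \<Otimes>\<^sub>M ?S) (J.grad (f n)) (J.grad (f n)) \<le> B"
      using J.ip_eq[OF fJ[of n] fJ[of n]] BJ[of n] L2_inner_self_nonneg[of ?S "f n"] \<kappa>
      by (smt (verit) mult_nonneg_nonneg)
    then show ?thesis
      using c unfolding J.nn_integral_grad_sq[OF fm[of n], symmetric] nn_integral_sq_eq_L2_inner[OF g]
      by (intro ennreal_leI) (simp add: field_simps)
  qed
  define A where "A = ?vol + B / \<kappa>"
  have A: "(\<integral>z. \<bar>f n z\<bar> \<partial>?S) \<le> A" for n
  proof -
    have "L2_inner ?S (f n) (f n) \<le> B / \<kappa>"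
      using J.ip_self(2)[OF fJ[of n]] BJ[of n] \<kappa> by (simp add: field_simps)
    then show ?thesis using sphere.L2_space_integrable(2)[OF fL[of n]] by (simp add: A_def)
  qed
  have A0: "A \<ge> 0" using A[of 0] by (rule order_trans[rotated]) simp
  have fi: "integrable ?S (f n)" for n by (rule sphere.L2_space_integrable(1)[OF fL])
  \<comment> \<open>The square of a sum of three terms costs a factor 3, and two of the terms are
    averaging errors of size \<open>B / c / k\<close>. The constant 18 makes their total
    \<open>6 * (B / c / k)\<close> smaller than \<open>e / 3\<close>.\<close>
  obtain d k where d: "d > 0" and k: "k > 18 * (B / c) / e" and
    mass: "\<And>z. z \<in> unit_sphere \<Longrightarrow> (\<integral>\<^sup>+\<zeta>. ennreal (trunc_kernel ?N d (norm (z - \<zeta>))) \<partial>?S) = ennreal k"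
    using trunc_kernel_mass_large[of "18 * (B / c) / e", where 'n = 'n] by metis
  have k0: "k > 0" using k B0 c e by (smt (verit) divide_nonneg_pos mult_nonneg_nonneg)
  let ?K = "\<lambda>z \<zeta>. trunc_kernel ?N d (norm (z - \<zeta>))"
  have Km [measurable]: "?K z \<in> borel_measurable ?S" for z by measurable
  define T where "T n z = (\<integral>\<zeta>. ?K z \<zeta> * f n \<zeta> \<partial>?S) / k" for n z
  have Tm [measurable]: "T n \<in> borel_measurable ?S" for n
  proof -
    have [measurable]: "(\<lambda>p. ?K (fst p) (snd p)) \<in> borel_measurable (?S \<Otimes>\<^sub>M ?S)" by measurable
    have "(\<lambda>(z, \<zeta>). ?K z \<zeta> * f n \<zeta>) \<in> borel_measurable (?S \<Otimes>\<^sub>M ?S)"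
      by (simp add: case_prod_beta)
    then have "(\<lambda>z. \<integral>\<zeta>. ?K z \<zeta> * f n \<zeta> \<partial>?S) \<in> borel_measurable ?S"
      by (rule sphere.borel_measurable_lebesgue_integral)
    then show ?thesis unfolding T_def[abs_def] by measurable
  qed
  have Kb: "\<bar>?K z \<zeta>\<bar> \<le> inverse (d ^ ?N)" for z \<zeta>
    using trunc_kernel_bounds[OF d] by simp
  have Kfi: "integrable ?S (\<lambda>\<zeta>. ?K z \<zeta> * f n \<zeta>)" for z n
    by (rule sphere.integrable_bounded_mult[OF fi Km Kb])
  have approx: "(\<integral>\<^sup>+z. ennreal ((f n z - T n z)\<^sup>2) \<partial>?S) \<le> ennreal (B / c / k)" for n
  proof -
    have "(\<integral>\<^sup>+z. ennreal k * ennreal ((f n z - T n z)\<^sup>2) \<partial>?S) \<le>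
      (\<integral>\<^sup>+z. (\<integral>\<^sup>+\<zeta>. ennreal ((f n z - f n \<zeta>)\<^sup>2 * inverse (norm (z - \<zeta>) ^ ?N)) \<partial>?S) \<partial>?S)"
    proof (rule nn_integral_mono)
      fix z assume "z \<in> space ?S"
      then have z: "z \<in> unit_sphere" by (simp add: space_sphere_vol)
      have "ennreal (k * (f n z - T n z)\<^sup>2) \<le> (\<integral>\<^sup>+\<zeta>. ennreal ((f n z - f n \<zeta>)\<^sup>2 * ?K z \<zeta>) \<partial>?S)"
        unfolding T_def
        by (rule sphere.averaging_estimate[OF fL Km _ _ mass[OF z] k0]) (rule trunc_kernel_bounds[OF d])+
      also have "\<dots> \<le> (\<integral>\<^sup>+\<zeta>. ennreal ((f n z - f n \<zeta>)\<^sup>2 * inverse (norm (z - \<zeta>) ^ ?N)) \<partial>?S)"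
      proof (intro nn_integral_mono ennreal_leI)
        fix \<zeta>
        show "(f n z - f n \<zeta>)\<^sup>2 * ?K z \<zeta> \<le> (f n z - f n \<zeta>)\<^sup>2 * inverse (norm (z - \<zeta>) ^ ?N)"
        proof (cases "z = \<zeta>")
          case False
          then show ?thesis by (intro mult_left_mono trunc_kernel_bounds(3)[OF d]) auto
        qed simp
      qed
      finally show "ennreal k * ennreal ((f n z - T n z)\<^sup>2) \<le> (\<integral>\<^sup>+\<zeta>. ennreal ((f n z - f n \<zeta>)\<^sup>2 * inverse (norm (z - \<zeta>) ^ ?N)) \<partial>?S)"
        using k0 by (simp add: ennreal_mult')
    qed
    also have "\<dots> \<le> ennreal (B / c)" by (rule energy)
    finally have "ennreal k * (\<integral>\<^sup>+z. ennreal ((f n z - T n z)\<^sup>2) \<partial>?S) \<le> ennreal (B / c)"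
      by (subst (asm) nn_integral_cmult) auto
    then have "ennreal (1 / k) * (ennreal k * (\<integral>\<^sup>+z. ennreal ((f n z - T n z)\<^sup>2) \<partial>?S)) \<le> ennreal (1 / k) * ennreal (B / c)"
      by (rule mult_left_mono) simp
    also have "ennreal (1 / k) * ennreal (B / c) = ennreal (B / c / k)"
      using k0 by (subst ennreal_mult'[symmetric]) (auto simp: mult.commute)
    finally show ?thesis
      using k0 by (simp add: mult.assoc[symmetric] ennreal_mult'[symmetric])
  qed
  have Tdiff: "\<bar>T n z - T n z'\<bar> \<le> b * A / k" if "\<And>\<zeta>. \<zeta> \<in> unit_sphere \<Longrightarrow> \<bar>?K z \<zeta> - ?K z' \<zeta>\<bar> \<le> b" for n z z' b
  proof -
    have "T n z - T n z' = (\<integral>\<zeta>. ?K z \<zeta> * f n \<zeta> - ?K z' \<zeta> * f n \<zeta> \<partial>?S) / k"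
      unfolding T_def using Kfi by (subst Bochner_Integration.integral_diff) (auto simp: diff_divide_distrib)
    moreover have "\<bar>\<integral>\<zeta>. ?K z \<zeta> * f n \<zeta> - ?K z' \<zeta> * f n \<zeta> \<partial>?S\<bar> \<le> (\<integral>\<zeta>. b * \<bar>f n \<zeta>\<bar> \<partial>?S)"
    proof (rule order_trans[OF integral_abs_bound integral_mono])
      fix \<zeta> assume "\<zeta> \<in> space ?S"
      then show "\<bar>?K z \<zeta> * f n \<zeta> - ?K z' \<zeta> * f n \<zeta>\<bar> \<le> b * \<bar>f n \<zeta>\<bar>"
        using that[of \<zeta>] unfolding left_diff_distrib[symmetric] abs_mult
        by (intro mult_right_mono) (auto simp: space_sphere_vol)
    qed (use Kfi fi in auto)
    moreover have "(\<integral>\<zeta>. b * \<bar>f n \<zeta>\<bar> \<partial>?S) \<le> b * A"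
    proof -
      \<comment> \<open>The point \<open>(0, 1)\<close> witnesses that the sphere is nonempty, so
        \<open>b\<close> bounds some absolute value.\<close>
      have "b \<ge> 0" using that[of "(0, 1)"] by (force simp: unit_sphere_iff)
      then show ?thesis using A[of n] by (simp add: mult_left_mono)
    qed
    ultimately show ?thesis using k0 by (simp add: divide_right_mono)
  qed
  have Tb: "\<bar>T n z\<bar> \<le> inverse (d ^ ?N) * A / k" for n z
  proof -
    have "\<bar>\<integral>\<zeta>. ?K z \<zeta> * f n \<zeta> \<partial>?S\<bar> \<le> (\<integral>\<zeta>. inverse (d ^ ?N) * \<bar>f n \<zeta>\<bar> \<partial>?S)"
    proof (rule order_trans[OF integral_abs_bound integral_mono])
      show "integrable ?S (\<lambda>\<zeta>. \<bar>?K z \<zeta> * f n \<zeta>\<bar>)" by (rule integrable_abs[OF Kfi])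
      show "\<bar>?K z \<zeta> * f n \<zeta>\<bar> \<le> inverse (d ^ ?N) * \<bar>f n \<zeta>\<bar>" for \<zeta>
        unfolding abs_mult by (intro mult_right_mono Kb) simp
    qed (use fi in auto)
    also have "\<dots> \<le> inverse (d ^ ?N) * A"
      using A[of n] d by (simp add: mult_left_mono)
    finally show ?thesis using k0 by (simp add: T_def divide_right_mono)
  qed
  \<comment> \<open>The interval \<open>{0..2}\<close> contains all distances between points of the
    sphere.\<close>
  have uc: "uniformly_continuous_on {0..2} (trunc_kernel ?N d)"
    by (intro compact_uniformly_continuous continuous_trunc_kernel d) auto
  have equi: "\<exists>h>0. \<forall>n y. y \<in> unit_sphere \<and> norm (x - y) < h \<longrightarrow> norm (T n x - T n y) < \<eta>"
    if x: "x \<in> unit_sphere" and \<eta>: "\<eta> > 0" for x :: "(real ^ 'n) \<times> real" and \<eta>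
  proof -
    \<comment> \<open>With this choice \<open>b * A / k\<close> equals \<eta> times
      \<open>A / (2 * (A + 1))\<close>, which is below \<eta> also when
      \<open>A = 0\<close>.\<close>
    define b where "b = \<eta> * k / (2 * (A + 1))"
    have "b > 0" using \<eta> k0 A0 by (simp add: b_def)
    then obtain h where h: "h > 0" "\<And>s t. s \<in> {0..2} \<Longrightarrow> t \<in> {0..2} \<Longrightarrow> \<bar>s - t\<bar> < h \<Longrightarrow> \<bar>trunc_kernel ?N d s - trunc_kernel ?N d t\<bar> < b"
      using uc unfolding uniformly_continuous_on_def dist_real_def by (metis abs_minus_commute)
    have two: "norm (a - b) \<in> {0..2}" if "a \<in> unit_sphere" "b \<in> unit_sphere" for a b :: "(real ^ 'n) \<times> real"
      using that norm_triangle_ineq4[of a b] by (auto simp: unit_sphere_def)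
    have "norm (T n x - T n y) < \<eta>" if y: "y \<in> unit_sphere" "norm (x - y) < h" for n y
    proof -
      have "\<bar>?K x \<zeta> - ?K y \<zeta>\<bar> \<le> b" if "\<zeta> \<in> unit_sphere" for \<zeta>
      proof -
        have "\<bar>norm (x - \<zeta>) - norm (y - \<zeta>)\<bar> \<le> norm (x - y)"
          using norm_triangle_ineq3[of "x - \<zeta>" "y - \<zeta>"] by simp
        then show ?thesis using h(2)[OF two[OF x that] two[OF y(1) that]] y(2) by linarith
      qed
      then have "\<bar>T n x - T n y\<bar> \<le> b * A / k" by (rule Tdiff)
      also have "\<dots> = \<eta> * (A / (2 * (A + 1)))" using k0 by (simp add: b_def)
      also have "\<dots> < \<eta> * 1" using A0 \<eta> by (intro mult_strict_left_mono) (auto simp: field_simps)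
      finally show ?thesis by simp
    qed
    then show ?thesis using h(1) by blast
  qed
  have "compact (unit_sphere :: ((real ^ 'n) \<times> real) set)" by (simp add: unit_sphere_def)
  then obtain g r where r: "strict_mono (r :: nat \<Rightarrow> nat)"
    and g: "\<And>\<eta>. 0 < \<eta> \<Longrightarrow> \<exists>n0. \<forall>n z. n \<ge> n0 \<and> z \<in> unit_sphere \<longrightarrow> norm (T (r n) z - g z) < \<eta>"
    using Arzela_Ascoli[of unit_sphere T "inverse (d ^ ?N) * A / k"] Tb equi by (metis real_norm_def)
  \<comment> \<open>The two uniform errors contribute \<open>12 * \<eta>\<^sup>2 * ?vol\<close> to
    the integral, which this choice keeps at most \<open>e / 3\<close>; the added 1 excludes a zero
    denominator.\<close>
  define \<eta> where "\<eta> = sqrt (e / (36 * (?vol + 1)))"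
  have vol: "?vol \<ge> 0" by simp
  have \<eta>: "\<eta> > 0" using e vol by (simp add: \<eta>_def add_nonneg_pos)
  have \<eta>2: "\<eta>\<^sup>2 = e / (36 * (?vol + 1))" using e vol by (simp add: \<eta>_def)
  obtain n0 where n0: "\<And>n z. n \<ge> n0 \<Longrightarrow> z \<in> unit_sphere \<Longrightarrow> \<bar>T (r n) z - g z\<bar> < \<eta>"
    using g[OF \<eta>] by auto
  have "L2_inner ?S (\<lambda>x. f (r m) x - f (r n) x) (\<lambda>x. f (r m) x - f (r n) x) < e" if m: "m \<ge> n0" and n: "n \<ge> n0" for m n
  proof -
    have le: "(f (r m) z - f (r n) z)\<^sup>2 \<le> 3 * (f (r m) z - T (r m) z)\<^sup>2 + 3 * (f (r n) z - T (r n) z)\<^sup>2 + 12 * \<eta>\<^sup>2"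
      if z: "z \<in> unit_sphere" for z
    proof -
      have sq3: "(p + q + s)\<^sup>2 \<le> 3 * p\<^sup>2 + 3 * q\<^sup>2 + 3 * s\<^sup>2" for p q s :: real
        using zero_le_power2[of "p - q"] zero_le_power2[of "q - s"] zero_le_power2[of "p - s"]
        by (simp add: power2_eq_square algebra_simps)
      have "\<bar>T (r m) z - T (r n) z\<bar> \<le> 2 * \<eta>"
        using n0[OF m z] n0[OF n z] by linarith
      then have "(T (r m) z - T (r n) z)\<^sup>2 \<le> (2 * \<eta>)\<^sup>2"
        by (metis abs_ge_zero power2_abs power_mono)
      then show ?thesis
        using sq3[of "f (r m) z - T (r m) z" "- (f (r n) z - T (r n) z)" "T (r m) z - T (r n) z"]
        by (simp add: power_mult_distrib power2_commute[of "T (r n) z" "f (r n) z"])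
    qed
    have "(\<integral>\<^sup>+z. ennreal ((f (r m) z - f (r n) z)\<^sup>2) \<partial>?S) \<le>
      (\<integral>\<^sup>+z. ennreal 3 * ennreal ((f (r m) z - T (r m) z)\<^sup>2) + ennreal 3 * ennreal ((f (r n) z - T (r n) z)\<^sup>2) + ennreal (12 * \<eta>\<^sup>2) \<partial>?S)"
    proof (rule nn_integral_mono)
      fix z assume "z \<in> space ?S"
      then have z: "z \<in> unit_sphere" by (simp add: space_sphere_vol)
      show "ennreal ((f (r m) z - f (r n) z)\<^sup>2) \<le> ennreal 3 * ennreal ((f (r m) z - T (r m) z)\<^sup>2) + ennreal 3 * ennreal ((f (r n) z - T (r n) z)\<^sup>2) + ennreal (12 * \<eta>\<^sup>2)"
        using ennreal_leI[OF le[OF z]] by (simp add: ennreal_mult' ennreal_plus)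
    qed
    also have "\<dots> = ennreal 3 * (\<integral>\<^sup>+z. ennreal ((f (r m) z - T (r m) z)\<^sup>2) \<partial>?S) +
       ennreal 3 * (\<integral>\<^sup>+z. ennreal ((f (r n) z - T (r n) z)\<^sup>2) \<partial>?S) + ennreal (12 * \<eta>\<^sup>2) * emeasure ?S (space ?S)"
      by (simp add: nn_integral_add nn_integral_cmult)
    also have "\<dots> \<le> ennreal 3 * ennreal (B / c / k) + ennreal 3 * ennreal (B / c / k) + ennreal (12 * \<eta>\<^sup>2) * ennreal ?vol"
      by (intro add_mono mult_left_mono approx) (auto simp: sphere.emeasure_eq_measure)
    also have "\<dots> = ennreal (6 * (B / c / k) + 12 * \<eta>\<^sup>2 * ?vol)"
    proof -
      have q: "B / c / k \<ge> 0" using B0 c k0 by simp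
      have "ennreal 3 * ennreal (B / c / k) = ennreal (3 * (B / c / k))"
        "ennreal (12 * \<eta>\<^sup>2) * ennreal ?vol = ennreal (12 * \<eta>\<^sup>2 * ?vol)"
        by (rule ennreal_mult'[symmetric], simp)+
      then show ?thesis
        using ennreal_plus[of "3 * (B / c / k)" "3 * (B / c / k)"]
          ennreal_plus[of "6 * (B / c / k)" "12 * \<eta>\<^sup>2 * ?vol"] q by simp
    qed
    finally have "L2_inner ?S (\<lambda>x. f (r m) x - f (r n) x) (\<lambda>x. f (r m) x - f (r n) x) \<le> 6 * (B / c / k) + 12 * \<eta>\<^sup>2 * ?vol"
      unfolding nn_integral_sq_eq_L2_inner[OF L2_space_diff[OF fL fL]]
      by (subst (asm) ennreal_le_iff) (use B0 c k0 in auto)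
    moreover have "6 * (B / c / k) < e / 3 + e / 9"
    proof -
      have "18 * (B / c) < k * e" using k unfolding pos_divide_less_eq[OF e] .
      then have "18 * (B / c) / k < e" unfolding pos_divide_less_eq[OF k0] by (simp add: mult.commute)
      then show ?thesis using e by simp
    qed
    moreover have "12 * \<eta>\<^sup>2 * ?vol \<le> e / 3"
    proof -
      have "12 * \<eta>\<^sup>2 * ?vol = (e / 3) * (?vol / (?vol + 1))"
      proof -
        have "12 * (e / (36 * q)) * v = (e / 3) * (v / q)" for q v :: real by simp
        then show ?thesis unfolding \<eta>2 .
      qed
      also have "?vol / (?vol + 1) \<le> 1"
        by (subst divide_le_eq_1_pos) (use vol in linarith)+
      then have "(e / 3) * (?vol / (?vol + 1)) \<le> (e / 3) * 1" using e by (intro mult_left_mono) auto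
      finally show ?thesis by simp
    qed
    ultimately show ?thesis using e by linarith
  qed
  then show ?thesis using r by blast
qed

lemma H_compact:
  fixes f :: "nat \<Rightarrow> (real ^ 'n) \<times> real \<Rightarrow> real"
  assumes \<kappa>: "\<kappa> > 0" and f: "\<And>n. f n \<in> H_space \<kappa>" and B: "\<And>n. H_inner \<kappa> (f n) (f n) \<le> B"
  shows "\<exists>r :: nat \<Rightarrow> nat. strict_mono r \<and> (\<exists>w\<in>L2_space sphere_vol.
     (\<lambda>n. L2_inner sphere_vol (\<lambda>x. f (r n) x - w x) (\<lambda>x. f (r n) x - w x)) \<longlonglongrightarrow> 0)"
proof -
  define D where "D m n = L2_inner sphere_vol (\<lambda>x. f m x - f n x) (\<lambda>x. f m x - f n x)" for m n
  have "\<exists>(r :: nat \<Rightarrow> nat) n0. strict_mono r \<and> (\<forall>m\<ge>n0. \<forall>n\<ge>n0. D (s (r m)) (s (r n)) < e)" if "e > 0" for e and s :: "nat \<Rightarrow> nat"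
    using H_almost_Cauchy_subseq[OF \<kappa> _ _ that, of "\<lambda>n. f (s n)" B] f B unfolding D_def by blast
  then have "\<exists>r :: nat \<Rightarrow> nat. strict_mono r \<and> (\<forall>e>0. \<exists>n0. \<forall>m\<ge>n0. \<forall>n\<ge>n0. D (r m) (r n) < e)"
    by (rule Cauchy_subseq_of_totally_bounded)
  then obtain r :: "nat \<Rightarrow> nat" where r: "strict_mono r" "\<And>e. e > 0 \<Longrightarrow> \<exists>n0. \<forall>m\<ge>n0. \<forall>n\<ge>n0. D (r m) (r n) < e"
    by blast
  have "f n \<in> L2_space sphere_vol" for n using f[of n] by (simp add: H_space_def)
  then have "\<exists>w\<in>L2_space sphere_vol. (\<lambda>n. L2_inner sphere_vol (\<lambda>x. f (r n) x - w x) (\<lambda>x. f (r n) x - w x)) \<longlonglongrightarrow> 0"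
    using r(2) unfolding D_def by (intro sphere.L2_complete) auto
  then show ?thesis using r(1) by blast
qed

section \<open>Transport to the Euclidean space\<close>

lemma iota_add: "iota (\<lambda>z. u z + w z) = (\<lambda>x. iota u x + iota w x)"
  by (simp add: iota_def fun_eq_iff distrib_left)

lemma iota_diff: "iota (\<lambda>z. u z - w z) = (\<lambda>x. iota u x - iota w x)"
  by (simp add: iota_def fun_eq_iff right_diff_distrib)

lemma iota_scale: "iota (\<lambda>z. a * u z) = (\<lambda>x. a * iota u x)"
  by (simp add: iota_def fun_eq_iff)

text \<open>At the pole omitted by the projection, \<open>stereo\<close> divides by zero and has the value \<open>0\<close>; the pole is a
  null set.\<close>

definition iota_inv :: "(real ^ 'n \<Rightarrow> real) \<Rightarrow> (real ^ 'n) \<times> real \<Rightarrow> real" where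
  "iota_inv v z = conf_factor (stereo z) powr (- (real CARD('n) / 2)) * v (stereo z)"

lemma iota_iota_inv [simp]: "iota (iota_inv v) = v"
  by (auto simp: iota_def iota_inv_def fun_eq_iff powr_minus)

lemma measurable_sphere_vol_iff:
  "f \<in> measurable sphere_vol M \<longleftrightarrow> f \<in> measurable (restrict_space borel unit_sphere) M"
  by (simp add: measurable_cong_sets[OF sets_sphere_vol refl])

lemma measurable_compose_inv_stereo:
  assumes "u \<in> borel_measurable sphere_vol"
  shows "(\<lambda>x. u (inv_stereo x)) \<in> borel_measurable borel"
  using measurable_comp[OF measurable_inv_stereo, of u] assms by (simp add: o_def measurable_sphere_vol_iff)

lemma iota_measurable:
  assumes "u \<in> borel_measurable sphere_vol"
  shows "iota u \<in> borel_measurable borel"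
  unfolding iota_def[abs_def] using measurable_compose_inv_stereo[OF assms] by measurable

lemma iota_inv_measurable:
  assumes [measurable]: "v \<in> borel_measurable borel"
  shows "iota_inv v \<in> borel_measurable sphere_vol"
  unfolding measurable_sphere_vol_iff iota_inv_def[abs_def] by (rule measurable_restrict_space1) measurable

lemma AE_iota_eq_iff:
  assumes u: "u \<in> borel_measurable sphere_vol" and w: "w \<in> borel_measurable sphere_vol"
  shows "(AE x in lborel. iota u x = iota w x) \<longleftrightarrow> (AE z in sphere_vol. u z = w z)"
proof -
  have "{z \<in> space sphere_vol. u z = w z} \<in> sets sphere_vol" using u w by measurable
  then have "{z \<in> unit_sphere. u z = w z} \<in> sets borel"
    by (simp add: sets_sphere_vol sets_sphere_iff space_sphere_vol)
  from AE_sphere_vol[OF this] show ?thesis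
    by (simp add: iota_def)
qed

lemma iota_mult:
  fixes x :: "real ^ 'n"
  shows "iota u x * iota w x = conf_factor x ^ CARD('n) * (u (inv_stereo x) * w (inv_stereo x))"
proof -
  have "conf_factor x ^ CARD('n) = conf_factor x powr (real CARD('n) / 2) * conf_factor x powr (real CARD('n) / 2)"
    by (simp add: powr_add[symmetric] powr_realpow)
  then show ?thesis by (simp add: iota_def)
qed

lemma iota_L2_iff:
  assumes u: "u \<in> borel_measurable sphere_vol"
  shows "iota u \<in> L2_space lborel \<longleftrightarrow> u \<in> L2_space sphere_vol"
proof -
  have "(\<integral>\<^sup>+z. ennreal ((u z)\<^sup>2) \<partial>sphere_vol) = (\<integral>\<^sup>+x. ennreal ((iota u x)\<^sup>2) \<partial>lborel)"
    using u by (subst nn_integral_sphere_vol)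
      (auto simp: power2_eq_square iota_mult ennreal_mult' less_imp_le intro!: nn_integral_cong)
  then show ?thesis using iota_measurable[OF u] u by (simp add: L2_space_iff)
qed

lemma integral_sphere_vol:
  fixes f :: "(real ^ 'n) \<times> real \<Rightarrow> real"
  assumes "f \<in> borel_measurable sphere_vol"
  shows "(\<integral>z. f z \<partial>sphere_vol) = (\<integral>x. conf_factor x ^ CARD('n) * f (inv_stereo x) \<partial>lborel)"
proof -
  have "(\<integral>z. f z \<partial>sphere_vol) = (\<integral>x. f (inv_stereo x) \<partial>density lborel (\<lambda>x. ennreal (conf_factor x ^ CARD('n))))"
    unfolding sphere_vol_eq stereo_vol_def
    using assms by (subst integral_distr) (auto simp: measurable_sphere_vol_iff)
  also have "\<dots> = (\<integral>x. conf_factor x ^ CARD('n) * f (inv_stereo x) \<partial>lborel)"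
    using measurable_compose_inv_stereo[OF assms] by (subst integral_real_density) (auto simp: less_imp_le)
  finally show ?thesis .
qed

lemma L2_inner_iota:
  assumes "u \<in> borel_measurable sphere_vol" "w \<in> borel_measurable sphere_vol"
  shows "L2_inner lborel (iota u) (iota w) = L2_inner sphere_vol u w"
  using assms by (simp add: L2_inner_def iota_mult integral_sphere_vol)

lemma norm_L2_iota:
  "u \<in> borel_measurable sphere_vol \<Longrightarrow> norm_of (L2_inner lborel) (iota u) = norm_of (L2_inner sphere_vol) u"
  by (simp add: norm_of_def L2_inner_iota)

lemma isometric_iso_L2:
  "isometric_iso_ae (sphere_vol :: ((real ^ 'n) \<times> real) measure)
     (L2_space sphere_vol) (norm_of (L2_inner sphere_vol))
     lborel (L2_space lborel) (norm_of (L2_inner lborel)) iota"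
  unfolding isometric_iso_ae_def
proof (intro conjI ballI allI)
  show "iota ` L2_space (sphere_vol :: ((real ^ 'n) \<times> real) measure) \<subseteq> L2_space lborel"
    by (auto simp: iota_L2_iff L2_space_measurable)
next
  fix v :: "real ^ 'n \<Rightarrow> real" assume v: "v \<in> L2_space lborel"
  then have m: "iota_inv v \<in> borel_measurable sphere_vol"
    by (intro iota_inv_measurable) (simp add: L2_space_def)
  have "iota_inv v \<in> L2_space sphere_vol" using iota_L2_iff[OF m] v by simp
  then show "\<exists>u\<in>L2_space sphere_vol. AE y in lborel. iota u y = v y"
    by (intro bexI[of _ "iota_inv v"]) auto
qed (simp_all add: iota_add iota_scale AE_iota_eq_iff L2_space_measurable norm_L2_iota)

lemma H_space_measurable: "u \<in> H_space \<kappa> \<Longrightarrow> u \<in> borel_measurable sphere_vol"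
  by (simp add: H_space_def L2_space_def)

context
  fixes \<kappa> :: real
  assumes kappa_pos: "\<kappa> > 0"
begin

lemmas H_linear = hilbert_space_H[OF kappa_pos, unfolded hilbert_space_ae_def, THEN conjunct1, unfolded ae_linear_space_def]
lemmas H_inner_product =
  hilbert_space_H[OF kappa_pos, unfolded hilbert_space_ae_def, THEN conjunct2, THEN conjunct1, unfolded ae_inner_product_def]

lemma H_space_add: "u \<in> H_space \<kappa> \<Longrightarrow> w \<in> H_space \<kappa> \<Longrightarrow> (\<lambda>x. u x + w x) \<in> H_space \<kappa>"
  using H_linear by blast

lemma H_space_scale: "u \<in> H_space \<kappa> \<Longrightarrow> (\<lambda>x. a * u x) \<in> H_space \<kappa>"
  using H_linear by blast

lemma H_space_AE_cong:
  "u \<in> H_space \<kappa> \<Longrightarrow> w \<in> borel_measurable sphere_vol \<Longrightarrow> AE x in sphere_vol. w x = u x \<Longrightarrow> w \<in> H_space \<kappa>"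
  using H_linear by blast

lemma H_inner_commute: "H_inner \<kappa> u w = H_inner \<kappa> w u"
  by (simp add: H_inner_def mult.commute)

lemma H_inner_add:
  "u \<in> H_space \<kappa> \<Longrightarrow> w \<in> H_space \<kappa> \<Longrightarrow> h \<in> H_space \<kappa> \<Longrightarrow>
    H_inner \<kappa> (\<lambda>x. u x + w x) h = H_inner \<kappa> u h + H_inner \<kappa> w h"
  using H_inner_product by blast

lemma H_inner_scale:
  "u \<in> H_space \<kappa> \<Longrightarrow> h \<in> H_space \<kappa> \<Longrightarrow> H_inner \<kappa> (\<lambda>x. a * u x) h = a * H_inner \<kappa> u h"
  using H_inner_product by blast

lemma H_inner_nonneg: "u \<in> H_space \<kappa> \<Longrightarrow> 0 \<le> H_inner \<kappa> u u"
  using H_inner_product by blast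

lemma H_inner_eq_0_iff: "u \<in> H_space \<kappa> \<Longrightarrow> H_inner \<kappa> u u = 0 \<longleftrightarrow> (AE x in sphere_vol. u x = 0)"
  using H_inner_product by blast

lemma H_inner_AE_cong_left:
  "u \<in> H_space \<kappa> \<Longrightarrow> w \<in> H_space \<kappa> \<Longrightarrow> h \<in> H_space \<kappa> \<Longrightarrow> AE x in sphere_vol. u x = w x \<Longrightarrow>
    H_inner \<kappa> u h = H_inner \<kappa> w h"
  using H_inner_product by blast

lemma H_inner_AE_cong:
  assumes "u \<in> H_space \<kappa>" "u' \<in> H_space \<kappa>" "w \<in> H_space \<kappa>" "w' \<in> H_space \<kappa>"
    "AE z in sphere_vol. u z = u' z" "AE z in sphere_vol. w z = w' z"
  shows "H_inner \<kappa> u w = H_inner \<kappa> u' w'"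
  using H_inner_AE_cong_left[of u u' w] H_inner_AE_cong_left[of w w' u'] H_inner_commute[of u'] assms by metis

lemma D_inner_iota:
  assumes u: "u \<in> H_space \<kappa>" and w: "w \<in> H_space \<kappa>"
  shows "D_inner \<kappa> (iota u) (iota w) = H_inner \<kappa> u w"
  unfolding D_inner_def
proof (rule the_equality)
  show "\<exists>u1\<in>H_space \<kappa>. \<exists>u2\<in>H_space \<kappa>. iota u = iota u1 \<and> iota w = iota u2 \<and> H_inner \<kappa> u w = H_inner \<kappa> u1 u2"
    using u w by blast
  fix r assume "\<exists>u1\<in>H_space \<kappa>. \<exists>u2\<in>H_space \<kappa>. iota u = iota u1 \<and> iota w = iota u2 \<and> r = H_inner \<kappa> u1 u2"
  then obtain u1 u2 where *: "u1 \<in> H_space \<kappa>" "u2 \<in> H_space \<kappa>" "iota u = iota u1" "iota w = iota u2" "r = H_inner \<kappa> u1 u2"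
    by blast
  have "AE z in sphere_vol. u1 z = u z"
    using AE_iota_eq_iff[of u1 u] * u by (simp add: H_space_measurable)
  moreover have "AE z in sphere_vol. u2 z = w z"
    using AE_iota_eq_iff[of u2 w] * w by (simp add: H_space_measurable)
  ultimately show "r = H_inner \<kappa> u w"
    unfolding *(5) using H_inner_AE_cong * u w by blast
qed

lemma norm_D_iota: "u \<in> H_space \<kappa> \<Longrightarrow> norm_of (D_inner \<kappa>) (iota u) = norm_of (H_inner \<kappa>) u"
  by (simp add: norm_of_def D_inner_iota)

lemma H_space_diff: "u \<in> H_space \<kappa> \<Longrightarrow> w \<in> H_space \<kappa> \<Longrightarrow> (\<lambda>z. u z - w z) \<in> H_space \<kappa>"
  using jump_form.form_space_diff[OF jump_form_sphere[OF kappa_pos]] by (simp add: H_space_eq[OF kappa_pos])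

lemma ae_linear_space_D: "ae_linear_space lborel (D_space \<kappa> :: (real ^ 'n \<Rightarrow> real) set)"
proof -
  show ?thesis unfolding ae_linear_space_def D_space_def
  proof (intro conjI ballI allI impI)
    show "iota ` H_space \<kappa> \<subseteq> borel_measurable (lborel :: (real ^ 'n) measure)"
      using iota_measurable H_space_measurable by auto
    have "(\<lambda>x :: real ^ 'n. 0) = iota (\<lambda>z. 0)" by (simp add: iota_def fun_eq_iff)
    then show "(\<lambda>x :: real ^ 'n. 0) \<in> iota ` H_space \<kappa>" using H_linear by blast
  next
    fix u w :: "real ^ 'n \<Rightarrow> real" assume "u \<in> iota ` H_space \<kappa>" "w \<in> iota ` H_space \<kappa>"
    then show "(\<lambda>x. u x + w x) \<in> iota ` H_space \<kappa>"
      by (auto simp: iota_add[symmetric] H_space_add)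
  next
    fix a and u :: "real ^ 'n \<Rightarrow> real" assume "u \<in> iota ` H_space \<kappa>"
    then show "(\<lambda>x. a * u x) \<in> iota ` H_space \<kappa>"
      by (auto simp: iota_scale[symmetric] H_space_scale)
  next
    fix v w :: "real ^ 'n \<Rightarrow> real"
    assume "v \<in> iota ` H_space \<kappa>" and w: "w \<in> borel_measurable lborel" and eq: "AE x in lborel. w x = v x"
    then obtain u where u: "u \<in> H_space \<kappa>" "v = iota u" by blast
    \<comment> \<open>\<open>D_space\<close> is an exact image, so \<open>w\<close> must be the
      image of some function; \<open>iota_inv w\<close> is one, and it differs from \<open>u\<close>
      on a null set only.\<close>
    have m: "iota_inv w \<in> borel_measurable sphere_vol" using w by (intro iota_inv_measurable) simp
    have "AE z in sphere_vol. iota_inv w z = u z"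
      using AE_iota_eq_iff[OF m H_space_measurable[OF u(1)]] eq u(2) by simp
    then have "iota_inv w \<in> H_space \<kappa>" by (rule H_space_AE_cong[OF u(1) m])
    then show "w \<in> iota ` H_space \<kappa>" by (metis image_eqI iota_iota_inv)
  qed
qed

lemma hilbert_space_D: "hilbert_space_ae lborel (D_space \<kappa> :: (real ^ 'n \<Rightarrow> real) set) (D_inner \<kappa>)"
  unfolding hilbert_space_ae_def
proof (intro conjI)
  note HH = hilbert_space_H[OF kappa_pos, where 'n = 'n, unfolded hilbert_space_ae_def]
  show "ae_linear_space lborel (D_space \<kappa> :: (real ^ 'n \<Rightarrow> real) set)" by (rule ae_linear_space_D)
  show "ae_inner_product lborel (D_space \<kappa> :: (real ^ 'n \<Rightarrow> real) set) (D_inner \<kappa>)"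
    unfolding ae_inner_product_def D_space_def ball_simps
  proof (intro conjI ballI allI impI)
    fix u w h :: "(real ^ 'n) \<times> real \<Rightarrow> real" and a
    assume u: "u \<in> H_space \<kappa>" and w: "w \<in> H_space \<kappa>" and h: "h \<in> H_space \<kappa>"
    show "D_inner \<kappa> (iota u) (iota h) = D_inner \<kappa> (iota w) (iota h)" if "AE x in lborel. iota u x = iota w x"
      using that AE_iota_eq_iff[OF H_space_measurable[OF u] H_space_measurable[OF w]] H_inner_AE_cong_left[OF u w h] u w h
      by (simp add: D_inner_iota)
    show "D_inner \<kappa> (\<lambda>x. iota u x + iota w x) (iota h) = D_inner \<kappa> (iota u) (iota h) + D_inner \<kappa> (iota w) (iota h)"
      unfolding iota_add[symmetric] by (simp add: D_inner_iota H_space_add H_inner_add u w h)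
  next
    fix u w :: "(real ^ 'n) \<times> real \<Rightarrow> real" assume u: "u \<in> H_space \<kappa>" and w: "w \<in> H_space \<kappa>"
    show "D_inner \<kappa> (iota u) (iota w) = D_inner \<kappa> (iota w) (iota u)"
      unfolding D_inner_iota[OF u w] D_inner_iota[OF w u] by (rule H_inner_commute)
  next
    fix a and u h :: "(real ^ 'n) \<times> real \<Rightarrow> real" assume u: "u \<in> H_space \<kappa>" and h: "h \<in> H_space \<kappa>"
    show "D_inner \<kappa> (\<lambda>x. a * iota u x) (iota h) = a * D_inner \<kappa> (iota u) (iota h)"
      unfolding iota_scale[symmetric] by (simp add: D_inner_iota H_space_scale H_inner_scale u h)
  next
    fix u :: "(real ^ 'n) \<times> real \<Rightarrow> real" assume u: "u \<in> H_space \<kappa>"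
    show "0 \<le> D_inner \<kappa> (iota u) (iota u)" by (simp add: D_inner_iota H_inner_nonneg u)
    have "(AE x in lborel. iota u x = 0) \<longleftrightarrow> (AE z in sphere_vol. u z = 0)"
      using AE_iota_eq_iff[OF H_space_measurable[OF u], of "\<lambda>_. 0"] by (simp add: iota_def)
    then show "D_inner \<kappa> (iota u) (iota u) = 0 \<longleftrightarrow> (AE x in lborel. iota u x = 0)"
      unfolding D_inner_iota[OF u u] by (simp add: H_inner_eq_0_iff u)
  qed
  show "ae_complete (D_space \<kappa> :: (real ^ 'n \<Rightarrow> real) set) (norm_of (D_inner \<kappa>))"
    unfolding ae_complete_def
  proof (intro allI impI, elim conjE)
    fix f :: "nat \<Rightarrow> real ^ 'n \<Rightarrow> real"
    assume f: "\<forall>n. f n \<in> D_space \<kappa>" and Cau: "\<forall>e>0. \<exists>n0. \<forall>m\<ge>n0. \<forall>n\<ge>n0. norm_of (D_inner \<kappa>) (\<lambda>x. f m x - f n x) < e"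
    obtain u where u: "\<And>n. u n \<in> H_space \<kappa>" "\<And>n. f n = iota (u n)"
      using f unfolding D_space_def image_iff by metis
    have nd: "norm_of (D_inner \<kappa>) (\<lambda>x. iota u1 x - iota u2 x) = norm_of (H_inner \<kappa>) (\<lambda>z. u1 z - u2 z)"
      if "u1 \<in> H_space \<kappa>" "u2 \<in> H_space \<kappa>" for u1 u2 :: "(real ^ 'n) \<times> real \<Rightarrow> real"
      unfolding iota_diff[symmetric] by (rule norm_D_iota[OF H_space_diff[OF that]])
    have "\<forall>e>0. \<exists>n0. \<forall>m\<ge>n0. \<forall>n\<ge>n0. norm_of (H_inner \<kappa>) (\<lambda>x. u m x - u n x) < e"
      using Cau by (simp add: u nd)
    then obtain w where w: "w \<in> H_space \<kappa>" "(\<lambda>n. norm_of (H_inner \<kappa>) (\<lambda>x. u n x - w x)) \<longlonglongrightarrow> 0"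
      using HH[THEN conjunct2, THEN conjunct2, unfolded ae_complete_def] u(1) by blast
    then show "\<exists>v\<in>D_space \<kappa>. (\<lambda>n. norm_of (D_inner \<kappa>) (\<lambda>x. f n x - v x)) \<longlonglongrightarrow> 0"
      unfolding D_space_def by (intro bexI[of _ "iota w"]) (auto simp: u nd)
  qed
qed

lemma H_norm_ge_L2:
  assumes "u \<in> H_space \<kappa>"
  shows "\<kappa> * L2_inner sphere_vol u u \<le> H_inner \<kappa> u u" "0 \<le> H_inner \<kappa> u u"
  using assms jump_form.ip_self(1,2)[OF jump_form_sphere[OF kappa_pos]]
  by (simp_all add: H_space_eq[OF kappa_pos] H_inner_eq[OF kappa_pos])

lemma compactly_embedded_D:
  "compactly_embedded (D_space \<kappa> :: (real ^ 'n \<Rightarrow> real) set) (norm_of (D_inner \<kappa>))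
     (L2_space lborel) (norm_of (L2_inner lborel))"
  unfolding compactly_embedded_def
proof (intro conjI allI impI)
  have HL: "u \<in> L2_space sphere_vol" if "u \<in> H_space \<kappa>" for u :: "(real ^ 'n) \<times> real \<Rightarrow> real"
    using that by (simp add: H_space_def)
  show "(D_space \<kappa> :: (real ^ 'n \<Rightarrow> real) set) \<subseteq> L2_space lborel"
    using HL by (auto simp: D_space_def iota_L2_iff H_space_measurable)
  show "\<exists>C. \<forall>u\<in>D_space \<kappa> :: (real ^ 'n \<Rightarrow> real) set. norm_of (L2_inner lborel) u \<le> C * norm_of (D_inner \<kappa>) u"
  proof (intro exI[of _ "1 / sqrt \<kappa>"] ballI)
    fix v :: "real ^ 'n \<Rightarrow> real" assume "v \<in> D_space \<kappa>"
    then obtain u where u: "u \<in> H_space \<kappa>" "v = iota u" by (auto simp: D_space_def)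
    have "sqrt (\<kappa> * L2_inner sphere_vol u u) \<le> sqrt (H_inner \<kappa> u u)"
      using H_norm_ge_L2[OF u(1)] by simp
    then show "norm_of (L2_inner lborel) v \<le> 1 / sqrt \<kappa> * norm_of (D_inner \<kappa>) v"
      using kappa_pos unfolding u(2) norm_L2_iota[OF H_space_measurable[OF u(1)]] norm_D_iota[OF u(1)]
      by (simp add: norm_of_def real_sqrt_mult field_simps)
  qed
  fix f :: "nat \<Rightarrow> real ^ 'n \<Rightarrow> real"
  assume "(\<forall>n. f n \<in> D_space \<kappa>) \<and> bounded (range (\<lambda>n. norm_of (D_inner \<kappa>) (f n)))"
  then have f: "\<And>n. f n \<in> D_space \<kappa>" and bd: "bounded (range (\<lambda>n. norm_of (D_inner \<kappa>) (f n)))" by auto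
  obtain u where u: "\<And>n. u n \<in> H_space \<kappa>" "\<And>n. f n = iota (u n)"
    using f unfolding D_space_def image_iff by metis
  obtain b where b: "\<And>n. \<bar>norm_of (D_inner \<kappa>) (f n)\<bar> \<le> b"
    using bd by (auto simp: bounded_iff)
  have "H_inner \<kappa> (u n) (u n) \<le> b\<^sup>2" for n
  proof -
    have "\<bar>sqrt (H_inner \<kappa> (u n) (u n))\<bar> \<le> b"
      using b[of n] by (simp add: u norm_of_def D_inner_iota)
    then have "(sqrt (H_inner \<kappa> (u n) (u n)))\<^sup>2 \<le> b\<^sup>2"
      by (metis abs_ge_zero power2_abs power_mono)
    then show ?thesis using H_norm_ge_L2(2)[OF u(1)] by simp
  qed
  from H_compact[OF kappa_pos, of u, OF u(1) this]
  obtain r w where r: "strict_mono (r :: nat \<Rightarrow> nat)" and w: "w \<in> L2_space sphere_vol"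
    and lim: "(\<lambda>n. L2_inner sphere_vol (\<lambda>x. u (r n) x - w x) (\<lambda>x. u (r n) x - w x)) \<longlonglongrightarrow> 0"
    by blast
  have wm: "w \<in> borel_measurable sphere_vol" using w by (simp add: L2_space_def)
  have "(\<lambda>n. norm_of (L2_inner lborel) (\<lambda>x. f (r n) x - iota w x)) \<longlonglongrightarrow> 0"
  proof -
    have "norm_of (L2_inner lborel) (\<lambda>x. f (r n) x - iota w x) =
       sqrt (L2_inner sphere_vol (\<lambda>x. u (r n) x - w x) (\<lambda>x. u (r n) x - w x))" for n
    proof -
      have "(\<lambda>x. u (r n) x - w x) \<in> borel_measurable sphere_vol"
        using wm H_space_measurable[OF u(1)] by measurable
      from norm_L2_iota[OF this] show ?thesis by (simp add: u(2) iota_diff norm_of_def)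
    qed
    then show ?thesis using tendsto_real_sqrt[OF lim] by simp
  qed
  then show "\<exists>r :: nat \<Rightarrow> nat. strict_mono r \<and> (\<exists>w\<in>L2_space lborel. (\<lambda>n. norm_of (L2_inner lborel) (\<lambda>x. f (r n) x - w x)) \<longlonglongrightarrow> 0)"
    using r w iota_L2_iff[OF wm] by blast
qed

lemma isometric_iso_H:
  "isometric_iso_ae (sphere_vol :: ((real ^ 'n) \<times> real) measure)
     (H_space \<kappa>) (norm_of (H_inner \<kappa>)) lborel (D_space \<kappa>) (norm_of (D_inner \<kappa>)) iota"
  unfolding isometric_iso_ae_def
proof (intro conjI ballI allI)
  fix v :: "real ^ 'n \<Rightarrow> real" assume "v \<in> D_space \<kappa>"
  then show "\<exists>u\<in>H_space \<kappa>. AE y in lborel. iota u y = v y"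
    unfolding D_space_def by fastforce
qed (simp_all add: D_space_def iota_add iota_scale AE_iota_eq_iff H_space_measurable norm_D_iota)

end

section \<open>Asymptotics of the kernel masses\<close>

text \<open>The surface measure of the unit sphere in dimension \<open>n\<close>, the constant of
  polar coordinates; it is not the total mass of \<open>sphere_vol\<close>.\<close>

definition sphere_area :: "nat \<Rightarrow> real" where
  "sphere_area n = real n * unit_ball_vol (real n)"

lemma sphere_area_pos: "n > 0 \<Longrightarrow> sphere_area n > 0"
  by (simp add: sphere_area_def)

text \<open>Since the area is \<open>2 \<pi>\<^sup>n\<^sup>/\<^sup>2 / \<Gamma>(n/2)\<close>, the
  normalization of the forms cancels everything but the factor 2.\<close>

lemma c_const_sphere_area: "n > 0 \<Longrightarrow> c_const n * sphere_area n = 2"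
proof -
  assume n: "n > 0"
  have "Gamma (real n / 2 + 1) = real n / 2 * Gamma (real n / 2)"
    using n by (intro Gamma_plus1) (auto simp: nonpos_Ints_def)
  moreover have "Gamma (real n / 2) > 0" using n by (intro Gamma_real_pos) simp
  moreover have "pi powr (- (real n / 2)) * pi powr (real n / 2) = 1"
    by (simp add: powr_add[symmetric])
  moreover have "P * g * (m * (q / (m / 2 * g))) = P * q * 2" if "g > 0" "m > 0" for P q g m :: real
    using that by (simp add: field_simps)
  ultimately show ?thesis
    using n by (simp only: c_const_def sphere_area_def unit_ball_vol_def of_nat_0_less_iff mult_1)
qed

text \<open>The mass \<open>k\<^sub>s\<close>, evaluated at the pole, where \<open>|z - \<zeta>|\<^sup>2 = 2 \<phi>\<close>.\<close>

definition zonal_mass :: "nat \<Rightarrow> real \<Rightarrow> real" where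
  "zonal_mass n s = sphere_area n * 2 powr (s - 1) * Beta (real n / 2) (s / 2)"

lemma Beta_real_nonneg: "a > 0 \<Longrightarrow> b > 0 \<Longrightarrow> 0 \<le> Beta a (b :: real)"
  by (simp add: Beta_def Gamma_real_pos less_imp_le)

lemma zonal_mass_nonneg: "n > 0 \<Longrightarrow> s > 0 \<Longrightarrow> 0 \<le> zonal_mass n s"
  using sphere_area_pos[of n] by (simp add: zonal_mass_def Beta_real_nonneg)

lemma sqrt_powr: "0 \<le> y \<Longrightarrow> sqrt y powr s = y powr (s / 2)" for y s :: real
  by (simp add: powr_half_sqrt[symmetric] powr_powr)

lemma nn_integral_zonal:
  fixes z :: "(real ^ 'n) \<times> real"
  assumes z: "z \<in> unit_sphere" and s: "s > 0"
  shows "(\<integral>\<^sup>+\<zeta>. ennreal (norm (z - \<zeta>) powr s * inverse (norm (z - \<zeta>) ^ CARD('n))) \<partial>sphere_vol) = ennreal (zonal_mass CARD('n) s)"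
proof -
  let ?N = "CARD('n)"
  have "(\<integral>\<^sup>+\<zeta>. ennreal (norm (z - \<zeta>) powr s * inverse (norm (z - \<zeta>) ^ ?N)) \<partial>sphere_vol) =
     (\<integral>\<^sup>+x. ennreal (conf_factor x ^ ?N) * ennreal (sqrt (2 * conf_factor x) powr s * inverse (sqrt (2 * conf_factor (x :: real ^ 'n)) ^ ?N)) \<partial>lborel)"
    by (rule zonal_integral_const[OF z, of "\<lambda>r. ennreal (r powr s * inverse (r ^ ?N))"]) measurable
  also have "\<dots> = (\<integral>\<^sup>+x. ennreal (2 powr ((s - real ?N) / 2)) * ennreal (conf_factor (x :: real ^ 'n) powr ((real ?N + s) / 2)) \<partial>lborel)"
  proof (intro nn_integral_cong)
    fix x :: "real ^ 'n"
    let ?c = "conf_factor x"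
    have c: "?c > 0" by simp
    have "?c ^ ?N * (sqrt (2 * ?c) powr s * inverse (sqrt (2 * ?c) ^ ?N)) = 2 powr ((s - real ?N) / 2) * ?c powr ((real ?N + s) / 2)"
    proof -
      have "?c ^ ?N = ?c powr real ?N" using c by (simp add: powr_realpow)
      moreover have "sqrt (2 * ?c) powr s = (2 * ?c) powr (s / 2)" using c by (intro sqrt_powr) (simp add: less_imp_le)
      moreover have "inverse (sqrt (2 * ?c) ^ ?N) = (2 * ?c) powr (- (real ?N / 2))"
        using c by (simp add: powr_half_nat powr_minus)
      ultimately have "?c ^ ?N * (sqrt (2 * ?c) powr s * inverse (sqrt (2 * ?c) ^ ?N)) =
          ?c powr real ?N * (2 * ?c) powr (s / 2 + - (real ?N / 2))"
        by (simp only: powr_add)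
      also have "\<dots> = 2 powr (s / 2 + - (real ?N / 2)) * (?c powr real ?N * ?c powr (s / 2 + - (real ?N / 2)))"
        using c by (simp add: powr_mult)
      also have "\<dots> = 2 powr (s / 2 + - (real ?N / 2)) * ?c powr (real ?N + (s / 2 + - (real ?N / 2)))"
        by (simp only: powr_add)
      also have "s / 2 + - (real ?N / 2) = (s - real ?N) / 2" by (simp add: diff_divide_distrib)
      also have "real ?N + (s - real ?N) / 2 = (real ?N + s) / 2" by (simp add: field_simps)
      finally show ?thesis .
    qed
    then show "ennreal (?c ^ ?N) * ennreal (sqrt (2 * ?c) powr s * inverse (sqrt (2 * ?c) ^ ?N)) =
        ennreal (2 powr ((s - real ?N) / 2)) * ennreal (?c powr ((real ?N + s) / 2))"
      by (simp add: ennreal_mult'[symmetric] less_imp_le)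
  qed
  also have "\<dots> = ennreal (2 powr ((s - real ?N) / 2)) *
      ennreal (real ?N * unit_ball_vol ?N * 2 powr ((real ?N + s) / 2) / 2 * Beta (real ?N / 2) (s / 2))"
    by (subst nn_integral_cmult) (simp_all add: nn_integral_conf_factor_powr[OF s])
  also have "\<dots> = ennreal (2 powr ((s - real ?N) / 2) * (real ?N * unit_ball_vol ?N * 2 powr ((real ?N + s) / 2) / 2 * Beta (real ?N / 2) (s / 2)))"
    by (rule ennreal_mult'[symmetric]) simp
  also have "2 powr ((s - real ?N) / 2) * (real ?N * unit_ball_vol ?N * 2 powr ((real ?N + s) / 2) / 2 * Beta (real ?N / 2) (s / 2)) = zonal_mass ?N s"
  proof -
    have "(s - real ?N) / 2 + (real ?N + s) / 2 = s" by (simp add: field_simps)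
    then have "2 powr ((s - real ?N) / 2) * 2 powr ((real ?N + s) / 2) = 2 powr s"
      by (simp only: powr_add[symmetric])
    moreover have "2 powr (s - 1) = 2 powr s / 2" by (simp add: powr_diff)
    moreover have "a * (b * c * d / 2 * e) = b * c * ((a * d) / 2) * e" for a b c d e :: real by simp
    ultimately show ?thesis by (simp only: zonal_mass_def sphere_area_def)
  qed
  finally show ?thesis .
qed

text \<open>Writing \<open>Gamma (s/2)\<close> as \<open>2/s * Gamma (1 + s/2)\<close> turns the
  mass into \<open>sphere_area n * h s / s\<close> with \<open>h\<close> differentiable at 0 and
  \<open>h 0 = 1\<close>. The limit is thus \<open>sphere_area n * h'(0)\<close>, and the
  logarithmic derivative of \<open>h\<close> consists of \<open>ln 2\<close>, half of
  \<open>Digamma 1\<close> and minus half of \<open>Digamma a\<close>.\<close>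

lemma zonal_mass_asymptotics:
  assumes n: "n > 0"
  shows "((\<lambda>s. zonal_mass n s - sphere_area n / s) \<longlongrightarrow> sphere_area n * (ln 2 - euler_mascheroni / 2 - Digamma (real n / 2) / 2)) (at_right 0)"
proof -
  define a where "a = real n / 2"
  have a: "a > 0" using n by (simp add: a_def)
  define h where "h s = 2 powr s * (Gamma a * Gamma (1 + s / 2) / Gamma (a + s / 2))" for s :: real
  have Ga: "Gamma a > 0" using a by (rule Gamma_real_pos)
  have npa: "a \<notin> \<int>\<^sub>\<le>\<^sub>0" using a by (auto simp: nonpos_Ints_def)
  have np1: "(1::real) \<notin> \<int>\<^sub>\<le>\<^sub>0" by (auto simp: nonpos_Ints_def)
  have "(h has_real_derivative (ln 2 - euler_mascheroni / 2 - Digamma a / 2)) (at 0)"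
    unfolding h_def using a Ga[THEN less_imp_neq, symmetric] npa np1
    by (auto intro!: derivative_eq_intros simp: field_simps power2_eq_square)
  then have "((\<lambda>s. (h s - h 0) / (s - 0)) \<longlongrightarrow> ln 2 - euler_mascheroni / 2 - Digamma a / 2) (at 0)"
    by (simp add: has_field_derivative_iff)
  then have "((\<lambda>s. sphere_area n * ((h s - h 0) / (s - 0))) \<longlongrightarrow> sphere_area n * (ln 2 - euler_mascheroni / 2 - Digamma a / 2)) (at_right 0)"
    by (intro tendsto_intros) (rule filterlim_at_split[THEN iffD1, THEN conjunct2])
  moreover have "eventually (\<lambda>s. sphere_area n * ((h s - h 0) / (s - 0)) = zonal_mass n s - sphere_area n / s) (at_right 0)"
  proof -
    have "sphere_area n * ((h s - h 0) / (s - 0)) = zonal_mass n s - sphere_area n / s" if s: "s > 0" for s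
    proof -
      have "Gamma (s / 2 + 1) = s / 2 * Gamma (s / 2)"
        using s by (intro Gamma_plus1) (auto simp: nonpos_Ints_def)
      then have G2: "Gamma (1 + s / 2) = s / 2 * Gamma (s / 2)" by (simp add: add.commute)
      have "h s = s * (2 powr s / 2) * Beta a (s / 2)"
        unfolding h_def Beta_def G2 by simp
      moreover have "2 powr s / 2 = 2 powr (s - 1)" by (simp add: powr_diff)
      moreover have "h 0 = 1" using Ga by (simp add: h_def)
      ultimately show ?thesis
        using s by (simp add: zonal_mass_def a_def[symmetric] field_simps)
    qed
    then show ?thesis by (auto simp: eventually_at_right_less eventually_at_filter intro!: always_eventually)
  qed
  ultimately show ?thesis unfolding a_def by (rule Lim_transform_eventually)
qed

text \<open>With \<open>t = s\<close> this is the leading term of the local mass; with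
  \<open>t = s + 1\<close> it measures the error of freezing the conformal factor.\<close>

lemma nn_integral_ball_power:
  fixes x :: "real ^ 'n"
  assumes t: "t > 0"
  shows "(\<integral>\<^sup>+y\<in>ball x 1. ennreal (norm (x - y) powr t * inverse (norm (x - y) ^ CARD('n))) \<partial>lborel) = ennreal (sphere_area CARD('n) / t)"
proof -
  let ?N = "CARD('n)"
  have N: "?N \<ge> 1" "DIM(real^'n) = ?N" by (auto simp: Suc_le_eq)
  let ?f = "\<lambda>r. ennreal (r powr t * inverse (r ^ ?N)) * indicator {..<1} r"
  have "(\<integral>\<^sup>+y\<in>ball x 1. ennreal (norm (x - y) powr t * inverse (norm (x - y) ^ ?N)) \<partial>lborel) = (\<integral>\<^sup>+y. ?f (norm (x - y)) \<partial>lborel)"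
    by (intro nn_integral_cong) (auto simp: indicator_def dist_norm)
  also have "\<dots> = (\<integral>\<^sup>+y. ?f (norm (x - y)) \<partial>distr lborel borel ((+) x))"
    by (simp add: lborel_distr_plus)
  also have "\<dots> = (\<integral>\<^sup>+y. ?f (norm (y :: real ^ 'n)) \<partial>lborel)"
    by (subst nn_integral_distr) auto
  also have "\<dots> = ennreal (sphere_area ?N) * (\<integral>\<^sup>+r\<in>{0<..}. ennreal (r ^ (?N - 1)) * ?f r \<partial>lborel)"
    by (subst nn_integral_radial[where f = ?f]) (auto simp: N sphere_area_def)
  also have "(\<integral>\<^sup>+r\<in>{0<..}. ennreal (r ^ (?N - 1)) * ?f r \<partial>lborel) = (\<integral>\<^sup>+r\<in>{0..1}. ennreal (r powr (t - 1)) \<partial>lborel)"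
  proof (rule nn_integral_cong_AE)
    have "AE r in lborel. r \<noteq> (0::real)" "AE r in lborel. r \<noteq> (1::real)" by (rule AE_lborel_singleton)+
    then show "AE r in lborel. ennreal (r ^ (?N - 1)) * ?f r * indicator {0<..} r = ennreal (r powr (t - 1)) * indicator {0..1} r"
    proof eventually_elim
      case (elim r)
      have "r ^ (?N - 1) * (r powr t * inverse (r ^ ?N)) = r powr (t - 1)" if "r > 0"
      proof -
        have "r ^ ?N = r * r ^ (?N - 1)" using power_Suc[of r "?N - 1"] by simp
        then show ?thesis using that by (simp add: powr_diff field_simps)
      qed
      then show ?case using elim by (auto simp: indicator_def ennreal_mult'[symmetric])
    qed
  qed
  also have "\<dots> = ennreal (1 / t)"
  proof -
    have hi: "((\<lambda>r. r powr (t - 1)) has_integral (1 / t)) {0..1}"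
      using has_integral_powr_from_0[of "t - 1" 1] t by simp
    then have "(\<lambda>r. r powr (t - 1)) absolutely_integrable_on {0..1}"
      by (subst absolutely_integrable_on_iff_nonneg) auto
    then show ?thesis using hi by (subst absolutely_integrable_nn_integral) (auto simp: integral_unique)
  qed
  also have "ennreal (sphere_area ?N) * ennreal (1 / t) = ennreal (sphere_area ?N / t)"
    using sphere_area_pos[of ?N] by (subst ennreal_mult'[symmetric]) auto
  finally show ?thesis .
qed

section \<open>Comparison of the chordal and the Euclidean distance\<close>

definition chord :: "real ^ 'n \<Rightarrow> real ^ 'n \<Rightarrow> real" where
  "chord x y = norm (inv_stereo x - inv_stereo y)"

lemma chord_eq: "chord x y = sqrt (conf_factor x * conf_factor y) * norm (x - y)"
  unfolding chord_def using chordal_distance_sq[of x y]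
  by (metis norm_ge_zero real_sqrt_mult real_sqrt_abs abs_norm_cancel real_sqrt_unique)

lemma chord_nonneg: "0 \<le> chord x y"
  by (simp add: chord_def)

lemma chord_le_2: "chord x y \<le> 2"
  using norm_triangle_ineq4[of "inv_stereo x" "inv_stereo y"] inv_stereo_in_sphere[of x] inv_stereo_in_sphere[of y]
  unfolding chord_def unit_sphere_def by simp

lemma chord_commute: "chord x y = chord y x"
  by (simp add: chord_def norm_minus_commute)

lemma chord_powr_le: "0 < s \<Longrightarrow> s \<le> 1 \<Longrightarrow> chord x y powr s \<le> 2"
proof -
  assume s: "0 < s" "s \<le> 1"
  have "chord x y powr s \<le> 2 powr s" using s chord_nonneg chord_le_2 by (intro powr_mono2) auto
  also have "\<dots> \<le> 2 powr 1" using s by (intro powr_mono) auto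
  finally show ?thesis by simp
qed

lemma borel_chord [measurable]: "(\<lambda>p. chord (fst p) (snd p)) \<in> borel_measurable (lborel \<Otimes>\<^sub>M lborel)"
  unfolding chord_eq by measurable

text \<open>Uniform comparability over unit distances, by which the local kernel \<open>nker\<close>
  is controlled by \<open>wker\<close>.\<close>

lemma conf_factor_ratio:
  assumes "norm (x - y) \<le> 1"
  shows "conf_factor x \<le> 3 * conf_factor y"
proof -
  have "norm y \<le> norm x + 1"
    using norm_triangle_ineq[of x "y - x"] assms by (simp add: norm_minus_commute)
  then have "(norm y)\<^sup>2 \<le> (norm x + 1)\<^sup>2" by (intro power_mono) auto
  also have "\<dots> \<le> 2 * (norm x)\<^sup>2 + 2"
    using zero_le_power2[of "norm x - 1"] by (simp add: power2_eq_square algebra_simps)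
  finally have Y: "(norm y)\<^sup>2 \<le> 2 * (norm x)\<^sup>2 + 2" .
  have "1 + (norm y)\<^sup>2 \<le> 3 + 3 * (norm x)\<^sup>2"
    using Y zero_le_power2[of "norm x"] by linarith
  then have "1 + (norm y)\<^sup>2 \<le> 3 * (1 + (norm x)\<^sup>2)" by simp
  then show ?thesis
    using one_plus_norm_sq_pos[of x] one_plus_norm_sq_pos[of y]
    unfolding conf_factor_def by (simp add: field_simps)
qed

text \<open>A global Lipschitz bound, reduced to \<open>1 + (b + t)\<^sup>2 \<le> (1 + b\<^sup>2) (1
  + 2 t + 2 t\<^sup>2)\<close> and the quadratic Taylor bound for \<open>exp (2 * t)\<close>. The
  constant 2 is generous and makes this elementary route possible.\<close>

lemma ln_conf_factor_diff_le: "ln (conf_factor x) - ln (conf_factor y) \<le> 2 * norm (x - y)"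
proof -
  define t where "t = norm (x - y)"
  define b where "b = norm x"
  have t: "t \<ge> 0" by (simp add: t_def)
  have "norm y \<le> b + t"
    using norm_triangle_ineq[of x "y - x"] by (simp add: b_def t_def norm_minus_commute)
  then have "(norm y)\<^sup>2 \<le> (b + t)\<^sup>2" by (intro power_mono) auto
  moreover have "1 + (b + t)\<^sup>2 \<le> (1 + b\<^sup>2) * (1 + 2 * t + 2 * t\<^sup>2)"
  proof -
    have "(1 + b\<^sup>2) * (1 + 2 * t + 2 * t\<^sup>2) - (1 + (b + t)\<^sup>2) = t\<^sup>2 + t * ((1 - b)\<^sup>2 + 1 + b\<^sup>2) + 2 * (b\<^sup>2 * t\<^sup>2)"
      by (simp add: power2_eq_square algebra_simps)
    also have "\<dots> \<ge> 0" using t by (intro add_nonneg_nonneg mult_nonneg_nonneg) auto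
    finally show ?thesis by simp
  qed
  moreover have "1 + 2 * t + 2 * t\<^sup>2 \<le> exp (2 * t)"
    using exp_lower_Taylor_quadratic[of "2 * t"] t by (simp add: power2_eq_square)
  then have "(1 + b\<^sup>2) * (1 + 2 * t + 2 * t\<^sup>2) \<le> (1 + b\<^sup>2) * exp (2 * t)"
    by (intro mult_left_mono) auto
  ultimately have "1 + (norm y)\<^sup>2 \<le> (1 + (norm x)\<^sup>2) * exp (2 * t)" unfolding b_def by linarith
  then have "ln (1 + (norm y)\<^sup>2) \<le> ln ((1 + (norm x)\<^sup>2) * exp (2 * t))"
    using one_plus_norm_sq_pos[of y] one_plus_norm_sq_pos[of x] by (subst ln_le_cancel_iff) auto
  then have "ln (1 + (norm y)\<^sup>2) \<le> ln (1 + (norm x)\<^sup>2) + 2 * t"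
    using one_plus_norm_sq_pos[of x] by (simp add: ln_mult)
  then show ?thesis
    using one_plus_norm_sq_pos[of x] one_plus_norm_sq_pos[of y]
    by (simp add: conf_factor_def ln_div t_def)
qed

lemma exp_diff_le: "exp a \<le> 2 \<Longrightarrow> exp b \<le> 2 \<Longrightarrow> \<bar>exp a - exp b\<bar> \<le> 2 * \<bar>a - b\<bar>" for a b :: real
proof -
  have *: "exp a - exp b \<le> 2 * \<bar>a - b\<bar>" if "exp a \<le> 2" for a b :: real
  proof -
    have "exp b = exp a * exp (b - a)" by (simp add: exp_diff)
    also have "\<dots> \<ge> exp a * (1 + (b - a))" by (intro mult_left_mono exp_ge_add_one_self) auto
    finally have "exp a - exp b \<le> exp a * (a - b)" by (simp add: algebra_simps)
    also have "\<dots> \<le> exp a * \<bar>a - b\<bar>" by (intro mult_left_mono) auto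
    also have "\<dots> \<le> 2 * \<bar>a - b\<bar>" using that by (intro mult_right_mono) auto
    finally show ?thesis .
  qed
  assume "exp a \<le> 2" "exp b \<le> 2"
  then show ?thesis using *[of a b] *[of b a] by (simp add: abs_minus_commute abs_le_iff)
qed

lemma conf_factor_powr_le: "0 < s \<Longrightarrow> s \<le> 1 \<Longrightarrow> conf_factor x powr s \<le> 2"
proof -
  assume s: "0 < s" "s \<le> 1"
  have "conf_factor x powr s \<le> 2 powr s" using s conf_factor_le_2 by (intro powr_mono2) (auto simp: less_imp_le)
  also have "\<dots> \<le> 2 powr 1" using s by (intro powr_mono) auto
  finally show ?thesis by simp
qed

text \<open>The cost of replacing \<open>conf_factor y\<close> by \<open>conf_factor x\<close>. Both
  gains matter: the extra power of \<open>norm (x - y)\<close> compensates the singular kernel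
  uniformly in \<open>s\<close>, and the factor \<open>s\<close> makes the error vanish in the
  limit.\<close>

lemma chord_powr_approx:
  assumes s: "0 < s" "s \<le> 1"
  shows "\<bar>chord x y powr s - conf_factor x powr s * norm (x - y) powr s\<bar> \<le> 2 * s * norm (x - y) powr (s + 1)"
proof -
  let ?a = "s / 2 * ln (conf_factor x) + s / 2 * ln (conf_factor y)" and ?b = "s * ln (conf_factor x)"
  have ea: "exp ?a = conf_factor x powr (s / 2) * conf_factor y powr (s / 2)"
    by (simp add: exp_add powr_def)
  have eb: "exp ?b = conf_factor x powr s" by (simp add: powr_def)
  have "exp ?a \<le> 2"
  proof -
    have h: "conf_factor z powr (s / 2) \<le> 2 powr (s / 2)" for z :: "real ^ 'a"
      using s conf_factor_le_2 by (intro powr_mono2) (auto simp: less_imp_le)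
    have "exp ?a \<le> 2 powr (s / 2) * 2 powr (s / 2)"
      unfolding ea using h by (intro mult_mono) auto
    also have "\<dots> = 2 powr s" by (simp add: powr_add[symmetric])
    also have "\<dots> \<le> 2 powr 1" using s by (intro powr_mono) auto
    finally show ?thesis by simp
  qed
  moreover have "exp ?b \<le> 2" unfolding eb by (rule conf_factor_powr_le[OF s])
  ultimately have "\<bar>exp ?a - exp ?b\<bar> \<le> 2 * \<bar>?a - ?b\<bar>" by (rule exp_diff_le)
  also have "?a - ?b = s / 2 * (ln (conf_factor y) - ln (conf_factor x))" by (simp add: field_simps)
  also have "2 * \<bar>s / 2 * (ln (conf_factor y) - ln (conf_factor x))\<bar> = s * \<bar>ln (conf_factor y) - ln (conf_factor x)\<bar>"
    using s by (simp add: abs_mult)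
  also have "\<dots> \<le> s * (2 * norm (x - y))"
    using s ln_conf_factor_diff_le[of x y] ln_conf_factor_diff_le[of y x]
    by (intro mult_left_mono) (auto simp: abs_le_iff norm_minus_commute)
  finally have le: "\<bar>exp ?a - exp ?b\<bar> \<le> 2 * s * norm (x - y)" by simp
  have "chord x y powr s = exp ?a * norm (x - y) powr s"
  proof -
    have "sqrt (conf_factor x * conf_factor y) powr s = (conf_factor x * conf_factor y) powr (s / 2)"
      by (intro sqrt_powr) (simp add: less_imp_le)
    then show ?thesis unfolding chord_eq ea by (simp add: powr_mult less_imp_le)
  qed
  then have "\<bar>chord x y powr s - conf_factor x powr s * norm (x - y) powr s\<bar> = \<bar>exp ?a - exp ?b\<bar> * norm (x - y) powr s"
    unfolding eb by (simp add: left_diff_distrib[symmetric] abs_mult)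
  also have "\<dots> \<le> 2 * s * norm (x - y) * norm (x - y) powr s"
    using le by (intro mult_right_mono) auto
  also have "\<dots> = 2 * s * norm (x - y) powr (s + 1)"
    by (simp add: powr_add)
  finally show ?thesis .
qed

section \<open>Lipschitz bounds\<close>

text \<open>Boundedness of the derivative is checked on basis vectors, where continuity is
  available; convexity of the ball then gives the Lipschitz bound.\<close>

lemma C1_bounded_Lipschitz:
  fixes f :: "'a::euclidean_space \<Rightarrow> real"
  assumes C1: "Ck_on (Suc 0) UNIV f"
  shows "\<exists>L\<ge>0. \<forall>x\<in>cball 0 R. \<forall>y\<in>cball 0 R. \<bar>f x - f y\<bar> \<le> L * norm (x - y)"
proof -
  let ?D = "\<lambda>x. frechet_derivative f (at x)"
  have der: "(f has_derivative ?D x) (at x)" for x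
    by (rule Ck_on_Suc_has_derivative[OF _ C1]) auto
  have "\<exists>M. \<forall>x\<in>cball 0 R. \<bar>?D x b\<bar> \<le> M" if "b \<in> Basis" for b
  proof -
    have "continuous_on (cball 0 R) (\<lambda>x. ?D x b)"
      using C1 that by (auto intro: continuous_on_subset)
    then have "bounded ((\<lambda>x. ?D x b) ` cball 0 R)"
      by (intro compact_imp_bounded compact_continuous_image) auto
    then show ?thesis by (auto simp: bounded_iff)
  qed
  then obtain M where M: "\<And>b x. b \<in> Basis \<Longrightarrow> x \<in> cball 0 R \<Longrightarrow> \<bar>?D x b\<bar> \<le> M b" by metis
  define L where "L = (\<Sum>b\<in>Basis. \<bar>M b\<bar>)"
  have on: "onorm (?D x) \<le> L" if x: "x \<in> cball 0 R" for x
  proof (rule onorm_le)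
    fix h :: 'a
    have lin: "linear (?D x)" using der by (rule has_derivative_linear)
    have "?D x h = (\<Sum>b\<in>Basis. (h \<bullet> b) * ?D x b)"
      using linear_sum[OF lin, of "\<lambda>b. (h \<bullet> b) *\<^sub>R b" Basis] by (simp add: euclidean_representation linear_cmul[OF lin])
    then have "\<bar>?D x h\<bar> \<le> (\<Sum>b\<in>Basis. \<bar>(h \<bullet> b) * ?D x b\<bar>)" by simp
    also have "\<dots> \<le> (\<Sum>b\<in>Basis. norm h * \<bar>M b\<bar>)"
      unfolding abs_mult by (intro sum_mono mult_mono Basis_le_norm order_trans[OF M[OF _ x] abs_ge_self]) auto
    finally show "norm (?D x h) \<le> L * norm h" by (simp add: L_def sum_distrib_left mult.commute)
  qed
  have "\<bar>f x - f y\<bar> \<le> L * norm (x - y)" if "x \<in> cball 0 R" "y \<in> cball 0 R" for x y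
    using differentiable_bound[OF convex_cball has_derivative_at_withinI[OF der] on that] by simp
  moreover have "L \<ge> 0" by (simp add: L_def sum_nonneg)
  ultimately show ?thesis by blast
qed

text \<open>The chordal metric degenerates at infinity, yet the bound is global: at least one point
  may be assumed in the support ball. If the other is near, the metrics are comparable; if it is
  far, the chordal distance is bounded below and boundedness of \<open>f\<close> suffices.\<close>

lemma C1_compact_support_chord_Lipschitz:
  fixes f :: "real ^ 'n \<Rightarrow> real"
  assumes C1: "Ck_on (Suc 0) UNIV f" and supp: "\<And>x. norm x > R \<Longrightarrow> f x = 0"
  shows "\<exists>C\<ge>0. \<forall>x y. (f x - f y)\<^sup>2 \<le> C * (chord x y)\<^sup>2"
proof -
  \<comment> \<open>The hypothesis puts no sign on \<open>R\<close>; the absolute value gives a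
    nonnegative radius.\<close>
  define Q where "Q = \<bar>R\<bar>"
  have supp: "norm x \<le> Q" if "f x \<noteq> 0" for x
    using supp[of x] that by (force simp: Q_def)
  \<comment> \<open>The radius \<open>Q + 1\<close> contains both points of every pair at distance
    at most 1 with one point in the support ball.\<close>
  obtain L where L: "L \<ge> 0" "\<And>x y. x \<in> cball 0 (Q + 1) \<Longrightarrow> y \<in> cball 0 (Q + 1) \<Longrightarrow> \<bar>f x - f y\<bar> \<le> L * norm (x - y)"
    using C1_bounded_Lipschitz[OF C1] by metis
  define m where "m = 2 / (1 + Q\<^sup>2)"
  have m: "m > 0" unfolding m_def using one_plus_norm_sq_pos[of Q] by simp
  have cm: "conf_factor x \<ge> m" if "norm x \<le> Q" for x :: "real ^ 'n"
  proof -
    have "(norm x)\<^sup>2 \<le> Q\<^sup>2" using that by (intro power_mono) auto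
    then show ?thesis unfolding conf_factor_def m_def using one_plus_norm_sq_pos[of x] by (intro frac_le) auto
  qed
  obtain B where B: "B \<ge> 0" "\<And>x. \<bar>f x\<bar> \<le> B"
  proof -
    have "continuous_on (cball 0 Q) f"
      using Ck_on_SucD[OF open_UNIV C1] by (auto intro: continuous_on_subset)
    then have "bounded (f ` cball 0 Q)"
      by (intro compact_imp_bounded compact_continuous_image) auto
    then obtain B where B: "\<And>x. norm x \<le> Q \<Longrightarrow> \<bar>f x\<bar> \<le> B" unfolding bounded_iff by (metis image_eqI mem_cball_0 real_norm_def)
    show ?thesis
    proof (rule that[of "\<bar>B\<bar>"])
      show "\<bar>f x\<bar> \<le> \<bar>B\<bar>" for x using B[of x] supp[of x] by (cases "f x = 0") auto
    qed simp
  qed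
  \<comment> \<open>The first summand handles near pairs, where the product of conformal factors is
    at least \<open>m * (m / 3)\<close>; the second handles far pairs, where the squared chordal
    distance is at least \<open>2 * m / (3 + 2 * Q\<^sup>2)\<close>.\<close>
  define C where "C = L\<^sup>2 * 3 / m\<^sup>2 + (2 * B)\<^sup>2 * (3 + 2 * Q\<^sup>2) / (2 * m)"
  have C1: "L\<^sup>2 * 3 / m\<^sup>2 \<ge> 0" and C2: "(2 * B)\<^sup>2 * (3 + 2 * Q\<^sup>2) / (2 * m) \<ge> 0"
    using m by auto
  have key: "(f x - f y)\<^sup>2 \<le> C * (chord x y)\<^sup>2" if x: "norm x \<le> Q" for x y
  proof (cases "norm (x - y) \<le> 1")
    case True
    have "norm y \<le> Q + 1" using True x norm_triangle_ineq[of x "y - x"] by (simp add: norm_minus_commute)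
    then have "\<bar>f x - f y\<bar> \<le> L * norm (x - y)" using x by (intro L(2)) auto
    then have "(f x - f y)\<^sup>2 \<le> (L * norm (x - y))\<^sup>2" by (metis abs_ge_zero power2_abs power_mono)
    also have "\<dots> = L\<^sup>2 * 3 / m\<^sup>2 * ((m * (m / 3)) * (norm (x - y))\<^sup>2)"
      using m by (simp add: power2_eq_square)
    also have "\<dots> \<le> L\<^sup>2 * 3 / m\<^sup>2 * (conf_factor x * conf_factor y * (norm (x - y))\<^sup>2)"
      using cm[OF x] conf_factor_ratio[OF True] m C1
      by (intro mult_left_mono mult_right_mono mult_mono) auto
    also have "\<dots> = L\<^sup>2 * 3 / m\<^sup>2 * (chord x y)\<^sup>2" by (simp add: chord_def chordal_distance_sq)
    also have "\<dots> \<le> C * (chord x y)\<^sup>2" using C2 by (intro mult_right_mono) (auto simp: C_def)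
    finally show ?thesis .
  next
    case False
    define t where "t = norm (x - y)"
    have t: "t > 1" using False by (simp add: t_def)
    have "norm y \<le> Q + t" using x norm_triangle_ineq[of x "y - x"] by (simp add: norm_minus_commute t_def)
    then have "(norm y)\<^sup>2 \<le> (Q + t)\<^sup>2" by (intro power_mono) auto
    also have "\<dots> \<le> 2 * Q\<^sup>2 + 2 * t\<^sup>2" using zero_le_power2[of "Q - t"] by (simp add: power2_eq_square algebra_simps)
    finally have "1 + (norm y)\<^sup>2 \<le> 1 * 1 + 2 * Q\<^sup>2 * 1 + 2 * t\<^sup>2" by simp
    also have "\<dots> \<le> 1 * t\<^sup>2 + 2 * Q\<^sup>2 * t\<^sup>2 + 2 * t\<^sup>2"
      using t by (intro add_mono mult_left_mono) (auto simp: one_le_power)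
    finally have ny: "1 + (norm y)\<^sup>2 \<le> (3 + 2 * Q\<^sup>2) * t\<^sup>2" by (simp add: algebra_simps)
    have pos: "3 + 2 * Q\<^sup>2 > 0" by (simp add: add_pos_nonneg)
    \<comment> \<open>The quadratic decay of \<open>conf_factor y\<close> at infinity is compensated
      by \<open>t\<^sup>2\<close>.\<close>
    have cy: "2 / (3 + 2 * Q\<^sup>2) \<le> conf_factor y * t\<^sup>2"
    proof -
      have "2 / (3 + 2 * Q\<^sup>2) = 2 / ((3 + 2 * Q\<^sup>2) * t\<^sup>2) * t\<^sup>2" using t by simp
      also have "\<dots> \<le> conf_factor y * t\<^sup>2"
        unfolding conf_factor_def using ny one_plus_norm_sq_pos[of y] by (intro mult_right_mono frac_le) auto
      finally show ?thesis .
    qed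
    have "\<bar>f x - f y\<bar> \<le> 2 * B" using B(2)[of x] B(2)[of y] by linarith
    then have "(f x - f y)\<^sup>2 \<le> (2 * B)\<^sup>2" by (metis abs_ge_zero power2_abs power_mono)
    also have "\<dots> = (2 * B)\<^sup>2 * (3 + 2 * Q\<^sup>2) / (2 * m) * (m * (2 / (3 + 2 * Q\<^sup>2)))"
      using m pos by simp
    also have "\<dots> \<le> (2 * B)\<^sup>2 * (3 + 2 * Q\<^sup>2) / (2 * m) * (conf_factor x * (conf_factor y * t\<^sup>2))"
      using cm[OF x] cy m C2 pos by (intro mult_left_mono mult_mono) (auto simp: less_imp_le)
    also have "\<dots> = (2 * B)\<^sup>2 * (3 + 2 * Q\<^sup>2) / (2 * m) * (chord x y)\<^sup>2" by (simp add: chord_def chordal_distance_sq t_def)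
    also have "\<dots> \<le> C * (chord x y)\<^sup>2" using C1 by (intro mult_right_mono) (auto simp: C_def)
    finally show ?thesis .
  qed
  have "(f x - f y)\<^sup>2 \<le> C * (chord x y)\<^sup>2" for x y
  proof -
    consider "norm x \<le> Q" | "norm y \<le> Q" | "f x = 0" "f y = 0" using supp by blast
    then show ?thesis
    proof cases
      case 1 then show ?thesis by (rule key)
    next
      case 2 from key[OF this, of x] show ?thesis by (simp add: power2_commute chord_commute)
    next
      case 3 then show ?thesis using C1 C2 by (simp add: C_def)
    qed
  qed
  moreover have "C \<ge> 0" using C1 C2 by (simp add: C_def)
  ultimately show ?thesis by blast
qed

lemma Ck1_conf_factor_powr: "Ck_on (Suc 0) UNIV (\<lambda>x :: real ^ 'n. conf_factor x powr a)"
proof (rule Ck_on_SucI)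
  fix x :: "real ^ 'n"
  have "((\<lambda>t. t powr a) has_derivative (\<lambda>h. h * (a * conf_factor x powr (a - 1)))) (at (conf_factor x))"
    using DERIV_powr[OF DERIV_ident conf_factor_pos, of "\<lambda>_. a" 0 x]
    by (simp add: has_field_derivative_def mult_commute_abs) (use has_real_derivative_powr[OF conf_factor_pos, of a x] in \<open>simp add: has_field_derivative_def mult_commute_abs\<close>)
  from has_derivative_compose[OF conf_factor_has_derivative this]
  show "((\<lambda>x. conf_factor x powr a) has_derivative
     (\<lambda>b. - (conf_factor x * (conf_factor x * (x \<bullet> b))) * (a * conf_factor x powr (a - 1)))) (at x)" .
next
  fix b :: "real ^ 'n"
  show "Ck_on 0 UNIV (\<lambda>x. - (conf_factor x * (conf_factor x * (x \<bullet> b))) * (a * conf_factor x powr (a - 1)))"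
    by (simp, intro continuous_intros continuous_conf_factor) auto
qed auto

section \<open>The form in Euclidean coordinates\<close>

definition kern :: "real ^ 'n \<Rightarrow> real ^ 'n \<Rightarrow> real" where
  "kern x y = inverse (norm (x - y) ^ CARD('n))"

definition pf :: "real ^ 'n \<Rightarrow> real" where
  "pf x = conf_factor x powr (real CARD('n) / 2)"

lemma pf_pos [simp]: "0 < pf x"
  by (simp add: pf_def)

lemma pf_neq [simp]: "pf x \<noteq> 0"
  by (simp add: pf_def)

lemma pf_sq: "pf x * pf x = conf_factor (x :: real ^ 'n) ^ CARD('n)"
  by (simp add: pf_def powr_add[symmetric] powr_realpow)

lemma borel_pf [measurable]: "pf \<in> borel_measurable borel"
  unfolding pf_def[abs_def] by measurable

lemma kern_nonneg: "0 \<le> kern x y"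
  by (simp add: kern_def)

lemma kern_commute: "kern x y = kern y x"
  by (simp add: kern_def norm_minus_commute)

lemma borel_kern [measurable]: "(\<lambda>p. kern (fst p) (snd p)) \<in> borel_measurable (lborel \<Otimes>\<^sub>M lborel)"
  unfolding kern_def by measurable

lemma borel_kern1 [measurable]: "kern x \<in> borel_measurable borel"
  unfolding kern_def[abs_def] by measurable

lemma borel_chord1 [measurable]: "chord x \<in> borel_measurable borel"
  unfolding chord_eq[abs_def] by measurable

text \<open>Conformal covariance of the kernel: its exponent matches the weight of
  \<open>iota\<close>, so half of the two volume densities turns the chordal kernel into the
  Euclidean one.\<close>

lemma inverse_chord_power:
  fixes x :: "real ^ 'n"
  shows "pf x * pf y * inverse (chord x y ^ CARD('n)) = kern x y"
proof -
  have "sqrt (conf_factor x * conf_factor y) ^ CARD('n) = pf x * pf y"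
    unfolding pf_def by (simp add: powr_half_nat real_sqrt_mult power_mult_distrib)
  then have "chord x y ^ CARD('n) = pf x * pf y * norm (x - y) ^ CARD('n)"
    by (simp add: chord_eq power_mult_distrib)
  moreover have "a * b * inverse (a * b * c) = inverse c" if "a \<noteq> 0" "b \<noteq> 0" for a b c :: real
    using that by (simp add: field_simps)
  ultimately show ?thesis by (simp only: kern_def pf_neq not_False_eq_True)
qed

lemma nn_integral_weighted_kern:
  fixes x :: "real ^ 'n"
  assumes s: "s > 0"
  shows "(\<integral>\<^sup>+y. ennreal (pf y / pf x * (kern x y * chord x y powr s)) \<partial>lborel) = ennreal (zonal_mass CARD('n) s)"
proof -
  have "ennreal (zonal_mass CARD('n) s) =
     (\<integral>\<^sup>+\<zeta>. ennreal (norm (inv_stereo x - \<zeta>) powr s * inverse (norm (inv_stereo x - \<zeta>) ^ CARD('n))) \<partial>sphere_vol)"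
    by (rule nn_integral_zonal[symmetric]) (auto simp: s)
  also have "\<dots> = (\<integral>\<^sup>+y. ennreal (conf_factor y ^ CARD('n)) * ennreal (chord x y powr s * inverse (chord x y ^ CARD('n))) \<partial>lborel)"
    unfolding chord_def by (rule nn_integral_sphere_vol) measurable
  also have "\<dots> = (\<integral>\<^sup>+y. ennreal (pf y / pf x * (kern x y * chord x y powr s)) \<partial>lborel)"
  proof (intro nn_integral_cong)
    fix y :: "real ^ 'n"
    have "conf_factor y ^ CARD('n) * (chord x y powr s * inverse (chord x y ^ CARD('n))) =
       pf y / pf x * (pf x * pf y * inverse (chord x y ^ CARD('n)) * chord x y powr s)"
      by (simp add: pf_sq[symmetric])
    also have "\<dots> = pf y / pf x * (kern x y * chord x y powr s)"
      by (simp only: inverse_chord_power)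
    finally show "ennreal (conf_factor y ^ CARD('n)) * ennreal (chord x y powr s * inverse (chord x y ^ CARD('n))) =
       ennreal (pf y / pf x * (kern x y * chord x y powr s))"
      by (simp add: ennreal_mult'[symmetric] less_imp_le)
  qed
  finally show ?thesis ..
qed

text \<open>The weighted coefficient of \<open>v1 x * v2 x\<close> in the sphere form; its integral
  in \<open>y\<close> is independent of \<open>x\<close>.\<close>

definition wker :: "real \<Rightarrow> real ^ 'n \<Rightarrow> real ^ 'n \<Rightarrow> real" where
  "wker s x y = pf y / pf x * (kern x y * chord x y powr s)"

text \<open>The weighted coefficient of \<open>v1 x * v2 x\<close> in the near part of
  \<open>E_L\<close>.\<close>

definition nker :: "real \<Rightarrow> real ^ 'n \<Rightarrow> real ^ 'n \<Rightarrow> real" where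
  "nker s x y = (if norm (x - y) < 1 then kern x y * chord x y powr s else 0)"

lemma wker_nonneg: "0 \<le> wker s x y"
  by (simp add: wker_def kern_nonneg less_imp_le)

lemma nker_nonneg: "0 \<le> nker s x y"
  by (simp add: nker_def kern_nonneg)

lemma borel_wker [measurable]: "(\<lambda>p. wker s (fst p) (snd p)) \<in> borel_measurable (lborel \<Otimes>\<^sub>M lborel)"
  unfolding wker_def by measurable

lemma borel_wker1 [measurable]: "wker s x \<in> borel_measurable borel"
  unfolding wker_def[abs_def] by measurable

lemma borel_nker [measurable]: "(\<lambda>p. nker s (fst p) (snd p)) \<in> borel_measurable (lborel \<Otimes>\<^sub>M lborel)"
  unfolding nker_def by measurable

lemma borel_nker1 [measurable]: "nker s x \<in> borel_measurable borel"
  unfolding nker_def[abs_def] by measurable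

text \<open>Within unit distance \<open>pf y / pf x\<close> is at least
  \<open>3 powr - (N/2)\<close>, so \<open>nker\<close> inherits finiteness of its mass from
  \<open>wker\<close>.\<close>

lemma nker_le_wker: "nker s x y \<le> 3 powr (real CARD('n) / 2) * wker s x (y :: real ^ 'n)"
proof (cases "norm (x - y) < 1")
  case True
  have "conf_factor x powr (real CARD('n) / 2) \<le> (3 * conf_factor y) powr (real CARD('n) / 2)"
    using conf_factor_ratio[of x y] True by (intro powr_mono2) (auto simp: less_imp_le)
  then have "pf x \<le> 3 powr (real CARD('n) / 2) * pf y"
    by (simp add: pf_def powr_mult less_imp_le)
  then have "1 \<le> 3 powr (real CARD('n) / 2) * (pf y / pf x)"
    by (simp add: field_simps)
  then have "1 * (kern x y * chord x y powr s) \<le> 3 powr (real CARD('n) / 2) * (pf y / pf x) * (kern x y * chord x y powr s)"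
    by (intro mult_right_mono) (auto simp: kern_nonneg)
  then show ?thesis using True by (simp add: nker_def wker_def mult.assoc)
qed (simp add: nker_def wker_nonneg)

lemma nn_integral_wker: "s > 0 \<Longrightarrow> (\<integral>\<^sup>+y. ennreal (wker s x (y :: real ^ 'n)) \<partial>lborel) = ennreal (zonal_mass CARD('n) s)"
  unfolding wker_def by (rule nn_integral_weighted_kern)

lemma nn_integral_nker_le:
  assumes "s > 0"
  shows "(\<integral>\<^sup>+y. ennreal (nker s x (y :: real ^ 'n)) \<partial>lborel) \<le> ennreal (3 powr (real CARD('n) / 2) * zonal_mass CARD('n) s)"
proof -
  have "(\<integral>\<^sup>+y. ennreal (nker s x (y :: real ^ 'n)) \<partial>lborel) \<le> (\<integral>\<^sup>+y. ennreal (3 powr (real CARD('n) / 2)) * ennreal (wker s x y) \<partial>lborel)"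
    using nker_le_wker[of s x] by (intro nn_integral_mono) (simp add: ennreal_mult'[symmetric] ennreal_leI)
  also have "\<dots> = ennreal (3 powr (real CARD('n) / 2) * zonal_mass CARD('n) s)"
    by (subst nn_integral_cmult) (simp_all add: nn_integral_wker[OF assms] ennreal_mult')
  finally show ?thesis .
qed

lemma integrable_wker: "s > 0 \<Longrightarrow> integrable lborel (wker s x)"
  by (intro integrableI_bounded) (simp_all add: nn_integral_wker wker_nonneg)

lemma integrable_nker: "s > 0 \<Longrightarrow> integrable lborel (nker s x)"
  using le_less_trans[OF nn_integral_nker_le[of s x]]
  by (intro integrableI_bounded) (simp_all add: nker_nonneg)

lemma integral_wker: "s > 0 \<Longrightarrow> (\<integral>y. wker s x (y :: real ^ 'n) \<partial>lborel) = zonal_mass CARD('n) s"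
  using zonal_mass_nonneg[of "CARD('n)" s]
  by (subst integral_eq_nn_integral) (simp_all add: nn_integral_wker wker_nonneg)

text \<open>The local mass \<open>q\<^sub>s(x)\<close>.\<close>

definition near_mass :: "real \<Rightarrow> real ^ 'n \<Rightarrow> real" where
  "near_mass s x = (\<integral>y. nker s x y \<partial>lborel)"

lemma ball_power_integral:
  fixes x :: "real ^ 'n"
  assumes t: "t > 0"
  defines "f \<equiv> \<lambda>y. if norm (x - y) < 1 then kern x y * norm (x - y) powr t else 0"
  shows "integrable lborel f" "(\<integral>y. f y \<partial>lborel) = sphere_area CARD('n) / t"
proof -
  have [measurable]: "f \<in> borel_measurable borel" unfolding f_def by measurable
  have nn: "0 \<le> f y" for y by (simp add: f_def kern_nonneg)
  have eq: "(\<integral>\<^sup>+y. ennreal (f y) \<partial>lborel) = ennreal (sphere_area CARD('n) / t)"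
    unfolding nn_integral_ball_power[OF t, of x, symmetric] f_def kern_def
    by (intro nn_integral_cong) (auto simp: indicator_def dist_norm mult.commute)
  show "integrable lborel f"
    using eq nn by (intro integrableI_bounded) simp_all
  show "(\<integral>y. f y \<partial>lborel) = sphere_area CARD('n) / t"
    using eq nn t sphere_area_pos[of "CARD('n)"] by (subst integral_eq_nn_integral) auto
qed

text \<open>With the conformal factor frozen at \<open>x\<close> the integral is radial and
  explicit. The error integrates to at most \<open>2 * s * sphere_area N / (s + 1)\<close>.\<close>

lemma near_mass_approx:
  fixes x :: "real ^ 'n"
  assumes s: "0 < s" "s \<le> 1"
  shows "\<bar>near_mass s x - sphere_area CARD('n) * conf_factor x powr s / s\<bar> \<le> 2 * s * sphere_area CARD('n)"
proof -
  let ?f = "\<lambda>t y. if norm (x - y) < 1 then kern x y * norm (x - y) powr t else 0"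
  have W: "sphere_area CARD('n) > 0" by (rule sphere_area_pos) simp
  have "near_mass s x - sphere_area CARD('n) * conf_factor x powr s / s =
     (\<integral>y. nker s x y - conf_factor x powr s * ?f s y \<partial>lborel)"
    using s ball_power_integral[OF s(1), of x] integrable_nker[OF s(1), of x]
    by (subst Bochner_Integration.integral_diff) (auto simp: near_mass_def)
  moreover have "\<bar>\<integral>y. nker s x y - conf_factor x powr s * ?f s y \<partial>lborel\<bar> \<le> (\<integral>y. 2 * s * ?f (s + 1) y \<partial>lborel)"
  proof (rule order_trans[OF integral_abs_bound integral_mono])
    show "integrable lborel (\<lambda>y. \<bar>nker s x y - conf_factor x powr s * ?f s y\<bar>)"
      using ball_power_integral(1)[OF s(1), of x] integrable_nker[OF s(1), of x] by (intro integrable_abs) auto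
    show "integrable lborel (\<lambda>y. 2 * s * ?f (s + 1) y)"
      using ball_power_integral(1)[of "s + 1" x] s by (intro integrable_mult_right) auto
    fix y
    show "\<bar>nker s x y - conf_factor x powr s * ?f s y\<bar> \<le> 2 * s * ?f (s + 1) y"
    proof (cases "norm (x - y) < 1")
      case True
      then have "nker s x y - conf_factor x powr s * ?f s y = kern x y * (chord x y powr s - conf_factor x powr s * norm (x - y) powr s)"
        by (simp add: nker_def right_diff_distrib)
      then have "\<bar>nker s x y - conf_factor x powr s * ?f s y\<bar> = kern x y * \<bar>chord x y powr s - conf_factor x powr s * norm (x - y) powr s\<bar>"
        by (simp only: abs_mult abs_of_nonneg[OF kern_nonneg])
      also have "\<dots> \<le> kern x y * (2 * s * norm (x - y) powr (s + 1))"
        by (intro mult_left_mono chord_powr_approx s kern_nonneg)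
      finally show ?thesis using True by (simp add: mult_ac)
    qed (simp add: nker_def)
  qed
  moreover have "(\<integral>y. 2 * s * ?f (s + 1) y \<partial>lborel) = 2 * s * (sphere_area CARD('n) / (s + 1))"
    using ball_power_integral(2)[of "s + 1" x] s by simp
  moreover have "2 * s * (sphere_area CARD('n) / (s + 1)) \<le> 2 * s * sphere_area CARD('n)"
  proof -
    have "sphere_area CARD('n) / (s + 1) \<le> sphere_area CARD('n) / 1" using W s by (intro divide_left_mono) auto
    then show ?thesis using s by (intro mult_left_mono) auto
  qed
  ultimately show ?thesis by linarith
qed

definition mass_limit :: "nat \<Rightarrow> real" where
  "mass_limit n = sphere_area n * (ln 2 - euler_mascheroni / 2 - Digamma (real n / 2) / 2)"

text \<open>Dominated convergence is applied along a sequence; this one stays in the range where the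
  weight is at most 2.\<close>

definition sseq :: "nat \<Rightarrow> real" where
  "sseq k = 1 / real (Suc k)"

lemma sseq_bounds: "0 < sseq k" "sseq k \<le> 1"
  by (simp_all add: sseq_def)

lemma sseq_tendsto_0: "sseq \<longlonglongrightarrow> 0"
  using LIMSEQ_inverse_real_of_nat by (simp add: inverse_eq_divide sseq_def[abs_def])

lemma sseq_lim: "filterlim sseq (at_right 0) sequentially"
  using sseq_tendsto_0 sseq_bounds(1) by (auto simp: filterlim_at less_imp_neq[THEN not_sym] intro!: always_eventually)

text \<open>The singular parts \<open>?W / s\<close> cancel. What the local mass adds is
  \<open>?W * (conf_factor x powr s - 1) / s\<close>, a difference quotient with limit
  \<open>?W * ln (conf_factor x)\<close>.\<close>

lemma zonal_minus_near_mass_limit: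
  fixes x :: "real ^ 'n"
  shows "(\<lambda>k. zonal_mass CARD('n) (sseq k) - near_mass (sseq k) x) \<longlonglongrightarrow> mass_limit CARD('n) - sphere_area CARD('n) * ln (conf_factor x)"
proof -
  let ?W = "sphere_area CARD('n)"
  let ?l = "ln (conf_factor x)"
  have 1: "(\<lambda>k. zonal_mass CARD('n) (sseq k) - ?W / sseq k) \<longlonglongrightarrow> mass_limit CARD('n)"
    unfolding mass_limit_def
    by (rule filterlim_compose[OF zonal_mass_asymptotics sseq_lim]) simp
  have "((\<lambda>s. exp (s * ?l)) has_real_derivative ?l) (at 0)"
    by (auto intro!: derivative_eq_intros)
  then have "((\<lambda>s. (exp (s * ?l) - 1) / s) \<longlongrightarrow> ?l) (at 0)"
    by (simp add: has_field_derivative_iff)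
  then have "((\<lambda>s. (exp (s * ?l) - 1) / s) \<longlongrightarrow> ?l) (at_right 0)"
    by (rule filterlim_at_split[THEN iffD1, THEN conjunct2])
  then have 2: "(\<lambda>k. ?W * ((exp (sseq k * ?l) - 1) / sseq k)) \<longlonglongrightarrow> ?W * ?l"
    by (intro tendsto_intros filterlim_compose[OF _ sseq_lim])
  have 3: "(\<lambda>k. near_mass (sseq k) x - ?W * conf_factor x powr sseq k / sseq k) \<longlonglongrightarrow> 0"
  proof (rule Lim_null_comparison)
    show "eventually (\<lambda>k. norm (near_mass (sseq k) x - ?W * conf_factor x powr sseq k / sseq k) \<le> 2 * sseq k * ?W) sequentially"
      using near_mass_approx[OF sseq_bounds, of _ x] by (auto intro!: always_eventually)
    have "(\<lambda>k. 2 * sseq k * ?W) \<longlonglongrightarrow> 2 * 0 * ?W" by (intro tendsto_intros sseq_tendsto_0)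
    then show "(\<lambda>k. 2 * sseq k * ?W) \<longlonglongrightarrow> 0" by simp
  qed
  have "(\<lambda>k. (zonal_mass CARD('n) (sseq k) - ?W / sseq k) - ?W * ((exp (sseq k * ?l) - 1) / sseq k)
      - (near_mass (sseq k) x - ?W * conf_factor x powr sseq k / sseq k)) \<longlonglongrightarrow> mass_limit CARD('n) - ?W * ?l - 0"
    by (intro tendsto_diff 1 2 3)
  moreover have "(zonal_mass CARD('n) (sseq k) - ?W / sseq k) - ?W * ((exp (sseq k * ?l) - 1) / sseq k)
      - (near_mass (sseq k) x - ?W * conf_factor x powr sseq k / sseq k) = zonal_mass CARD('n) (sseq k) - near_mass (sseq k) x" for k
  proof -
    have "exp (sseq k * ?l) = conf_factor x powr sseq k" by (simp add: powr_def)
    moreover have "(a - w / t) - w * ((p - 1) / t) - (b - w * p / t) = a - b" for a w t p b :: real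
      by (simp add: diff_divide_distrib right_diff_distrib)
    ultimately show ?thesis by (simp only:)
  qed
  ultimately show ?thesis by (simp only: diff_0_right)
qed

text \<open>Uniformity in \<open>k\<close> provides the dominating function; the logarithm is
  harmless after multiplication by compactly supported functions.\<close>

lemma zonal_minus_near_mass_bound:
  "\<exists>M. \<forall>k. \<forall>x :: real ^ 'n. \<bar>zonal_mass CARD('n) (sseq k) - near_mass (sseq k) x\<bar> \<le> M + 2 * sphere_area CARD('n) * \<bar>ln (conf_factor x)\<bar>"
proof -
  let ?W = "sphere_area CARD('n)"
  have W: "?W > 0" by (rule sphere_area_pos) simp
  have "(\<lambda>k. zonal_mass CARD('n) (sseq k) - ?W / sseq k) \<longlonglongrightarrow> mass_limit CARD('n)"
    unfolding mass_limit_def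
    by (rule filterlim_compose[OF zonal_mass_asymptotics sseq_lim]) simp
  then have "Bseq (\<lambda>k. zonal_mass CARD('n) (sseq k) - ?W / sseq k)"
    by (intro convergent_imp_Bseq convergentI)
  then obtain M where M: "\<And>k. \<bar>zonal_mass CARD('n) (sseq k) - ?W / sseq k\<bar> \<le> M"
    by (auto simp: Bseq_def)
  have "\<bar>zonal_mass CARD('n) (sseq k) - near_mass (sseq k) x\<bar> \<le> (M + 2 * ?W) + 2 * ?W * \<bar>ln (conf_factor x)\<bar>"
    for k and x :: "real ^ 'n"
  proof -
    let ?s = "sseq k" let ?l = "ln (conf_factor x)"
    have e: "exp (?s * ?l) = conf_factor x powr ?s" by (simp add: powr_def)
    have "\<bar>exp (?s * ?l) - exp 0\<bar> \<le> 2 * \<bar>?s * ?l - 0\<bar>"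
      using conf_factor_powr_le[OF sseq_bounds, of x k] by (intro exp_diff_le) (auto simp: e)
    then have "\<bar>conf_factor x powr ?s - 1\<bar> \<le> 2 * (?s * \<bar>?l\<bar>)" using sseq_bounds(1)[of k] by (simp add: e abs_mult)
    then have "?W / ?s * \<bar>conf_factor x powr ?s - 1\<bar> \<le> ?W / ?s * (2 * (?s * \<bar>?l\<bar>))"
      using W sseq_bounds[of k] by (intro mult_left_mono) auto
    also have "\<dots> = 2 * ?W * \<bar>?l\<bar>" using sseq_bounds(1)[of k] by simp
    finally have 1: "\<bar>?W * conf_factor x powr ?s / ?s - ?W / ?s\<bar> \<le> 2 * ?W * \<bar>?l\<bar>"
    proof -
      have "?W * conf_factor x powr ?s / ?s - ?W / ?s = ?W / ?s * (conf_factor x powr ?s - 1)"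
        by (simp add: right_diff_distrib)
      moreover have "\<bar>?W / ?s * (conf_factor x powr ?s - 1)\<bar> = ?W / ?s * \<bar>conf_factor x powr ?s - 1\<bar>"
        using W sseq_bounds(1)[of k] by (simp add: abs_mult)
      moreover assume "?W / ?s * \<bar>conf_factor x powr ?s - 1\<bar> \<le> 2 * ?W * \<bar>?l\<bar>"
      ultimately show ?thesis by simp
    qed
    have "2 * ?s * ?W \<le> 2 * 1 * ?W" using W sseq_bounds[of k] by (intro mult_right_mono mult_left_mono) auto
    then have 2: "\<bar>near_mass ?s x - ?W * conf_factor x powr ?s / ?s\<bar> \<le> 2 * ?W"
      using near_mass_approx[OF sseq_bounds, of k x] by simp
    show ?thesis using 1 2 M[of k] by linarith
  qed
  then show ?thesis by blast
qed

section \<open>Integrability on the product space and removal of the weight\<close>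

lemma integrable_pair_bound:
  fixes F :: "'a::euclidean_space \<Rightarrow> 'a \<Rightarrow> real"
  assumes m: "(\<lambda>p. F (fst p) (snd p)) \<in> borel_measurable (lborel \<Otimes>\<^sub>M lborel)"
    and le: "\<And>x. (\<integral>\<^sup>+y. ennreal \<bar>F x y\<bar> \<partial>lborel) \<le> ennreal (b x)" and b: "integrable lborel b"
  shows "integrable (lborel \<Otimes>\<^sub>M lborel) (\<lambda>p. F (fst p) (snd p))"
proof (rule integrableI_bounded[OF m])
  have "(\<integral>\<^sup>+p. ennreal (norm (F (fst p) (snd p))) \<partial>(lborel \<Otimes>\<^sub>M lborel)) = (\<integral>\<^sup>+x. \<integral>\<^sup>+y. ennreal \<bar>F x y\<bar> \<partial>lborel \<partial>lborel)"
    using m by (subst lborel.nn_integral_fst[symmetric]) auto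
  also have "\<dots> \<le> (\<integral>\<^sup>+x. ennreal (norm (b x)) \<partial>lborel)"
    by (intro nn_integral_mono order_trans[OF le] ennreal_leI) auto
  also have "\<dots> < \<infinity>" using b by (simp add: integrable_iff_bounded)
  finally show "(\<integral>\<^sup>+p. ennreal (norm (F (fst p) (snd p))) \<partial>(lborel \<Otimes>\<^sub>M lborel)) < \<infinity>" .
qed

lemma integrable_compact_support:
  fixes f :: "'a::euclidean_space \<Rightarrow> real"
  assumes "continuous_on UNIV f" "\<And>x. norm x > R \<Longrightarrow> f x = 0"
  shows "integrable lborel f"
proof -
  have "integrable lborel (\<lambda>x. indicator (cball 0 R) x *\<^sub>R f x)"
    using assms(1) by (intro borel_integrable_compact) (auto intro: continuous_on_subset)
  moreover have "(\<lambda>x. indicator (cball 0 R) x *\<^sub>R f x) = f"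
    using assms(2) by (auto simp: fun_eq_iff indicator_def not_le)
  ultimately show ?thesis by simp
qed

lemma integrable_nker_mult:
  fixes f :: "real ^ 'n \<Rightarrow> real"
  assumes "s > 0" "integrable lborel f"
  shows "integrable (lborel \<Otimes>\<^sub>M lborel) (\<lambda>p. nker s (fst p) (snd p) * f (fst p))"
proof (rule integrable_pair_bound)
  have [measurable]: "f \<in> borel_measurable borel" using assms(2) by auto
  show "(\<lambda>p. nker s (fst p) (snd p) * f (fst p)) \<in> borel_measurable (lborel \<Otimes>\<^sub>M lborel)" by measurable
  show "integrable lborel (\<lambda>x. \<bar>f x\<bar> * (3 powr (real CARD('n) / 2) * zonal_mass CARD('n) s))"
    using assms(2) by auto
  fix x
  have "(\<integral>\<^sup>+y. ennreal \<bar>nker s x y * f x\<bar> \<partial>lborel) = ennreal \<bar>f x\<bar> * (\<integral>\<^sup>+y. ennreal (nker s x y) \<partial>lborel)"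
    by (subst nn_integral_cmult[symmetric]) (auto simp: abs_mult nker_nonneg ennreal_mult'[symmetric] mult.commute)
  also have "\<dots> \<le> ennreal \<bar>f x\<bar> * ennreal (3 powr (real CARD('n) / 2) * zonal_mass CARD('n) s)"
    by (intro mult_left_mono nn_integral_nker_le assms) auto
  finally show "(\<integral>\<^sup>+y. ennreal \<bar>nker s x y * f x\<bar> \<partial>lborel) \<le> ennreal (\<bar>f x\<bar> * (3 powr (real CARD('n) / 2) * zonal_mass CARD('n) s))"
    by (simp only: ennreal_mult'[symmetric] abs_ge_zero)
qed

lemma integrable_wker_mult:
  fixes f :: "real ^ 'n \<Rightarrow> real"
  assumes "s > 0" "integrable lborel f"
  shows "integrable (lborel \<Otimes>\<^sub>M lborel) (\<lambda>p. wker s (fst p) (snd p) * f (fst p))"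
proof (rule integrable_pair_bound)
  have [measurable]: "f \<in> borel_measurable borel" using assms(2) by auto
  show "(\<lambda>p. wker s (fst p) (snd p) * f (fst p)) \<in> borel_measurable (lborel \<Otimes>\<^sub>M lborel)" by measurable
  show "integrable lborel (\<lambda>x. \<bar>f x\<bar> * zonal_mass CARD('n) s)"
    using assms(2) by auto
  fix x
  have "(\<integral>\<^sup>+y. ennreal \<bar>wker s x y * f x\<bar> \<partial>lborel) = ennreal \<bar>f x\<bar> * (\<integral>\<^sup>+y. ennreal (wker s x y) \<partial>lborel)"
    by (subst nn_integral_cmult[symmetric]) (auto simp: abs_mult wker_nonneg ennreal_mult'[symmetric] mult.commute)
  then show "(\<integral>\<^sup>+y. ennreal \<bar>wker s x y * f x\<bar> \<partial>lborel) \<le> ennreal (\<bar>f x\<bar> * zonal_mass CARD('n) s)"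
    by (simp add: nn_integral_wker[OF assms(1)] ennreal_mult'[symmetric])
qed

text \<open>The integrand of the sphere form for \<open>u = v / pf\<close> in stereographic
  coordinates, with densities and chordal kernel already merged by
  \<open>inverse_chord_power\<close>.\<close>

definition sphere_integrand :: "(real ^ 'n \<Rightarrow> real) \<Rightarrow> (real ^ 'n \<Rightarrow> real) \<Rightarrow> real ^ 'n \<Rightarrow> real ^ 'n \<Rightarrow> real" where
  "sphere_integrand v1 v2 x y =
     pf x * pf y * ((v1 x / pf x - v1 y / pf y) * (v2 x / pf x - v2 y / pf y)) * kern x y"

definition near_integrand :: "(real ^ 'n \<Rightarrow> real) \<Rightarrow> (real ^ 'n \<Rightarrow> real) \<Rightarrow> real ^ 'n \<Rightarrow> real ^ 'n \<Rightarrow> real" where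
  "near_integrand v1 v2 x y = (if norm (x - y) < 1 then (v1 x - v1 y) * (v2 x - v2 y) * kern x y else 0)"

text \<open>Keeps the asymmetric product \<open>v1 x * v2 y\<close> found in \<open>E_L\<close>; its
  mirror image is matched by swapping the variables under the integral.\<close>

definition far_integrand :: "(real ^ 'n \<Rightarrow> real) \<Rightarrow> (real ^ 'n \<Rightarrow> real) \<Rightarrow> real ^ 'n \<Rightarrow> real ^ 'n \<Rightarrow> real" where
  "far_integrand v1 v2 x y = (if norm (x - y) < 1 then 0 else v1 x * v2 y * kern x y)"

text \<open>The last two terms cancel after integration, as the product measure is symmetric.\<close>

lemma integrand_identity:
  "(sphere_integrand v1 v2 x y - near_integrand v1 v2 x y + 2 * far_integrand v1 v2 x y) * chord x y powr s =
   (wker s x y - nker s x y) * (v1 x * v2 x) + (wker s y x - nker s y x) * (v1 y * v2 y)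
     + far_integrand v1 v2 x y * chord x y powr s - far_integrand v1 v2 y x * chord y x powr s"
proof -
  have sph: "sphere_integrand v1 v2 x y =
      kern x y * (pf y / pf x * (v1 x * v2 x) + pf x / pf y * (v1 y * v2 y) - v1 x * v2 y - v1 y * v2 x)"
    by (simp add: sphere_integrand_def field_simps)
  show ?thesis
    unfolding sph near_integrand_def far_integrand_def wker_def nker_def
      kern_commute[of y x] chord_commute[of y x] norm_minus_commute[of y x]
    by (simp add: algebra_simps)
qed

lemma integrable_swap:
  fixes F :: "real ^ 'n \<Rightarrow> real ^ 'n \<Rightarrow> real"
  assumes "integrable (lborel \<Otimes>\<^sub>M lborel) (\<lambda>p. F (fst p) (snd p))"
  shows "integrable (lborel \<Otimes>\<^sub>M lborel) (\<lambda>p. F (snd p) (fst p))"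
    "(\<integral>p. F (snd p) (fst p) \<partial>(lborel \<Otimes>\<^sub>M lborel)) = (\<integral>p. F (fst p) (snd p) \<partial>(lborel \<Otimes>\<^sub>M lborel))"
proof -
  have eq: "(\<lambda>(x, y). (\<lambda>p. F (fst p) (snd p)) (y, x)) = (\<lambda>p. F (snd p) (fst p))"
    by (auto simp: fun_eq_iff)
  show "integrable (lborel \<Otimes>\<^sub>M lborel) (\<lambda>p. F (snd p) (fst p))"
    using lborel_pair.integrable_product_swap[OF assms] unfolding eq .
  show "(\<integral>p. F (snd p) (fst p) \<partial>(lborel \<Otimes>\<^sub>M lborel)) = (\<integral>p. F (fst p) (snd p) \<partial>(lborel \<Otimes>\<^sub>M lborel))"
    using lborel_pair.integral_product_swap[OF borel_measurable_integrable[OF assms]] unfolding eq .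
qed

text \<open>The exponent is written as \<open>powr 2\<close> so that multiplication by the kernel
  yields the weighted kernels \<open>wker\<close> and \<open>nker\<close> at \<open>s = 2\<close>,
  whose masses are finite.\<close>

lemma chord_bound:
  assumes "Ck_on (Suc 0) UNIV a" "Ck_on (Suc 0) UNIV b"
    and "\<And>x. norm x > R \<Longrightarrow> a x = 0" "\<And>x. norm x > R \<Longrightarrow> b x = (0::real)"
  shows "\<exists>C\<ge>0. \<forall>x y :: real ^ 'n. \<bar>(a x - a y) * (b x - b y)\<bar> \<le> C * chord x y powr 2"
proof -
  obtain C1 where C1: "C1 \<ge> 0" "\<And>x y. (a x - a y)\<^sup>2 \<le> C1 * (chord x y)\<^sup>2"
    using C1_compact_support_chord_Lipschitz[OF assms(1,3)] by blast
  obtain C2 where C2: "C2 \<ge> 0" "\<And>x y. (b x - b y)\<^sup>2 \<le> C2 * (chord x y)\<^sup>2"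
    using C1_compact_support_chord_Lipschitz[OF assms(2,4)] by blast
  have "\<bar>(a x - a y) * (b x - b y)\<bar> \<le> (C1 + C2) * chord x y powr 2" for x y
  proof -
    have "\<bar>p * q\<bar> \<le> p\<^sup>2 + q\<^sup>2" for p q :: real
      using sum_squares_bound[of "\<bar>p\<bar>" "\<bar>q\<bar>"] abs_ge_zero[of "p * q"]
      unfolding abs_mult power2_abs by linarith
    from this[of "a x - a y" "b x - b y"] C1(2)[of x y] C2(2)[of x y]
    show ?thesis by (simp add: powr_numeral chord_nonneg distrib_right)
  qed
  then show ?thesis using C1(1) C2(1) by (intro exI[of _ "C1 + C2"]) auto
qed

lemma Ck1_div_pf:
  assumes "Ck_on (Suc 0) UNIV v"
  shows "Ck_on (Suc 0) UNIV (\<lambda>x :: real ^ 'n. v x / pf x)"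
proof -
  have "Ck_on (Suc 0) UNIV (\<lambda>x :: real ^ 'n. conf_factor x powr (- (real CARD('n) / 2)) *\<^sub>R v x)"
    by (intro Ck_on_scaleR Ck1_conf_factor_powr assms) auto
  then show ?thesis by (simp add: pf_def powr_minus_divide)
qed

context
  fixes v1 v2 :: "real ^ 'n \<Rightarrow> real" and R :: real
  assumes C1: "Ck_on (Suc 0) UNIV v1" "Ck_on (Suc 0) UNIV v2"
    and supp: "\<And>x. norm x > R \<Longrightarrow> v1 x = 0" "\<And>x. norm x > R \<Longrightarrow> v2 x = 0"
begin

lemma continuous_v: "continuous_on UNIV v1" "continuous_on UNIV v2"
  using C1[THEN Ck_on_SucD[OF open_UNIV]] by simp_all

lemma measurable_v [measurable]: "v1 \<in> borel_measurable borel" "v2 \<in> borel_measurable borel"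
  using continuous_v by (auto intro: borel_measurable_continuous_onI)

lemma integrable_v: "integrable lborel v1" "integrable lborel v2"
  using continuous_v supp by (auto intro!: integrable_compact_support[of _ R])

lemma integrable_prod: "integrable lborel (\<lambda>x. v1 x * v2 x)"
  using continuous_v supp by (intro integrable_compact_support[of _ R] continuous_intros) auto

lemma integrable_prod_ln: "integrable lborel (\<lambda>x. v1 x * v2 x * ln (conf_factor x))"
  using continuous_v supp
  by (intro integrable_compact_support[of _ R] continuous_intros continuous_conf_factor) auto

lemma integrable_sphere_integrand:
  "integrable (lborel \<Otimes>\<^sub>M lborel) (\<lambda>p. sphere_integrand v1 v2 (fst p) (snd p))"
proof -
  obtain C where C: "C \<ge> 0" "\<And>x y. \<bar>(v1 x / pf x - v1 y / pf y) * (v2 x / pf x - v2 y / pf y)\<bar> \<le> C * chord x y powr 2"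
  proof -
    have "\<exists>C\<ge>0. \<forall>x y. \<bar>(v1 x / pf x - v1 y / pf y) * (v2 x / pf x - v2 y / pf y)\<bar> \<le> C * chord x y powr 2"
      by (rule chord_bound[OF Ck1_div_pf[OF C1(1)] Ck1_div_pf[OF C1(2)], of R]) (simp_all add: supp)
    then show ?thesis using that by blast
  qed
  have le: "\<bar>sphere_integrand v1 v2 x y\<bar> \<le> C * conf_factor x ^ CARD('n) * wker 2 x y" for x y
  proof -
    have "\<bar>sphere_integrand v1 v2 x y\<bar> = pf x * pf y * kern x y * \<bar>(v1 x / pf x - v1 y / pf y) * (v2 x / pf x - v2 y / pf y)\<bar>"
      by (simp add: sphere_integrand_def abs_mult kern_nonneg less_imp_le)
    also have "\<dots> \<le> pf x * pf y * kern x y * (C * chord x y powr 2)"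
      by (intro mult_left_mono C(2) mult_nonneg_nonneg) (auto simp: kern_nonneg less_imp_le)
    also have "\<dots> = C * conf_factor x ^ CARD('n) * wker 2 x y"
      by (simp add: pf_sq[symmetric] wker_def)
    finally show ?thesis .
  qed
  show ?thesis
  proof (rule integrable_pair_bound)
    show "(\<lambda>p. sphere_integrand v1 v2 (fst p) (snd p)) \<in> borel_measurable (lborel \<Otimes>\<^sub>M lborel)"
      unfolding sphere_integrand_def by measurable
    show "integrable lborel (\<lambda>x :: real ^ 'n. C * conf_factor x ^ CARD('n) * zonal_mass CARD('n) 2)"
      using integrable_conf_factor_power[where 'n = 'n] by auto
    fix x
    have "(\<integral>\<^sup>+y. ennreal \<bar>sphere_integrand v1 v2 x y\<bar> \<partial>lborel) \<le> (\<integral>\<^sup>+y. ennreal (C * conf_factor x ^ CARD('n)) * ennreal (wker 2 x y) \<partial>lborel)"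
      using le[of x] C(1) by (intro nn_integral_mono) (simp add: ennreal_mult'[symmetric] ennreal_leI less_imp_le)
    also have "\<dots> = ennreal (C * conf_factor x ^ CARD('n) * zonal_mass CARD('n) 2)"
      using C(1) by (subst nn_integral_cmult) (simp_all add: nn_integral_wker ennreal_mult' less_imp_le)
    finally show "(\<integral>\<^sup>+y. ennreal \<bar>sphere_integrand v1 v2 x y\<bar> \<partial>lborel) \<le> ennreal (C * conf_factor x ^ CARD('n) * zonal_mass CARD('n) 2)" .
  qed
qed

lemma integrable_near_integrand:
  "integrable (lborel \<Otimes>\<^sub>M lborel) (\<lambda>p. near_integrand v1 v2 (fst p) (snd p))"
proof -
  obtain C where C: "C \<ge> 0" "\<And>x y. \<bar>(v1 x - v1 y) * (v2 x - v2 y)\<bar> \<le> C * chord x y powr 2"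
  proof -
    have "\<exists>C\<ge>0. \<forall>x y. \<bar>(v1 x - v1 y) * (v2 x - v2 y)\<bar> \<le> C * chord x y powr 2"
      by (rule chord_bound[OF C1, of R]) (simp_all add: supp)
    then show ?thesis using that by blast
  qed
  \<comment> \<open>The radius is enlarged by 1: if \<open>norm x > R + 1\<close>, every
    \<open>y\<close> at distance below 1 is outside the support as well.\<close>
  have le: "\<bar>near_integrand v1 v2 x y\<bar> \<le> C * (nker 2 x y * indicator (cball 0 (R + 1)) x)" for x y
  proof (cases "norm (x - y) < 1 \<and> norm x \<le> R + 1")
    case True
    have "\<bar>(v1 x - v1 y) * (v2 x - v2 y)\<bar> * kern x y \<le> C * chord x y powr 2 * kern x y"
      by (intro mult_right_mono C(2) kern_nonneg)
    then show ?thesis using True by (simp add: near_integrand_def nker_def abs_mult kern_nonneg mult_ac)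
  next
    case False
    have "near_integrand v1 v2 x y = 0"
    proof (cases "norm (x - y) < 1")
      case True
      then have "norm x > R + 1" using False by simp
      moreover from this have "norm y > R"
        using True norm_triangle_ineq[of "x - y" y] by simp
      ultimately show ?thesis using supp by (simp add: near_integrand_def)
    qed (simp add: near_integrand_def)
    then show ?thesis using C(1) by (simp add: nker_nonneg)
  qed
  have i: "integrable (lborel \<Otimes>\<^sub>M lborel) (\<lambda>p. C * (nker 2 (fst p) (snd p) * indicator (cball (0 :: real ^ 'n) (R + 1)) (fst p)))"
    by (intro integrable_mult_right integrable_nker_mult integrable_real_indicator)
      (use emeasure_bounded_finite[OF bounded_cball[of "0 :: real ^ 'n" "R + 1"]] in auto)
  show ?thesis
  proof (rule Bochner_Integration.integrable_bound[OF i])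
    show "(\<lambda>p. near_integrand v1 v2 (fst p) (snd p)) \<in> borel_measurable (lborel \<Otimes>\<^sub>M lborel)"
      unfolding near_integrand_def by measurable
    show "AE p in lborel \<Otimes>\<^sub>M lborel. norm (near_integrand v1 v2 (fst p) (snd p)) \<le> norm (C * (nker 2 (fst p) (snd p) * indicator (cball (0 :: real ^ 'n) (R + 1)) (fst p)))"
      unfolding real_norm_def by (intro always_eventually allI order_trans[OF le abs_ge_self])
  qed
qed

lemma integrable_far_integrand:
  "integrable (lborel \<Otimes>\<^sub>M lborel) (\<lambda>p. far_integrand v1 v2 (fst p) (snd p))"
proof (rule integrable_pair_bound)
  show "(\<lambda>p. far_integrand v1 v2 (fst p) (snd p)) \<in> borel_measurable (lborel \<Otimes>\<^sub>M lborel)"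
    unfolding far_integrand_def by measurable
  show "integrable lborel (\<lambda>x. \<bar>v1 x\<bar> * (\<integral>y. \<bar>v2 y\<bar> \<partial>lborel))"
    using integrable_v by auto
  fix x
  have "\<bar>far_integrand v1 v2 x y\<bar> \<le> \<bar>v1 x\<bar> * \<bar>v2 y\<bar>" for y
  proof (cases "norm (x - y) < 1")
    case False
    then have "1 \<le> norm (x - y) ^ CARD('n)" by (intro one_le_power) simp
    then have "kern x y \<le> 1" unfolding kern_def by (intro inverse_le_1_iff[THEN iffD2]) auto
    then have "\<bar>v1 x * v2 y\<bar> * kern x y \<le> \<bar>v1 x * v2 y\<bar> * 1" by (intro mult_left_mono) auto
    then show ?thesis using False by (simp add: far_integrand_def abs_mult kern_nonneg)
  qed (simp add: far_integrand_def)
  then have "(\<integral>\<^sup>+y. ennreal \<bar>far_integrand v1 v2 x y\<bar> \<partial>lborel) \<le> (\<integral>\<^sup>+y. ennreal \<bar>v1 x\<bar> * ennreal \<bar>v2 y\<bar> \<partial>lborel)"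
    by (intro nn_integral_mono) (simp add: ennreal_mult'[symmetric] ennreal_leI)
  also have "\<dots> = ennreal \<bar>v1 x\<bar> * ennreal (\<integral>y. \<bar>v2 y\<bar> \<partial>lborel)"
    using integrable_v(2) by (subst nn_integral_cmult) (auto simp: nn_integral_eq_integral)
  finally show "(\<integral>\<^sup>+y. ennreal \<bar>far_integrand v1 v2 x y\<bar> \<partial>lborel) \<le> ennreal (\<bar>v1 x\<bar> * (\<integral>y. \<bar>v2 y\<bar> \<partial>lborel))"
    by (simp add: ennreal_mult'[symmetric])
qed

text \<open>The combination in which the cross terms cancel after integration. Its three terms are
  integrable without any weight, so its integral can be found as a limit and then solved for the
  sphere term.\<close>

definition combined :: "(real ^ 'n) \<times> (real ^ 'n) \<Rightarrow> real" where
  "combined p = sphere_integrand v1 v2 (fst p) (snd p) - near_integrand v1 v2 (fst p) (snd p)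
     + 2 * far_integrand v1 v2 (fst p) (snd p)"

lemma integrable_combined: "integrable (lborel \<Otimes>\<^sub>M lborel) combined"
  unfolding combined_def[abs_def]
  using integrable_sphere_integrand integrable_near_integrand integrable_far_integrand by auto

text \<open>Only for \<open>s > 0\<close> can the diagonal terms be split off: \<open>wker\<close>
  and \<open>nker\<close> are then integrable in \<open>y\<close> separately, and integration
  replaces them by their masses.\<close>

lemma regularized_identity:
  assumes s: "0 < s" "s \<le> 1"
  shows "(\<integral>p. combined p * chord (fst p) (snd p) powr s \<partial>(lborel \<Otimes>\<^sub>M lborel)) =
    2 * (\<integral>x. v1 x * v2 x * (zonal_mass CARD('n) s - near_mass s x) \<partial>lborel)"
proof -
  let ?P = "lborel \<Otimes>\<^sub>M lborel :: ((real ^ 'n) \<times> (real ^ 'n)) measure"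
  define Z where "Z x y = (wker s x y - nker s x y) * (v1 x * v2 x)" for x y
  define Fs where "Fs x y = far_integrand v1 v2 x y * chord x y powr s" for x y
  have Z: "integrable ?P (\<lambda>p. Z (fst p) (snd p))"
    unfolding Z_def left_diff_distrib
    using integrable_wker_mult[OF s(1) integrable_prod] integrable_nker_mult[OF s(1) integrable_prod] by auto
  have Fs: "integrable ?P (\<lambda>p. Fs (fst p) (snd p))"
  proof (rule Bochner_Integration.integrable_bound)
    show "integrable ?P (\<lambda>p. 2 * far_integrand v1 v2 (fst p) (snd p))"
      using integrable_far_integrand by auto
    show "(\<lambda>p. Fs (fst p) (snd p)) \<in> borel_measurable ?P"
      unfolding Fs_def far_integrand_def by measurable
    have "\<bar>far_integrand v1 v2 x y * chord x y powr s\<bar> \<le> \<bar>2 * far_integrand v1 v2 x y\<bar>" for x y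
      using mult_left_mono[OF chord_powr_le[OF s, of x y], of "\<bar>far_integrand v1 v2 x y\<bar>"] by (simp add: abs_mult mult.commute)
    then show "AE p in ?P. norm (Fs (fst p) (snd p)) \<le> norm (2 * far_integrand v1 v2 (fst p) (snd p))"
      by (simp add: Fs_def)
  qed
  have "(\<integral>p. combined p * chord (fst p) (snd p) powr s \<partial>?P) =
     (\<integral>p. Z (fst p) (snd p) + Z (snd p) (fst p) + Fs (fst p) (snd p) - Fs (snd p) (fst p) \<partial>?P)"
    unfolding combined_def integrand_identity Z_def Fs_def ..
  also have "\<dots> = 2 * (\<integral>p. Z (fst p) (snd p) \<partial>?P)"
    using Z Fs integrable_swap[OF Z] integrable_swap[OF Fs] by simp
  also have "(\<integral>p. Z (fst p) (snd p) \<partial>?P) = (\<integral>x. \<integral>y. Z x y \<partial>lborel \<partial>lborel)"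
    using lborel_pair.integral_fst'[OF Z] by simp
  also have "\<dots> = (\<integral>x. v1 x * v2 x * (zonal_mass CARD('n) s - near_mass s x) \<partial>lborel)"
  proof (rule Bochner_Integration.integral_cong[OF refl])
    fix x
    show "(\<integral>y. Z x y \<partial>lborel) = v1 x * v2 x * (zonal_mass CARD('n) s - near_mass s x)"
      unfolding Z_def using integrable_wker[OF s(1), of x] integrable_nker[OF s(1), of x]
      by (simp add: integral_wker[OF s(1)] near_mass_def)
  qed
  finally show ?thesis .
qed

lemma integral_combined:
  "(\<integral>p. combined p \<partial>(lborel \<Otimes>\<^sub>M lborel)) =
    2 * (\<integral>x. v1 x * v2 x * (mass_limit CARD('n) - sphere_area CARD('n) * ln (conf_factor x)) \<partial>lborel)"
proof -
  let ?P = "lborel \<Otimes>\<^sub>M lborel :: ((real ^ 'n) \<times> (real ^ 'n)) measure"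
  have cm [measurable]: "combined \<in> borel_measurable ?P"
    using integrable_combined by auto
  have "(\<lambda>k. \<integral>p. combined p * chord (fst p) (snd p) powr sseq k \<partial>?P) \<longlonglongrightarrow> (\<integral>p. combined p \<partial>?P)"
  proof (rule integral_dominated_convergence[where w = "\<lambda>p. 2 * \<bar>combined p\<bar>"])
    show "integrable ?P (\<lambda>p. 2 * \<bar>combined p\<bar>)" using integrable_combined by auto
    show "AE p in ?P. (\<lambda>k. combined p * chord (fst p) (snd p) powr sseq k) \<longlonglongrightarrow> combined p"
    proof (intro always_eventually allI)
      fix p
      show "(\<lambda>k. combined p * chord (fst p) (snd p) powr sseq k) \<longlonglongrightarrow> combined p"
      proof (cases "chord (fst p) (snd p) = 0")
        \<comment> \<open>On the diagonal the weight is \<open>0 powr s = 0\<close> and does not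
          tend to 1, but \<open>combined\<close> vanishes there.\<close>
        case True
        then have "fst p = snd p" by (auto simp: chord_eq)
        then have "combined p = 0"
          by (simp add: combined_def sphere_integrand_def near_integrand_def far_integrand_def kern_def)
        then show ?thesis by simp
      next
        case False
        have "(\<lambda>k. combined p * chord (fst p) (snd p) powr sseq k) \<longlonglongrightarrow> combined p * chord (fst p) (snd p) powr 0"
          using False by (intro tendsto_intros sseq_tendsto_0) auto
        then show ?thesis using False by simp
      qed
    qed
    show "AE p in ?P. norm (combined p * chord (fst p) (snd p) powr sseq k) \<le> 2 * \<bar>combined p\<bar>" for k
      using mult_left_mono[OF chord_powr_le[OF sseq_bounds], of "\<bar>combined _\<bar>"]
      by (intro always_eventually allI) (simp add: abs_mult mult.commute)
  qed measurable
  moreover have "(\<lambda>k. \<integral>p. combined p * chord (fst p) (snd p) powr sseq k \<partial>?P) =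
     (\<lambda>k. 2 * (\<integral>x. v1 x * v2 x * (zonal_mass CARD('n) (sseq k) - near_mass (sseq k) x) \<partial>lborel))"
    by (rule ext) (rule regularized_identity[OF sseq_bounds])
  moreover have lim: "(\<lambda>k. \<integral>x. v1 x * v2 x * (zonal_mass CARD('n) (sseq k) - near_mass (sseq k) x) \<partial>lborel)
     \<longlonglongrightarrow> (\<integral>x. v1 x * v2 x * (mass_limit CARD('n) - sphere_area CARD('n) * ln (conf_factor x)) \<partial>lborel)"
  proof -
    obtain M where M: "\<And>k x. \<bar>zonal_mass CARD('n) (sseq k) - near_mass (sseq k) (x :: real ^ 'n)\<bar> \<le> M + 2 * sphere_area CARD('n) * \<bar>ln (conf_factor x)\<bar>"
      using zonal_minus_near_mass_bound by blast
    have nm [measurable]: "near_mass s \<in> borel_measurable (borel :: (real ^ 'n) measure)" for s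
    proof -
      have "(\<lambda>(x, y). nker s x (y :: real ^ 'n)) \<in> borel_measurable (lborel \<Otimes>\<^sub>M lborel)"
        using borel_nker[of s] by (simp add: case_prod_beta)
      from lborel.borel_measurable_lebesgue_integral[OF this] show ?thesis
        by (simp add: near_mass_def[abs_def])
    qed
    show ?thesis
    proof (rule integral_dominated_convergence[where w = "\<lambda>x. M * \<bar>v1 x * v2 x\<bar> + 2 * sphere_area CARD('n) * \<bar>v1 x * v2 x * ln (conf_factor x)\<bar>"])
      show "integrable lborel (\<lambda>x. M * \<bar>v1 x * v2 x\<bar> + 2 * sphere_area CARD('n) * \<bar>v1 x * v2 x * ln (conf_factor x)\<bar>)"
        using integrable_prod integrable_prod_ln by (intro Bochner_Integration.integrable_add integrable_mult_right integrable_abs)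
      show "AE x in lborel. (\<lambda>k. v1 x * v2 x * (zonal_mass CARD('n) (sseq k) - near_mass (sseq k) x)) \<longlonglongrightarrow>
         v1 x * v2 x * (mass_limit CARD('n) - sphere_area CARD('n) * ln (conf_factor x))"
        by (intro always_eventually allI tendsto_mult tendsto_const zonal_minus_near_mass_limit)
      show "AE x in lborel. norm (v1 x * v2 x * (zonal_mass CARD('n) (sseq k) - near_mass (sseq k) x)) \<le>
         M * \<bar>v1 x * v2 x\<bar> + 2 * sphere_area CARD('n) * \<bar>v1 x * v2 x * ln (conf_factor x)\<bar>" for k
      proof (intro always_eventually allI)
        fix x
        have "\<bar>v1 x * v2 x\<bar> * \<bar>zonal_mass CARD('n) (sseq k) - near_mass (sseq k) x\<bar> \<le> \<bar>v1 x * v2 x\<bar> * (M + 2 * sphere_area CARD('n) * \<bar>ln (conf_factor x)\<bar>)"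
          by (intro mult_left_mono M) auto
        then show "norm (v1 x * v2 x * (zonal_mass CARD('n) (sseq k) - near_mass (sseq k) x)) \<le>
          M * \<bar>v1 x * v2 x\<bar> + 2 * sphere_area CARD('n) * \<bar>v1 x * v2 x * ln (conf_factor x)\<bar>"
          by (simp add: abs_mult distrib_left mult_ac)
      qed
    qed measurable
  qed
  ultimately show ?thesis
    using LIMSEQ_unique[OF _ tendsto_mult_left[OF lim, of 2]] by simp
qed

lemma integral_sphere_integrand:
  "(\<integral>p. sphere_integrand v1 v2 (fst p) (snd p) \<partial>(lborel \<Otimes>\<^sub>M lborel)) =
    (\<integral>p. near_integrand v1 v2 (fst p) (snd p) \<partial>(lborel \<Otimes>\<^sub>M lborel))
     - 2 * (\<integral>p. far_integrand v1 v2 (fst p) (snd p) \<partial>(lborel \<Otimes>\<^sub>M lborel))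
     + 2 * (mass_limit CARD('n) * (\<integral>x. v1 x * v2 x \<partial>lborel) - sphere_area CARD('n) * (\<integral>x. v1 x * v2 x * ln (conf_factor x) \<partial>lborel))"
proof -
  have "(\<integral>x. v1 x * v2 x * (mass_limit CARD('n) - sphere_area CARD('n) * ln (conf_factor x)) \<partial>lborel) =
     (\<integral>x. mass_limit CARD('n) * (v1 x * v2 x) - sphere_area CARD('n) * (v1 x * v2 x * ln (conf_factor x)) \<partial>lborel)"
    by (intro Bochner_Integration.integral_cong) (auto simp: algebra_simps)
  also have "\<dots> = mass_limit CARD('n) * (\<integral>x. v1 x * v2 x \<partial>lborel) - sphere_area CARD('n) * (\<integral>x. v1 x * v2 x * ln (conf_factor x) \<partial>lborel)"
    using integrable_prod integrable_prod_ln by simp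
  finally show ?thesis
    using integral_combined integrable_sphere_integrand integrable_near_integrand integrable_far_integrand
    by (simp add: combined_def)
qed

lemma E_L_eq:
  "E_L v1 v2 = c_const CARD('n) / 2 * (\<integral>p. near_integrand v1 v2 (fst p) (snd p) \<partial>(lborel \<Otimes>\<^sub>M lborel))
     - c_const CARD('n) * (\<integral>p. far_integrand v1 v2 (fst p) (snd p) \<partial>(lborel \<Otimes>\<^sub>M lborel))
     + rho_const CARD('n) * (\<integral>x. v1 x * v2 x \<partial>lborel)"
proof -
  have "(LINT x|lborel. (LINT y:ball x 1|lborel. (v1 x - v1 y) * (v2 x - v2 y) / norm (x - y) ^ CARD('n))) =
     (\<integral>x. \<integral>y. near_integrand v1 v2 x y \<partial>lborel \<partial>lborel)"
    unfolding set_lebesgue_integral_def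
    by (intro Bochner_Integration.integral_cong refl)
      (auto simp: near_integrand_def kern_def indicator_def dist_norm divide_inverse)
  also have "\<dots> = (\<integral>p. near_integrand v1 v2 (fst p) (snd p) \<partial>(lborel \<Otimes>\<^sub>M lborel))"
    using lborel_pair.integral_fst'[OF integrable_near_integrand] by simp
  finally have 1: "(LINT x|lborel. (LINT y:ball x 1|lborel. (v1 x - v1 y) * (v2 x - v2 y) / norm (x - y) ^ CARD('n))) =
     (\<integral>p. near_integrand v1 v2 (fst p) (snd p) \<partial>(lborel \<Otimes>\<^sub>M lborel))" .
  have 2: "(LINT p:{p. norm (fst p - snd p) \<ge> 1}|lborel \<Otimes>\<^sub>M lborel. v1 (fst p) * v2 (snd p) / norm (fst p - snd p) ^ CARD('n)) =
     (\<integral>p. far_integrand v1 v2 (fst p) (snd p) \<partial>(lborel \<Otimes>\<^sub>M lborel))"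
    unfolding set_lebesgue_integral_def
    by (intro Bochner_Integration.integral_cong refl)
      (auto simp: far_integrand_def kern_def indicator_def divide_inverse)
  show ?thesis unfolding E_L_def 1 2 ..
qed

end

section \<open>Test functions and the final formula\<close>

lemma Cc_smoothD:
  assumes "v \<in> Cc_smooth"
  shows "Ck_on (Suc 0) UNIV v" "\<exists>R. \<forall>x. norm x > R \<longrightarrow> v x = 0"
proof -
  show "Ck_on (Suc 0) UNIV v" using assms unfolding Cc_smooth_def smooth_on_open_def by blast
  have "compact (closure {x. v x \<noteq> 0})" using assms by (simp add: Cc_smooth_def)
  then have "bounded {x. v x \<noteq> 0}"
    by (rule bounded_subset[OF compact_imp_bounded closure_subset])
  then obtain R where "\<forall>x\<in>{x. v x \<noteq> 0}. norm x \<le> R" unfolding bounded_iff ..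
  then show "\<exists>R. \<forall>x. norm x > R \<longrightarrow> v x = 0" by (intro exI[of _ R]) fastforce
qed

lemma iota_inv_inv_stereo: "iota_inv v (inv_stereo x) = v x / pf x"
  by (simp add: iota_inv_def pf_def powr_minus_divide)

text \<open>Off the pole the preimage is Lipschitz for the chordal distance, so the energy density
  is at most a constant times \<open>|z - \<zeta>|\<^sup>2\<^sup>-\<^sup>N\<close>, whose mass is
  \<open>zonal_mass N 2\<close>.\<close>

lemma iota_inv_in_H_space:
  fixes v :: "real ^ 'n \<Rightarrow> real"
  assumes v: "v \<in> Cc_smooth" and \<kappa>: "\<kappa> > 0"
  shows "iota_inv v \<in> H_space \<kappa>"
proof -
  let ?S = "sphere_vol :: ((real ^ 'n) \<times> real) measure"
  let ?p = "(0, - 1) :: (real ^ 'n) \<times> real"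
  obtain R where C1: "Ck_on (Suc 0) UNIV v" and R: "\<And>x. norm x > R \<Longrightarrow> v x = 0"
    using Cc_smoothD[OF v] by blast
  have vm: "v \<in> borel_measurable borel" by (rule measurable_v(1)[OF C1 C1 R R])
  have um [measurable]: "iota_inv v \<in> borel_measurable ?S" by (rule iota_inv_measurable[OF vm])
  have "v \<in> L2_space lborel"
    using integrable_prod[OF C1 C1 R R] vm by (simp add: L2_space_def power2_eq_square)
  then have uL: "iota_inv v \<in> L2_space ?S" using iota_L2_iff[OF um] by simp
  obtain C where C: "C \<ge> 0" "\<And>x y. (v x / pf x - v y / pf y)\<^sup>2 \<le> C * (chord x y)\<^sup>2"
  proof -
    have "\<exists>C\<ge>0. \<forall>x y. (v x / pf x - v y / pf y)\<^sup>2 \<le> C * (chord x y)\<^sup>2"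
      by (rule C1_compact_support_chord_Lipschitz[OF Ck1_div_pf[OF C1], of R]) (simp add: R)
    then show ?thesis using that by blast
  qed
  have "unit_sphere - {?p} \<in> sets borel"
    by (intro sets.Diff borel_closed closed_unit_sphere closed_singleton)
  moreover have "{z \<in> unit_sphere. z \<noteq> ?p} = unit_sphere - {?p}" by auto
  ultimately have "{z \<in> unit_sphere. z \<noteq> ?p} \<in> sets borel" by (simp only:)
  from AE_sphere_vol[OF this] have pole: "AE z in ?S. z \<noteq> ?p" by simp
  \<comment> \<open>The pole is excluded because \<open>stereo\<close> has the default value 0
    there, so \<open>iota_inv v\<close> takes a value determined by \<open>v 0\<close> and unrelated
    to those nearby.\<close>
  have Lip: "(iota_inv v z - iota_inv v \<zeta>)\<^sup>2 \<le> C * (norm (z - \<zeta>))\<^sup>2"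
    if zz: "z \<in> unit_sphere" "z \<noteq> ?p" "\<zeta> \<in> unit_sphere" "\<zeta> \<noteq> ?p" for z \<zeta>
    using C(2)[of "stereo z" "stereo \<zeta>"] zz
    by (simp add: iota_inv_inv_stereo[symmetric] inv_stereo_stereo chord_def)
  have "(\<integral>\<^sup>+z. (\<integral>\<^sup>+\<zeta>. ennreal ((iota_inv v z - iota_inv v \<zeta>)\<^sup>2 / norm (z - \<zeta>) ^ CARD('n)) \<partial>?S) \<partial>?S) \<le>
     (\<integral>\<^sup>+z. ennreal (C * zonal_mass CARD('n) 2) \<partial>?S)"
  proof (rule nn_integral_mono_AE)
    show "AE z in ?S. (\<integral>\<^sup>+\<zeta>. ennreal ((iota_inv v z - iota_inv v \<zeta>)\<^sup>2 / norm (z - \<zeta>) ^ CARD('n)) \<partial>?S) \<le> ennreal (C * zonal_mass CARD('n) 2)"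
      using pole AE_space
    proof eventually_elim
      case (elim z)
      then have z: "z \<in> unit_sphere" "z \<noteq> ?p" by (auto simp: space_sphere_vol)
      have "(\<integral>\<^sup>+\<zeta>. ennreal ((iota_inv v z - iota_inv v \<zeta>)\<^sup>2 / norm (z - \<zeta>) ^ CARD('n)) \<partial>?S) \<le>
        (\<integral>\<^sup>+\<zeta>. ennreal C * ennreal (norm (z - \<zeta>) powr 2 * inverse (norm (z - \<zeta>) ^ CARD('n))) \<partial>?S)"
      proof (rule nn_integral_mono_AE)
        show "AE \<zeta> in ?S. ennreal ((iota_inv v z - iota_inv v \<zeta>)\<^sup>2 / norm (z - \<zeta>) ^ CARD('n)) \<le>
           ennreal C * ennreal (norm (z - \<zeta>) powr 2 * inverse (norm (z - \<zeta>) ^ CARD('n)))"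
          using pole AE_space
        proof eventually_elim
          case (elim \<zeta>)
          then have "(iota_inv v z - iota_inv v \<zeta>)\<^sup>2 * inverse (norm (z - \<zeta>) ^ CARD('n)) \<le> C * (norm (z - \<zeta>))\<^sup>2 * inverse (norm (z - \<zeta>) ^ CARD('n))"
            using z by (intro mult_right_mono Lip) (auto simp: space_sphere_vol)
          then show ?case
            using C(1) by (simp add: ennreal_mult'[symmetric] powr_numeral divide_inverse mult.assoc ennreal_leI)
        qed
      qed
      also have "\<dots> = ennreal C * ennreal (zonal_mass CARD('n) 2)"
        using nn_integral_zonal[OF z(1), of 2] by (subst nn_integral_cmult) simp_all
      finally show ?case using C(1) by (simp add: ennreal_mult')
    qed
  qed
  also have "\<dots> < \<infinity>"
    by (simp add: sphere.emeasure_eq_measure ennreal_mult_less_top)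
  finally have "(\<integral>\<^sup>+z. (\<integral>\<^sup>+\<zeta>. ennreal ((iota_inv v z - iota_inv v \<zeta>)\<^sup>2 / norm (z - \<zeta>) ^ CARD('n)) \<partial>?S) \<partial>?S) < \<infinity>" .
  then show ?thesis
    using uL by (auto simp: H_space_def H_sqnorm_ext_def L2_space_iff ennreal_mult_less_top)
qed

lemma H_inner_iota_inv:
  fixes v1 v2 :: "real ^ 'n \<Rightarrow> real"
  assumes v: "v1 \<in> Cc_smooth" "v2 \<in> Cc_smooth"
  shows "H_inner \<kappa> (iota_inv v1) (iota_inv v2) =
    E_L v1 v2 + (LINT x|lborel. v1 x * v2 x * (\<kappa> - A_const CARD('n) + ln (conf_factor x powr (-2))))"
proof -
  let ?S = "sphere_vol :: ((real ^ 'n) \<times> real) measure"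
  let ?u1 = "iota_inv v1" and ?u2 = "iota_inv v2"
  obtain R1 R2 where R1: "\<And>x. norm x > R1 \<Longrightarrow> v1 x = 0" and R2: "\<And>x. norm x > R2 \<Longrightarrow> v2 x = 0"
    using Cc_smoothD(2)[OF v(1)] Cc_smoothD(2)[OF v(2)] by blast
  define R where "R = max R1 R2"
  have R: "\<And>x. norm x > R \<Longrightarrow> v1 x = 0" "\<And>x. norm x > R \<Longrightarrow> v2 x = 0"
    using R1 R2 by (auto simp: R_def)
  note C1 = Cc_smoothD(1)[OF v(1)] Cc_smoothD(1)[OF v(2)]
  note facts = C1 R
  have um [measurable]: "?u1 \<in> borel_measurable ?S" "?u2 \<in> borel_measurable ?S"
    using measurable_v[OF facts] by (auto intro: iota_inv_measurable)
  have "(LINT z|?S. LINT \<zeta>|?S. (?u1 z - ?u1 \<zeta>) * (?u2 z - ?u2 \<zeta>) / norm (z - \<zeta>) ^ CARD('n)) =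
     (\<integral>x. \<integral>y. sphere_integrand v1 v2 x y \<partial>lborel \<partial>lborel)"
  proof -
    \<comment> \<open>The two sphere integrals are transformed one at a time, for which
      measurability suffices. Integrability enters when the iterated Euclidean integral becomes an
      integral over the product.\<close>
    let ?G = "\<lambda>z \<zeta>. (?u1 z - ?u1 \<zeta>) * (?u2 z - ?u2 \<zeta>) * inverse (norm (z - \<zeta>) ^ CARD('n))"
    have Gm [measurable]: "(\<lambda>p. ?G (fst p) (snd p)) \<in> borel_measurable (?S \<Otimes>\<^sub>M ?S)" by measurable
    have G1: "?G z \<in> borel_measurable ?S" for z by measurable
    have G2: "(\<lambda>z. \<integral>\<zeta>. ?G z \<zeta> \<partial>?S) \<in> borel_measurable ?S"
      using sphere.borel_measurable_lebesgue_integral[of "\<lambda>z \<zeta>. ?G z \<zeta>" ?S] Gm by (simp add: case_prod_beta)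
    have "(LINT z|?S. LINT \<zeta>|?S. ?G z \<zeta>) = (\<integral>x. conf_factor x ^ CARD('n) * (\<integral>\<zeta>. ?G (inv_stereo x) \<zeta> \<partial>?S) \<partial>lborel)"
      by (rule integral_sphere_vol[OF G2])
    also have "\<dots> = (\<integral>x. conf_factor x ^ CARD('n) * (\<integral>y. conf_factor y ^ CARD('n) * ?G (inv_stereo x) (inv_stereo y) \<partial>lborel) \<partial>lborel)"
      by (subst integral_sphere_vol[OF G1]) (rule refl)
    also have "\<dots> = (\<integral>x. \<integral>y. conf_factor x ^ CARD('n) * (conf_factor y ^ CARD('n) * ?G (inv_stereo x) (inv_stereo y)) \<partial>lborel \<partial>lborel)"
      by (simp only: integral_mult_right_zero)
    also have "\<dots> = (\<integral>x. \<integral>y. sphere_integrand v1 v2 x y \<partial>lborel \<partial>lborel)"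
    proof (intro Bochner_Integration.integral_cong refl)
      fix x y :: "real ^ 'n"
      let ?d = "(v1 x / pf x - v1 y / pf y) * (v2 x / pf x - v2 y / pf y)"
      have "conf_factor x ^ CARD('n) * (conf_factor y ^ CARD('n) * ?G (inv_stereo x) (inv_stereo y)) =
        pf x * pf y * ?d * (pf x * pf y * inverse (chord x y ^ CARD('n)))"
        unfolding iota_inv_inv_stereo pf_sq[symmetric] chord_def by (simp add: mult_ac)
      then show "conf_factor x ^ CARD('n) * (conf_factor y ^ CARD('n) * ?G (inv_stereo x) (inv_stereo y)) = sphere_integrand v1 v2 x y"
        unfolding inverse_chord_power sphere_integrand_def .
    qed
    finally show ?thesis by (simp add: divide_inverse)
  qed
  also have "\<dots> = (\<integral>p. sphere_integrand v1 v2 (fst p) (snd p) \<partial>(lborel \<Otimes>\<^sub>M lborel))"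
    using lborel_pair.integral_fst'[OF integrable_sphere_integrand[OF facts]] by simp
  finally have 1: "(LINT z|?S. LINT \<zeta>|?S. (?u1 z - ?u1 \<zeta>) * (?u2 z - ?u2 \<zeta>) / norm (z - \<zeta>) ^ CARD('n)) = \<dots>" .
  have 2: "(LINT z|?S. ?u1 z * ?u2 z) = (\<integral>x. v1 x * v2 x \<partial>lborel)"
    using L2_inner_iota[OF um] by (simp add: L2_inner_def)
  let ?I = "\<integral>x. v1 x * v2 x \<partial>lborel" and ?J = "\<integral>x. v1 x * v2 x * ln (conf_factor x) \<partial>lborel"
  have 3: "(LINT x|lborel. v1 x * v2 x * (\<kappa> - A_const CARD('n) + ln (conf_factor x powr (-2)))) =
     (\<kappa> - A_const CARD('n)) * ?I - 2 * ?J"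
  proof -
    have "(LINT x|lborel. v1 x * v2 x * (\<kappa> - A_const CARD('n) + ln (conf_factor x powr (-2)))) =
       (LINT x|lborel. (\<kappa> - A_const CARD('n)) * (v1 x * v2 x) - 2 * (v1 x * v2 x * ln (conf_factor x)))"
      by (intro Bochner_Integration.integral_cong refl) (simp add: ln_powr algebra_simps)
    then show ?thesis using integrable_prod[OF facts] integrable_prod_ln[OF facts] by simp
  qed
  define Nr where "Nr = (\<integral>p. near_integrand v1 v2 (fst p) (snd p) \<partial>(lborel \<Otimes>\<^sub>M lborel))"
  define Fr where "Fr = (\<integral>p. far_integrand v1 v2 (fst p) (snd p) \<partial>(lborel \<Otimes>\<^sub>M lborel))"
  have cs: "c_const CARD('n) * sphere_area CARD('n) = 2" by (rule c_const_sphere_area) simp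
  \<comment> \<open>The masses contribute \<open>2 ln 2 - \<gamma> - \<psi>(N/2)\<close>, whereas
    \<open>E_L\<close> already carries \<open>2 ln 2 - \<gamma> + \<psi>(N/2)\<close>. The
    difference \<open>2 \<psi>(N/2)\<close> is the constant subtracted from \<kappa>.\<close>
  have cm: "c_const CARD('n) * mass_limit CARD('n) = rho_const CARD('n) - A_const CARD('n)"
  proof -
    have "c_const CARD('n) * mass_limit CARD('n) =
       (c_const CARD('n) * sphere_area CARD('n)) * (ln 2 - euler_mascheroni / 2 - Digamma (real CARD('n) / 2) / 2)"
      by (simp add: mass_limit_def)
    then show ?thesis unfolding cs by (simp add: rho_const_def A_const_def)
  qed
  have "H_inner \<kappa> ?u1 ?u2 = c_const CARD('n) / 2 * (Nr - 2 * Fr + 2 * (mass_limit CARD('n) * ?I - sphere_area CARD('n) * ?J)) + \<kappa> * ?I"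
  proof -
    have "(\<integral>p. sphere_integrand v1 v2 (fst p) (snd p) \<partial>(lborel \<Otimes>\<^sub>M lborel)) =
       Nr - 2 * Fr + 2 * (mass_limit CARD('n) * ?I - sphere_area CARD('n) * ?J)"
      unfolding Nr_def Fr_def by (rule integral_sphere_integrand[OF facts])
    then show ?thesis unfolding H_inner_def 1 2 by (simp only:)
  qed
  also have "\<dots> = c_const CARD('n) / 2 * Nr - c_const CARD('n) * Fr + (c_const CARD('n) * mass_limit CARD('n)) * ?I
      - (c_const CARD('n) * sphere_area CARD('n)) * ?J + \<kappa> * ?I"
    by (simp add: algebra_simps)
  also have "\<dots> = E_L v1 v2 + ((\<kappa> - A_const CARD('n)) * ?I - 2 * ?J)"
  proof -
    have "E_L v1 v2 = c_const CARD('n) / 2 * Nr - c_const CARD('n) * Fr + rho_const CARD('n) * ?I"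
      unfolding Nr_def Fr_def by (rule E_L_eq[OF facts])
    then show ?thesis unfolding cs cm by (simp add: algebra_simps)
  qed
  finally show ?thesis unfolding 3 .
qed

theorem theorem3p7:
  fixes \<kappa> :: real
  assumes kappa: "\<kappa> > Max {2 * (Digamma (real CARD('n::finite) / 2) - Digamma (real CARD('n) / 4)),
                        A_const CARD('n), 1}"
  shows "hilbert_space_ae lborel (D_space \<kappa> :: ((real ^ 'n) \<Rightarrow> real) set) (D_inner \<kappa>)
    \<and> compactly_embedded (D_space \<kappa> :: ((real ^ 'n) \<Rightarrow> real) set) (norm_of (D_inner \<kappa>))
        (L2_space lborel) (norm_of (L2_inner lborel))
    \<and> isometric_iso_ae
        (sphere_vol :: ((real ^ 'n) \<times> real) measure)
        (L2_space sphere_vol) (norm_of (L2_inner sphere_vol))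
        lborel (L2_space lborel) (norm_of (L2_inner lborel)) iota
    \<and> isometric_iso_ae
        (sphere_vol :: ((real ^ 'n) \<times> real) measure) (H_space \<kappa>) (norm_of (H_inner \<kappa>))
        lborel (D_space \<kappa>) (norm_of (D_inner \<kappa>)) iota
    \<and> (Cc_smooth :: ((real ^ 'n) \<Rightarrow> real) set) \<subseteq> D_space \<kappa>
    \<and> (\<forall>v \<in> (Cc_smooth :: ((real ^ 'n) \<Rightarrow> real) set).
        norm_of (D_inner \<kappa>) v =
          sqrt (E_L v v + (LINT x|lborel. (v x)\<^sup>2 * ln (conf_factor x powr (-2)))
                + (\<kappa> - A_const CARD('n)) * (LINT x|lborel. (v x)\<^sup>2)))
    \<and> (\<forall>v1 \<in> (Cc_smooth :: ((real ^ 'n) \<Rightarrow> real) set). \<forall>v2 \<in> Cc_smooth.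
        D_inner \<kappa> v1 v2 =
          E_L v1 v2 + (LINT x|lborel. v1 x * v2 x *
                        (\<kappa> - A_const CARD('n) + ln (conf_factor x powr (-2)))))"
proof -
  \<comment> \<open>Positivity is read off from the entry 1 of the maximum.\<close>
  have \<kappa>: "\<kappa> > 0" using kappa by simp
  have D: "D_inner \<kappa> v1 v2 = E_L v1 v2 + (LINT x|lborel. v1 x * v2 x * (\<kappa> - A_const CARD('n) + ln (conf_factor x powr (-2))))"
    if "v1 \<in> Cc_smooth" "v2 \<in> Cc_smooth" for v1 v2 :: "real ^ 'n \<Rightarrow> real"
    using D_inner_iota[OF \<kappa> iota_inv_in_H_space[OF that(1) \<kappa>] iota_inv_in_H_space[OF that(2) \<kappa>]]
      H_inner_iota_inv[OF that, of \<kappa>] by simp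
  have N: "norm_of (D_inner \<kappa>) v =
          sqrt (E_L v v + (LINT x|lborel. (v x)\<^sup>2 * ln (conf_factor x powr (-2)))
                + (\<kappa> - A_const CARD('n)) * (LINT x|lborel. (v x)\<^sup>2))" if v: "v \<in> Cc_smooth" for v :: "real ^ 'n \<Rightarrow> real"
  proof -
    obtain R where C1: "Ck_on (Suc 0) UNIV v" and R: "\<And>x. norm x > R \<Longrightarrow> v x = 0"
      using Cc_smoothD[OF v] by blast
    have i1: "integrable lborel (\<lambda>x. (v x)\<^sup>2)"
      using integrable_prod[OF C1 C1 R R] by (simp add: power2_eq_square)
    have i2: "integrable lborel (\<lambda>x. (v x)\<^sup>2 * ln (conf_factor x powr (-2)))"
      using integrable_mult_right[OF integrable_prod_ln[OF C1 C1 R R], of "-2"]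
      by (simp add: power2_eq_square ln_powr mult_ac)
    have "(LINT x|lborel. v x * v x * (\<kappa> - A_const CARD('n) + ln (conf_factor x powr (-2)))) =
       (LINT x|lborel. (v x)\<^sup>2 * ln (conf_factor x powr (-2)) + (\<kappa> - A_const CARD('n)) * (v x)\<^sup>2)"
      by (intro Bochner_Integration.integral_cong refl) (simp add: power2_eq_square algebra_simps)
    also have "\<dots> = (LINT x|lborel. (v x)\<^sup>2 * ln (conf_factor x powr (-2))) + (\<kappa> - A_const CARD('n)) * (LINT x|lborel. (v x)\<^sup>2)"
      using i1 i2 by simp
    finally show ?thesis unfolding norm_of_def D[OF v v] by (simp only: add.assoc)
  qed
  have "(Cc_smooth :: (real ^ 'n \<Rightarrow> real) set) \<subseteq> D_space \<kappa>"
  proof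
    fix v :: "real ^ 'n \<Rightarrow> real" assume "v \<in> Cc_smooth"
    then show "v \<in> D_space \<kappa>"
      unfolding D_space_def by (intro image_eqI[of _ _ "iota_inv v"] iota_inv_in_H_space \<kappa>) simp_all
  qed
  then show ?thesis
    by (intro conjI ballI hilbert_space_D[OF \<kappa>] compactly_embedded_D[OF \<kappa>] isometric_iso_L2
        isometric_iso_H[OF \<kappa>] N D)
qed

end
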